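(* Let $n\ge 1$ be an integer, let $\mathcal{H}$ be a complex Hilbert space, and let $f\in\mathcal{D}(\mathbb{D}^n,\mathcal{H})$. For $\theta\in[0,2\pi)^n$ and $h\in(0,\pi)^n$ let $$F_h(\theta)=\frac{\pi^n}{h_1\cdots h_n}\int_{(\theta_1-h_1,\theta_1+h_1)}\cdots\int_{(\theta_n-h_n,\theta_n+h_n)}f(\psi)\,d\psi.$$ Then $$\lim_{h\to(0,\dots,0)}F_h(\theta)=f(\theta)$$ for quasi-every $\theta$, where the limit is in the norm of $\mathcal{H}$, over $h\in(0,\pi)^n$ without restriction on the relationship between the $h_j$, and $f(\theta)$ denotes the Pringsheim sum.
   Context: Notation: $\mathbb{N}=\{0,1,2,\dots\}$; $(\alpha,\theta)=\alpha_1\theta_1+\cdots+\alpha_n\theta_n$. The set $[0,2\pi)^n$ is identified with the $n$-torus $\mathbb{T}^n$ via $\theta\mapsto(e^{i\theta_1},\dots,e^{i\theta_n})$ (functions on $\mathbb{T}^n$ being regarded as $2\pi$-periodic in each variable), and $d\psi$ denotes normalized Lebesgue measure on $\mathbb{T}^n$, i.e. $d\psi=(2\pi)^{-n}d\psi_1\cdots d\psi_n$ in terms of ordinary Lebesgue measure. Dirichlet space: a multiple Fourier series $f(\theta)\sim\sum_{\alpha\in\mathbb{N}^n}a_\alpha e^{i(\alpha,\theta)}$ with coefficients $a_\alpha\in\mathcal{H}$ belongs to $\mathcal{D}(\mathbb{D}^n,\mathcal{H})$ if $\sum_{\alpha\in\mathbb{N}^n}(\alpha_1+1)\cdots(\alpha_n+1)\|a_\alpha\|_{\mathcal{H}}^2<\infty$.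 Capacity: for a positive measurable function $g$ on $\mathbb{T}^n$ let $$Bg(\theta)=\int_{\mathbb{T}^n}\frac{1}{|e^{i\theta_1}-e^{i\psi_1}|^{1/2}}\cdots\frac{1}{|e^{i\theta_n}-e^{i\psi_n}|^{1/2}}\,g(\psi)\,d\psi\in[0,\infty].$$ For a set $E\subset\mathbb{T}^n$ let $C(E)=\inf\{\|g\|_{L^2(\mathbb{T}^n)}^2 : g\ge 0,\ Bg(\theta)\ge 1 \text{ for all } \theta\in E\}$. A property holds quasi-everywhere (for quasi-every $\theta$) if it holds for all $\theta\in\mathbb{T}^n$ outside a set $E$ with $C(E)=0$. Values of $f$: the series $f(\theta)$ converges in the sense of Pringsheim (at the given $\theta$) if the rectangular partial sums $\sum_{\alpha_1=0}^{N_1}\cdots\sum_{\alpha_n=0}^{N_n}a_\alpha e^{i(\alpha,\theta)}$ converge in $\mathcal{H}$ as $N\in\mathbb{N}^n$, $\min_{1\le j\le n}N_j\to\infty$ (no assumption on the relationship between the $N_j$), and the partial sums are bounded in $\mathcal{H}$ uniformly over $N\in\mathbb{N}^n$. The limit is then the Pringsheim sum, denoted $f(\theta)$; the assertion includes that it exists for quasi-every $\theta$. In the integral defining $F_h$, $f$ is the $\mathcal{H}$-valued function in $L^2(\mathbb{T}^n,\mathcal{H})$ with Fourier coefficients $a_\alpha$ (which agrees almost everywhere with the Pringsheim sum). *)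

theory Defs
  imports "HOL-Analysis.Analysis"
begin

text \<open>Complex Hilbert spaces of arbitrary dimension; separability is not assumed. The inner product
  is linear in its first argument. Positive definiteness follows from \<open>cinner_self\<close> and the norm
  axioms, completeness from the superclass.\<close>

class chilbert_space = banach +
  fixes scaleC :: "complex \<Rightarrow> 'a \<Rightarrow> 'a" (infixr "*\<^sub>C" 75)
    and cinner :: "'a \<Rightarrow> 'a \<Rightarrow> complex"
  assumes scaleC_add_right: "c *\<^sub>C (x + y) = c *\<^sub>C x + c *\<^sub>C y"
    and scaleC_add_left: "(c + d) *\<^sub>C x = c *\<^sub>C x + d *\<^sub>C x"
    and scaleC_scaleC: "c *\<^sub>C d *\<^sub>C x = (c * d) *\<^sub>C x"
    and scaleC_of_real: "complex_of_real r *\<^sub>C x = r *\<^sub>R x"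
    and cinner_commute: "cinner x y = cnj (cinner y x)"
    and cinner_add_left: "cinner (x + y) z = cinner x z + cinner y z"
    and cinner_scaleC_left: "cinner (c *\<^sub>C x) y = c * cinner x y"
    and cinner_self: "cinner x x = complex_of_real ((norm x)\<^sup>2)"

instantiation complex :: chilbert_space
begin

definition scaleC_complex :: "complex \<Rightarrow> complex \<Rightarrow> complex"
  where "scaleC_complex c x = c * x"

definition cinner_complex :: "complex \<Rightarrow> complex \<Rightarrow> complex"
  where "cinner_complex x y = x * cnj y"

instance
proof
  fix x :: complex
  show "cinner x x = complex_of_real ((norm x)\<^sup>2)"
    by (simp only: cinner_complex_def complex_norm_square)
qed (simp_all add: scaleC_complex_def cinner_complex_def ring_distribs scaleR_conv_of_real
    mult.assoc mult.commute)

end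

definition torus :: "(real ^ 'n) set"
  where "torus = {\<theta>. \<forall>i. 0 \<le> \<theta> $ i \<and> \<theta> $ i < 2 * pi}"

definition torus_measure :: "(real ^ 'n) measure"
  where "torus_measure = uniform_measure lebesgue torus"

text \<open>In \<open>ennreal\<close> we have \<open>1 / 0 = \<infinity>\<close>, so the kernel is infinite where some
  \<open>\<theta> $ i = \<psi> $ i\<close> (unless multiplied by \<open>g \<psi> = 0\<close>), a null set of \<open>\<psi>\<close>.\<close>

definition B_potential :: "(real ^ 'n \<Rightarrow> ennreal) \<Rightarrow> real ^ 'n \<Rightarrow> ennreal"
  where "B_potential g \<theta> =
    (\<integral>\<^sup>+\<psi>. (\<Prod>i\<in>UNIV. 1 / ennreal (cmod (cis (\<theta> $ i) - cis (\<psi> $ i)) powr (1/2))) * g \<psi>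
      \<partial>torus_measure)"

definition capacity :: "(real ^ 'n) set \<Rightarrow> ennreal"
  where "capacity E =
    (INF g \<in> {g \<in> borel_measurable lebesgue. \<forall>\<theta>\<in>E. 1 \<le> B_potential g \<theta>}.
      \<integral>\<^sup>+\<psi>. (g \<psi>)\<^sup>2 \<partial>torus_measure)"

definition quasi_everywhere :: "(real ^ 'n \<Rightarrow> bool) \<Rightarrow> bool"
  where "quasi_everywhere P \<longleftrightarrow>
    (\<exists>E \<subseteq> torus. capacity E = 0 \<and> (\<forall>\<theta> \<in> torus - E. P \<theta>))"

definition dirichlet_space :: "(nat ^ 'n \<Rightarrow> 'h::chilbert_space) set"
  where "dirichlet_space =
    {a. (\<lambda>\<alpha>. (\<Prod>i\<in>UNIV. real (\<alpha> $ i) + 1) * (norm (a \<alpha>))\<^sup>2) summable_on UNIV}"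

definition rect_partial_sum ::
    "(nat ^ 'n \<Rightarrow> 'h::chilbert_space) \<Rightarrow> real ^ 'n \<Rightarrow> nat ^ 'n \<Rightarrow> 'h"
  where "rect_partial_sum a \<theta> N =
    (\<Sum>\<alpha> | \<forall>i. \<alpha> $ i \<le> N $ i. cis (\<Sum>i\<in>UNIV. real (\<alpha> $ i) * \<theta> $ i) *\<^sub>C a \<alpha>)"

definition pringsheim_sums ::
    "(nat ^ 'n \<Rightarrow> 'h::chilbert_space) \<Rightarrow> real ^ 'n \<Rightarrow> 'h \<Rightarrow> bool"
  where "pringsheim_sums a \<theta> s \<longleftrightarrow>
    bounded (range (rect_partial_sum a \<theta>)) \<and>
    (rect_partial_sum a \<theta> \<longlongrightarrow> s) (filtercomap (\<lambda>N. Min (range (\<lambda>j. N $ j))) at_top)"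

text \<open>Measurability is strong (Bochner) measurability, as the library's Bochner integral is
  restricted to second countable spaces. For the same reason, integrals of vector-valued functions
  below are Henstock-Kurzweil integrals, which exist and agree with the Bochner integral for every
  Bochner integrable function into a Banach space.\<close>

definition L2_torus :: "(real ^ 'n \<Rightarrow> 'h::banach) set"
  where "L2_torus = {f.
    (\<forall>\<theta> i. f (\<theta> + axis i (2 * pi)) = f \<theta>) \<and>
    (\<exists>s. (\<forall>k::nat. simple_function lebesgue (s k)) \<and>
         (AE \<theta> in lebesgue. (\<lambda>k. s k \<theta>) \<longlonglongrightarrow> f \<theta>)) \<and>
    (\<integral>\<^sup>+\<theta>. ennreal ((norm (f \<theta>))\<^sup>2) \<partial>torus_measure) < \<infinity>}"

definition fourier_coeff :: "(real ^ 'n \<Rightarrow> 'h::chilbert_space) \<Rightarrow> int ^ 'n \<Rightarrow> 'h"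
  where "fourier_coeff f k =
    (1 / (2 * pi) ^ CARD('n)) *\<^sub>R
      integral torus (\<lambda>\<theta>. cis (- (\<Sum>i\<in>UNIV. of_int (k $ i) * \<theta> $ i)) *\<^sub>C f \<theta>)"

definition has_fourier_series ::
    "(real ^ 'n \<Rightarrow> 'h::chilbert_space) \<Rightarrow> (nat ^ 'n \<Rightarrow> 'h) \<Rightarrow> bool"
  where "has_fourier_series f a \<longleftrightarrow>
    (\<forall>k. fourier_coeff f k = (if \<forall>i. 0 \<le> k $ i then a (\<chi> i. nat (k $ i)) else 0))"

text \<open>The factor \<open>1 / (2 * pi) ^ CARD('n)\<close> normalizes Lebesgue measure.\<close>

definition box_mean :: "(real ^ 'n \<Rightarrow> 'h::banach) \<Rightarrow> real ^ 'n \<Rightarrow> real ^ 'n \<Rightarrow> 'h"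
  where "box_mean f h \<theta> =
    (pi ^ CARD('n) / (\<Prod>i\<in>UNIV. h $ i)) *\<^sub>R
      ((1 / (2 * pi) ^ CARD('n)) *\<^sub>R integral (box (\<theta> - h) (\<theta> + h)) f)"

end

theory Submission
  imports Defs
begin

text \<open>Write \<open>a \<alpha> = g \<alpha> / (\<Prod>i. sqrt (\<alpha> i + 1))\<close>, so that \<open>g\<close> is square summable. Both a rectangular partial
  sum and a box mean arise from \<open>g\<close> by convolution with a product of one-dimensional kernels with
  coefficients \<open>\<mu> m / sqrt (m + 1)\<close>, where \<open>\<mu>\<close> is a cutoff or \<open>sinc (m * h)\<close>, and these kernels are
  bounded by a constant multiple of \<open>\<bar>1 - exp (\<i> t)\<bar> powr (-1/2)\<close>, uniformly in the cutoff and in \<open>h\<close>.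
  Split the index set into finite blocks on which the square sums of \<open>g\<close> decay like \<open>16 powr (-k)\<close>, and
  let \<open>u k\<close> be the norm of the trigonometric polynomial of the \<open>k\<close>-th block of \<open>g\<close>. Then
  \<open>G = (SUP k. 2 ^ k * u k)\<close> is in \<open>L\<^sup>2\<close>, so its potential is finite outside a set of capacity zero.
  At such a point the \<open>k\<close>-th block contributes at most a constant times \<open>2 powr (-k)\<close> to every partial sum
  and to every box mean, and converges to the same value in both cases, so dominated convergence of the
  series over the blocks gives the claim.\<close>

subsection \<open>Complex Hilbert spaces\<close>

text \<open>The exponent 1/2 of the potential matches the weights of the Dirichlet space: the
  function with coefficients \<open>1 / sqrt (m + 1)\<close> has a singularity of order
  \<open>t powr (-1/2)\<close> at 0. The obstacle is that both limits are unrestricted in several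
  variables and have to hold off a set of capacity zero, where almost everywhere arguments say
  nothing. Hence all partial sums and box means are dominated at one and the same point by one and
  the same potential. Finiteness of the blocks lets every limit within a block be taken term by
  term, and \<open>g\<close> need never be realized as a function. The decay
  \<open>16 powr (-k)\<close> pays for the squared weights \<open>4 ^ k\<close> and leaves a
  convergent series. A second obstacle is that \<open>f\<close> is given only through its Fourier
  coefficients: that its box means are the sums of the box means of the blocks is proved weakly, by
  testing with trigonometric polynomials that converge boundedly to the indicator of the periodized
  box.\<close>

lemma norm_scaleC: "norm (c *\<^sub>C x) = cmod c * norm (x::'a::chilbert_space)"
proof -
  have "complex_of_real ((norm (c *\<^sub>C x))\<^sup>2) = c * cinner x (c *\<^sub>C x)"
    using cinner_self[of "c *\<^sub>C x"] by (simp add: cinner_scaleC_left)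
  also have "cinner x (c *\<^sub>C x) = cnj c * cinner x x"
    by (metis cinner_commute cinner_scaleC_left complex_cnj_mult)
  also have "c * (cnj c * cinner x x) = complex_of_real ((cmod c)\<^sup>2 * (norm x)\<^sup>2)"
    by (simp only: of_real_mult complex_norm_square cinner_self mult.assoc)
  finally have "(norm (c *\<^sub>C x))\<^sup>2 = (cmod c * norm x)\<^sup>2"
    by (simp only: of_real_eq_iff power_mult_distrib)
  then show ?thesis by (simp add: power2_eq_iff_nonneg)
qed

lemma bounded_linear_scaleC_left: "bounded_linear (\<lambda>c. c *\<^sub>C (x::'a::chilbert_space))"
proof (rule bounded_linear_intro)
  fix r c show "(r *\<^sub>R c) *\<^sub>C x = r *\<^sub>R c *\<^sub>C x"
    by (simp add: scaleR_conv_of_real scaleC_scaleC[symmetric] scaleC_of_real)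
qed (auto simp: scaleC_add_left norm_scaleC)

lemma cinner_scaleC_right: "cinner x (c *\<^sub>C y) = cnj c * cinner x (y::'a::chilbert_space)"
  by (metis cinner_commute cinner_scaleC_left complex_cnj_mult)

lemma cinner_scaleR_left: "cinner (r *\<^sub>R x) y = r *\<^sub>R cinner x (y::'a::chilbert_space)"
  by (metis cinner_scaleC_left scaleC_of_real scaleR_conv_of_real)

lemma cinner_add_right: "cinner x (y + z) = cinner x y + cinner x (z::'a::chilbert_space)"
  by (metis cinner_add_left cinner_commute complex_cnj_add)

lemma cinner_zero_left: "cinner 0 (y::'a::chilbert_space) = 0"
  by (metis cinner_scaleR_left scaleR_zero_left)

lemma cinner_minus_left: "cinner (- x) (y::'a::chilbert_space) = - cinner x y"
  using cinner_scaleR_left[of "-1" x y] by simp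

lemma cinner_Cauchy_Schwarz: "cmod (cinner x y) \<le> norm x * norm (y::'a::chilbert_space)"
proof (cases "y = 0")
  case True
  then show ?thesis by (metis cinner_commute cinner_zero_left complex_cnj_zero norm_zero mult_zero_right order_refl)
next
  case False
  \<comment> \<open>\<open>z\<close> is the component of \<open>x\<close> orthogonal to
    \<open>y\<close>; the inequality says that its squared norm is nonnegative.\<close>
  define c where "c = cinner x y / complex_of_real ((norm y)\<^sup>2)"
  define z where "z = x + (- c) *\<^sub>C y"
  have ny: "complex_of_real ((norm y)\<^sup>2) \<noteq> 0" using False by simp
  have 0: "cinner z y = 0"
    using ny by (simp add: z_def cinner_add_left cinner_scaleC_left cinner_self c_def)
  have "cinner z z = cinner z x"
    using 0 cinner_add_right[of z x "(- c) *\<^sub>C y"] by (simp add: z_def[symmetric] cinner_scaleC_right)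
  also have "\<dots> = cinner x x - c * cinner y x"
    by (simp add: z_def cinner_add_left cinner_scaleC_left)
  also have "c * cinner y x = complex_of_real ((cmod (cinner x y))\<^sup>2 / (norm y)\<^sup>2)"
    by (subst cinner_commute[of y x]) (simp only: c_def of_real_divide complex_norm_square times_divide_eq_left)
  finally have "complex_of_real ((norm z)\<^sup>2) = complex_of_real ((norm x)\<^sup>2 - (cmod (cinner x y))\<^sup>2 / (norm y)\<^sup>2)"
    by (simp add: cinner_self)
  then have "(norm x)\<^sup>2 - (cmod (cinner x y))\<^sup>2 / (norm y)\<^sup>2 \<ge> 0"
    by (metis of_real_eq_iff zero_le_power2)
  then have "(cmod (cinner x y))\<^sup>2 \<le> (norm x * norm y)\<^sup>2"
    using False by (simp add: field_simps power_mult_distrib)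
  then show ?thesis by (rule power2_le_imp_le) simp
qed

lemma bounded_linear_cinner_left: "bounded_linear (\<lambda>x. cinner x (y::'a::chilbert_space))"
  by (rule bounded_linear_intro[where K = "norm y"])
    (auto simp: cinner_add_left cinner_scaleR_left cinner_Cauchy_Schwarz)

lemmas cinner_sum_left = linear_sum[OF bounded_linear.linear[OF bounded_linear_cinner_left]]

text \<open>Identities between vectors are checked weakly, so that only complex-valued integrals
  have to be evaluated.\<close>

lemma cinner_eqI:
  fixes x y :: "'a::chilbert_space"
  assumes "\<And>w. cinner x w = cinner y w"
  shows "x = y"
proof -
  have "cinner (x - y) (x - y) = 0"
    using assms cinner_add_left[of x "- y"] by (simp add: cinner_minus_left)
  then show ?thesis by (simp add: cinner_self)
qed

subsection \<open>Fourier multipliers of the kernel\<close>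

text \<open>Multiplication by \<open>1 - z\<close> turns the sum into boundary terms and a sum over
  differences of \<open>b\<close>, and all powers of \<open>z\<close> have modulus 1.\<close>

lemma Abel_summation_bound:
  fixes b :: "nat \<Rightarrow> real" and z :: complex
  assumes "cmod z = 1" "M \<le> N"
  shows "cmod (1 - z) * cmod (\<Sum>m=M..<N. of_real (b m) * z ^ m)
     \<le> \<bar>b M\<bar> + \<bar>b N\<bar> + (\<Sum>m=M..<N. \<bar>b m - b (Suc m)\<bar>)"
proof -
  have "(1 - z) * (\<Sum>m=M..<N. of_real (b m) * z ^ m) = of_real (b M) * z ^ M - of_real (b N) * z ^ N
     - (\<Sum>m=M..<N. of_real (b m - b (Suc m)) * z ^ Suc m)"
    using assms(2) by (induction rule: dec_induct) (auto simp: algebra_simps)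
  then have "cmod (1 - z) * cmod (\<Sum>m=M..<N. of_real (b m) * z ^ m)
    \<le> cmod (of_real (b M) * z ^ M) + cmod (of_real (b N) * z ^ N)
      + cmod (\<Sum>m=M..<N. of_real (b m - b (Suc m)) * z ^ Suc m)"
    unfolding norm_mult[symmetric] by (smt (verit) norm_triangle_ineq4)
  also have "\<dots> \<le> \<bar>b M\<bar> + \<bar>b N\<bar> + (\<Sum>m=M..<N. \<bar>b m - b (Suc m)\<bar>)"
  proof -
    have "cmod (\<Sum>m=M..<N. of_real (b m - b (Suc m)) * z ^ Suc m)
        \<le> (\<Sum>m=M..<N. \<bar>b m - b (Suc m)\<bar>)"
    proof (rule order_trans[OF norm_sum], rule sum_mono)
      fix m show "cmod (of_real (b m - b (Suc m)) * z ^ Suc m) \<le> \<bar>b m - b (Suc m)\<bar>"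
        using assms(1) unfolding norm_mult norm_power norm_of_real by simp
    qed
    then show ?thesis using assms(1) by (simp add: norm_mult norm_power)
  qed
  finally show ?thesis .
qed

text \<open>The difference of the roots is the reciprocal of their sum, which is at most
  \<open>2 * sqrt (m + 1)\<close>. This makes partial sums of \<open>1 / sqrt (m + 1)\<close>
  telescope to at most \<open>2 * sqrt K\<close>.\<close>

lemma sqrt_diff_le: "1 / sqrt (real m + 1) \<le> 2 * (sqrt (real m + 1) - sqrt (real m))"
proof -
  have "(sqrt (real m + 1) - sqrt (real m)) * (sqrt (real m + 1) + sqrt (real m)) = 1"
    by (simp add: algebra_simps)
  moreover have "sqrt (real m + 1) - sqrt (real m) \<ge> 0" by simp
  ultimately have "1 \<le> (sqrt (real m + 1) - sqrt (real m)) * (2 * sqrt (real m + 1))"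
    by (smt (verit) mult_left_mono real_sqrt_le_mono)
  then show ?thesis by (simp add: field_simps)
qed

lemma inverse_sqrt_diff:
  assumes "x > 0"
  shows "1 / sqrt x - 1 / sqrt (x + 1) = 1 / (sqrt x * sqrt (x + 1) * (sqrt x + sqrt (x + 1)))"
proof -
  have s: "sqrt x > 0" "sqrt (x + 1) > 0" using assms by auto
  have "(sqrt (x + 1) - sqrt x) * (sqrt x + sqrt (x + 1)) = 1"
    using assms by (simp add: algebra_simps)
  then have "sqrt (x + 1) - sqrt x = 1 / (sqrt x + sqrt (x + 1))"
    using s by (metis add_pos_pos nonzero_eq_divide_eq order_less_irrefl)
  moreover have "1 / sqrt x - 1 / sqrt (x + 1) = (sqrt (x + 1) - sqrt x) / (sqrt x * sqrt (x + 1))"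
    using s by (simp add: field_simps)
  ultimately show ?thesis by simp
qed

text \<open>Lets the total variation of the coefficients from a positive index on telescope; each
  \<open>sqrt x\<close> in the denominator of the difference is replaced by
  \<open>sqrt (x + 1)\<close>.\<close>

lemma inverse_three_halves_le_diff:
  assumes "x > 0"
  shows "1 / ((x + 1) * sqrt (x + 1)) \<le> 2 * (1 / sqrt x - 1 / sqrt (x + 1))"
proof -
  have s: "sqrt x > 0" "sqrt (x + 1) > 0" "sqrt x \<le> sqrt (x + 1)" using assms by auto
  let ?D = "sqrt x * sqrt (x + 1) * (sqrt x + sqrt (x + 1))"
  have "?D \<le> sqrt (x + 1) * sqrt (x + 1) * (2 * sqrt (x + 1))"
    using s by (intro mult_mono) auto
  also have "\<dots> = 2 * ((x + 1) * sqrt (x + 1))" using assms by simp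
  finally have "?D \<le> 2 * ((x + 1) * sqrt (x + 1))" .
  then have "2 / (2 * ((x + 1) * sqrt (x + 1))) \<le> 2 / ?D"
    using s assms by (intro divide_left_mono mult_pos_pos add_pos_pos) auto
  then show ?thesis unfolding inverse_sqrt_diff[OF assms] by simp
qed

text \<open>The same denominator is bounded from below instead, which shows that
  \<open>1 / sqrt\<close> itself has the variation required in \<open>kernel_bound\<close>.\<close>

lemma diff_le_inverse_three_halves:
  assumes "x > 0"
  shows "1 / sqrt x - 1 / sqrt (x + 1) \<le> 1 / (x * sqrt x)"
proof -
  have s: "sqrt x > 0" "sqrt (x + 1) > 0" "sqrt x \<le> sqrt (x + 1)" using assms by auto
  have "x * sqrt x = sqrt x * sqrt x * sqrt x" using assms by simp
  also have "\<dots> \<le> sqrt x * sqrt (x + 1) * (sqrt x + sqrt (x + 1))"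
    using s by (intro mult_mono) auto
  finally show ?thesis unfolding inverse_sqrt_diff[OF assms]
    using assms s by (intro divide_left_mono mult_pos_pos add_pos_pos) auto
qed

text \<open>The terms with index below \<open>1 / \<bar>1 - z\<bar>\<close> are estimated absolutely, the others by Abel
  summation.\<close>

lemma kernel_bound:
  fixes b :: "nat \<Rightarrow> real" and z :: complex
  assumes z: "cmod z = 1"
    and b: "\<And>m. \<bar>b m\<bar> \<le> A / sqrt (real m + 1)"
    and d: "\<And>m. \<bar>b m - b (Suc m)\<bar> \<le> A / ((real m + 1) * sqrt (real m + 1))"
  shows "cmod (\<Sum>m<N. of_real (b m) * z ^ m) * sqrt (cmod (1 - z)) \<le> 8 * A"
proof (cases "z = 1")
  case True
  have "0 \<le> A" using b[of 0] by simp
  with True show ?thesis by simp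
next
  case False
  have A: "0 \<le> A" using b[of 0] by simp
  define \<delta> where "\<delta> = cmod (1 - z)"
  have \<delta>: "\<delta> > 0" "\<delta> \<le> 2"
    using False norm_triangle_ineq4[of 1 z] z by (auto simp: \<delta>_def)
  \<comment> \<open>The cut at \<open>1 / \<delta>\<close> balances the two estimates:
    \<open>sqrt M\<close> for the low terms and \<open>1 / (\<delta> * sqrt M)\<close> for the tail
    are both of order \<open>1 / sqrt \<delta>\<close>. Each range contributes
    \<open>4 * A\<close>.\<close>
  define M where "M = nat \<lceil>1 / \<delta>\<rceil>"
  have M1: "real M \<ge> 1 / \<delta>" "real M \<le> 1 / \<delta> + 1" unfolding M_def using \<delta> by (simp_all add: of_nat_ceiling)
  have Mpos: "M > 0" using M1(1) \<delta> by (metis divide_pos_pos gr0I of_nat_0 order_less_le_trans zero_less_one less_irrefl)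
  have low: "cmod (\<Sum>m<K. of_real (b m) * z ^ m) \<le> 2 * A * sqrt K" for K
  proof -
    have "cmod (\<Sum>m<K. of_real (b m) * z ^ m) \<le> (\<Sum>m<K. \<bar>b m\<bar>)"
      using norm_sum[of "\<lambda>m. of_real (b m) * z ^ m" "{..<K}"] z by (simp add: norm_mult norm_power)
    also have "\<dots> \<le> (\<Sum>m<K. A * (2 * (sqrt (real (Suc m)) - sqrt (real m))))"
    proof (rule sum_mono)
      fix m
      have "A * (1 / sqrt (real m + 1)) \<le> A * (2 * (sqrt (real m + 1) - sqrt (real m)))"
        using sqrt_diff_le[of m] A by (rule mult_left_mono)
      then show "\<bar>b m\<bar> \<le> A * (2 * (sqrt (real (Suc m)) - sqrt (real m)))"
        using b[of m] by (simp add: add.commute)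
    qed
    also have "\<dots> = 2 * A * (\<Sum>m<K. sqrt (real (Suc m)) - sqrt (real m))"
      by (simp add: sum_distrib_left mult_ac)
    also have "\<dots> = 2 * A * sqrt K" by (subst sum_lessThan_telescope) simp
    finally show ?thesis .
  qed
  have lowM: "2 * A * sqrt K * sqrt \<delta> \<le> 4 * A" if "K \<le> M" for K
  proof -
    have "real K * \<delta> \<le> (1 / \<delta> + 1) * \<delta>" using that M1 \<delta> by (intro mult_right_mono) auto
    also have "\<dots> = 1 + \<delta>" using \<delta> by (simp add: field_simps)
    \<comment> \<open>\<open>1 + \<delta>\<close> is at most 3; it is rounded up to 4 for the sake
      of the square root.\<close>
    also have "\<dots> \<le> 4" using \<delta> by simp
    finally have "sqrt (real K * \<delta>) \<le> sqrt 4" by (rule real_sqrt_le_mono)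
    then have "2 * A * sqrt (real K * \<delta>) \<le> 2 * A * 2" using A by (intro mult_left_mono) auto
    then show ?thesis by (simp add: real_sqrt_mult)
  qed
  show ?thesis
  proof (cases "N \<le> M")
    case True
    have "cmod (\<Sum>m<N. of_real (b m) * z ^ m) * sqrt \<delta> \<le> 2 * A * sqrt N * sqrt \<delta>"
      using low[of N] \<delta> by (intro mult_right_mono) auto
    with lowM[OF True] A show ?thesis by (simp add: \<delta>_def)
  next
    case False
    then have MN: "M \<le> N" by simp
    define R where "R = cmod (\<Sum>m=M..<N. of_real (b m) * z ^ m)"
    have "\<delta> * R \<le> \<bar>b M\<bar> + \<bar>b N\<bar> + (\<Sum>m=M..<N. \<bar>b m - b (Suc m)\<bar>)"
      unfolding \<delta>_def R_def by (rule Abel_summation_bound[OF z MN])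
    also have "(\<Sum>m=M..<N. \<bar>b m - b (Suc m)\<bar>) \<le> (\<Sum>m=M..<N. 2 * A * (1 / sqrt (real m) - 1 / sqrt (real (Suc m))))"
    proof (rule sum_mono)
      fix m assume "m \<in> {M..<N}"
      then have "real m > 0" using Mpos by simp
      from mult_left_mono[OF inverse_three_halves_le_diff[OF this] A]
      show "\<bar>b m - b (Suc m)\<bar> \<le> 2 * A * (1 / sqrt (real m) - 1 / sqrt (real (Suc m)))"
        using d[of m] by (simp add: add.commute algebra_simps)
    qed
    also have "\<dots> = 2 * A * (1 / sqrt M - 1 / sqrt N)"
      unfolding sum_distrib_left[symmetric]
      using sum_Suc_diff'[OF MN, of "\<lambda>m. - 1 / sqrt (real m)"] by simp
    also have "\<dots> \<le> 2 * A * (1 / sqrt M)" using A by (intro mult_left_mono) auto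
    also have "\<bar>b M\<bar> \<le> A * (1 / sqrt M)"
    proof -
      have "A / sqrt (real M + 1) \<le> A / sqrt M" using A Mpos by (intro divide_left_mono) auto
      with b[of M] show ?thesis by simp
    qed
    also have "\<bar>b N\<bar> \<le> A * (1 / sqrt M)"
    proof -
      have "A / sqrt (real N + 1) \<le> A / sqrt M" using A Mpos MN by (intro divide_left_mono) auto
      with b[of N] show ?thesis by simp
    qed
    \<comment> \<open>\<open>2 * A\<close> comes from the variation and \<open>A\<close> from each
      of the two boundary terms.\<close>
    finally have "\<delta> * R \<le> 4 * A * (1 / sqrt M)" by simp
    also have "1 / sqrt M \<le> sqrt \<delta>"
    proof -
      have "1 / real M \<le> \<delta>" using M1 \<delta> Mpos by (simp add: field_simps)
      then have "sqrt (1 / real M) \<le> sqrt \<delta>" by (rule real_sqrt_le_mono)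
      then show ?thesis by (simp add: real_sqrt_divide)
    qed
    finally have "\<delta> * R \<le> 4 * A * sqrt \<delta>" using A by (simp add: mult_left_mono)
    then have "sqrt \<delta> * (sqrt \<delta> * R) \<le> sqrt \<delta> * (4 * A)" using \<delta> by (simp add: mult_ac)
    then have R: "sqrt \<delta> * R \<le> 4 * A" using \<delta> by (simp only: mult_le_cancel_left_pos real_sqrt_gt_0_iff)
    have split: "(\<Sum>m<N. of_real (b m) * z ^ m) = (\<Sum>m<M. of_real (b m) * z ^ m) + (\<Sum>m=M..<N. of_real (b m) * z ^ m)"
      using sum.atLeastLessThan_concat[of 0 M N "\<lambda>m. of_real (b m) * z ^ m"] MN by (simp add: atLeast0LessThan)
    have "cmod (\<Sum>m<N. of_real (b m) * z ^ m) \<le> 2 * A * sqrt M + R"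
      unfolding split R_def using low[of M] by (rule norm_triangle_le[OF add_right_mono])
    then have "cmod (\<Sum>m<N. of_real (b m) * z ^ m) * sqrt \<delta> \<le> (2 * A * sqrt M + R) * sqrt \<delta>"
      using \<delta> by (intro mult_right_mono) auto
    with lowM[of M] R show ?thesis by (simp add: \<delta>_def algebra_simps)
  qed
qed

text \<open>The kernel with coefficients \<open>\<mu> m / sqrt (m + 1)\<close>, and all its partial sums, are dominated by the
  kernel of the potential up to the factor \<open>C\<close>.\<close>

definition multiplier_bound :: "(nat \<Rightarrow> real) \<Rightarrow> real \<Rightarrow> bool" where
  "multiplier_bound \<mu> C \<longleftrightarrow> (\<forall>N z. cmod z = 1 \<longrightarrow>
     cmod (\<Sum>m<N. of_real (\<mu> m / sqrt (real m + 1)) * z ^ m) * sqrt (cmod (1 - z)) \<le> C)"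

text \<open>Discrete product rule: the difference of \<open>\<mu> m / sqrt (m + 1)\<close> gets 2
  from the difference of \<open>\<mu>\<close> and 1 from that of \<open>1 / sqrt\<close>. So
  \<open>A = 3\<close> in \<open>kernel_bound\<close>, whence \<open>24 = 8 * 3\<close>.\<close>

lemma multiplier_boundI:
  assumes 1: "\<And>m. \<bar>\<mu> m\<bar> \<le> 1" and d: "\<And>m. \<bar>\<mu> m - \<mu> (Suc m)\<bar> \<le> 2 / (real m + 1)"
  shows "multiplier_bound \<mu> 24"
  unfolding multiplier_bound_def
proof (intro allI impI)
  fix N and z :: complex assume z: "cmod z = 1"
  have "cmod (\<Sum>m<N. of_real (\<mu> m / sqrt (real m + 1)) * z ^ m) * sqrt (cmod (1 - z)) \<le> 8 * 3"
  proof (rule kernel_bound[OF z])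
    fix m
    have s: "sqrt (real m + 1) > 0" "sqrt (real m + 2) > 0" by auto
    show "\<bar>\<mu> m / sqrt (real m + 1)\<bar> \<le> 3 / sqrt (real m + 1)"
      using 1[of m] by (simp add: divide_right_mono)
    have "\<mu> m / sqrt (real m + 1) - \<mu> (Suc m) / sqrt (real (Suc m) + 1)
        = (\<mu> m - \<mu> (Suc m)) / sqrt (real m + 1) + \<mu> (Suc m) * (1 / sqrt (real m + 1) - 1 / sqrt (real m + 1 + 1))"
      using s by (simp add: field_simps)
    also have "\<bar>\<dots>\<bar> \<le> \<bar>(\<mu> m - \<mu> (Suc m)) / sqrt (real m + 1)\<bar> + \<bar>\<mu> (Suc m) * (1 / sqrt (real m + 1) - 1 / sqrt (real m + 1 + 1))\<bar>"
      by (rule abs_triangle_ineq)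
    also have "\<bar>(\<mu> m - \<mu> (Suc m)) / sqrt (real m + 1)\<bar> \<le> 2 / ((real m + 1) * sqrt (real m + 1))"
      using divide_right_mono[OF d[of m], of "sqrt (real m + 1)"] by (simp add: field_simps)
    also have "\<bar>\<mu> (Suc m) * (1 / sqrt (real m + 1) - 1 / sqrt (real m + 1 + 1))\<bar> \<le> 1 * (1 / ((real m + 1) * sqrt (real m + 1)))"
      unfolding abs_mult
    proof (rule mult_mono)
      have "1 / sqrt (real m + 1) - 1 / sqrt (real m + 1 + 1) \<ge> 0"
        using s by (simp add: field_simps)
      then show "\<bar>1 / sqrt (real m + 1) - 1 / sqrt (real m + 1 + 1)\<bar> \<le> 1 / ((real m + 1) * sqrt (real m + 1))"
        using diff_le_inverse_three_halves[of "real m + 1"] by simp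
    qed (use 1 in auto)
    finally show "\<bar>\<mu> m / sqrt (real m + 1) - \<mu> (Suc m) / sqrt (real (Suc m) + 1)\<bar> \<le> 3 / ((real m + 1) * sqrt (real m + 1))"
      by simp
  qed
  then show "cmod (\<Sum>m<N. of_real (\<mu> m / sqrt (real m + 1)) * z ^ m) * sqrt (cmod (1 - z)) \<le> 24" by simp
qed

text \<open>For \<open>K \<ge> 2\<close> the jump of the cutoff violates the difference condition of
  \<open>multiplier_boundI\<close>. Since \<open>multiplier_bound\<close> covers all lengths
  \<open>N\<close>, the cutoff merely shortens the sum for the constant multiplier 1.\<close>

lemma multiplier_bound_cutoff: "multiplier_bound (\<lambda>m. of_bool (m \<le> K)) 24"
proof -
  have "multiplier_bound (\<lambda>_. 1) 24" by (rule multiplier_boundI) auto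
  moreover have "(\<Sum>m<N. of_real (of_bool (m \<le> K) / sqrt (real m + 1)) * z ^ m)
     = (\<Sum>m<min N (Suc K). of_real (1 / sqrt (real m + 1)) * z ^ m)" for N and z :: complex
    by (rule sum.mono_neutral_cong_right) auto
  ultimately show ?thesis unfolding multiplier_bound_def by simp
qed

section \<open>The sinc multiplier of the box means\<close>

definition sinc :: "real \<Rightarrow> real" where "sinc x = (if x = 0 then 1 else sin x / x)"

lemma abs_sinc_le: "\<bar>sinc x\<bar> \<le> 1"
  using abs_sin_x_le_abs_x[of x] by (simp add: sinc_def)

lemma tendsto_sinc_0: "(sinc \<longlongrightarrow> 1) (nhds 0)"
proof -
  have "((\<lambda>x::real. sin x / x) \<longlongrightarrow> 1) (at 0)"
    using DERIV_sin[of 0] by (simp add: has_field_derivative_iff)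
  then have "(sinc \<longlongrightarrow> 1) (at 0)"
    by (rule tendsto_cong[THEN iffD1, rotated]) (auto simp: sinc_def eventually_at_filter)
  then show ?thesis by (simp add: tendsto_nhds_iff sinc_def)
qed

text \<open>Over the common denominator \<open>m * (m + 1) * h\<close> the numerator is
  \<open>sin x + m * (sin x - sin y)\<close>, and each summand is at most \<open>m * h\<close> in
  absolute value. The factor \<open>h\<close> cancels, which makes the bound uniform in
  \<open>h\<close>.\<close>

lemma multiplier_bound_sinc:
  assumes h: "0 < h"
  shows "multiplier_bound (\<lambda>m. sinc (real m * h)) 24"
proof (rule multiplier_boundI)
  fix m
  show "\<bar>sinc (real m * h)\<bar> \<le> 1" by (rule abs_sinc_le)
  show "\<bar>sinc (real m * h) - sinc (real (Suc m) * h)\<bar> \<le> 2 / (real m + 1)"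
  proof (cases "m = 0")
    \<comment> \<open>The common denominator used in the other case vanishes for
      \<open>m = 0\<close>.\<close>
    case True
    have "\<bar>sinc (real m * h) - sinc (real (Suc m) * h)\<bar> \<le> 1 + 1"
      by (rule order_trans[OF abs_triangle_ineq4 add_mono]) (rule abs_sinc_le)+
    with True show ?thesis by simp
  next
    case False
    let ?x = "real m * h" and ?y = "real (Suc m) * h"
    have pos: "real m > 0" "?x > 0" "?y > 0" using False h by auto
    have eq: "sinc ?x - sinc ?y = (sin ?x + real m * (sin ?x - sin ?y)) / (real m * (real m + 1) * h)"
    proof -
      have x: "sinc ?x = (real m + 1) * sin ?x / (real m * (real m + 1) * h)"
        using pos(1) h by (simp add: sinc_def)
      have y: "sinc ?y = real m * sin ?y / (real m * (real m + 1) * h)"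
        using pos(1) h by (simp add: sinc_def add.commute)
      have "(real m + 1) * sin ?x - real m * sin ?y = sin ?x + real m * (sin ?x - sin ?y)"
        by (simp add: ring_distribs)
      then show ?thesis unfolding x y diff_divide_distrib[symmetric] by simp
    qed
    have s1: "\<bar>sin ?x\<bar> \<le> real m * h" using abs_sin_x_le_abs_x[of ?x] pos by simp
    have "\<bar>sin ?x - sin ?y\<bar> \<le> h"
    proof -
      have "\<bar>sin ?x - sin ?y\<bar> = 2 * \<bar>sin ((?x - ?y) / 2)\<bar> * \<bar>cos ((?x + ?y) / 2)\<bar>"
        by (simp add: sin_diff_sin abs_mult)
      also have "\<dots> \<le> 2 * \<bar>(?x - ?y) / 2\<bar> * 1"
        by (intro mult_mono abs_sin_x_le_abs_x abs_cos_le_one) auto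
      also have "\<dots> = h" using h by (simp add: algebra_simps)
      finally show ?thesis .
    qed
    then have "real m * \<bar>sin ?x - sin ?y\<bar> \<le> real m * h" by (simp add: mult_left_mono)
    then have "\<bar>real m * (sin ?x - sin ?y)\<bar> \<le> real m * h" by (simp only: abs_mult abs_of_nat)
    with s1 have "\<bar>sin ?x + real m * (sin ?x - sin ?y)\<bar> \<le> 2 * (real m * h)"
      by linarith
    moreover have D: "real m * (real m + 1) * h > 0" using pos(1) h by (intro mult_pos_pos) auto
    ultimately have "\<bar>sinc ?x - sinc ?y\<bar> \<le> 2 * (real m * h) / (real m * (real m + 1) * h)"
      unfolding eq abs_divide abs_of_pos[OF D] by (intro divide_right_mono) auto
    also have "\<dots> = 2 / (real m + 1)" using False h by simp
    finally show ?thesis .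
  qed
qed

subsection \<open>Characters and Lebesgue measure on the torus\<close>

lemma finite_vec_all: "finite A \<Longrightarrow> finite {x :: 'a ^ 'n. \<forall>i. x $ i \<in> A}"
proof -
  assume A: "finite A"
  have "{x :: 'a ^ 'n. \<forall>i. x $ i \<in> A} \<subseteq> vec_lambda ` (PiE UNIV (\<lambda>_. A))"
  proof
    fix x :: "'a ^ 'n" assume "x \<in> {x. \<forall>i. x $ i \<in> A}"
    then have "vec_nth x \<in> PiE UNIV (\<lambda>_. A)" by (simp add: PiE_UNIV_domain)
    then have "vec_lambda (vec_nth x) \<in> vec_lambda ` (PiE UNIV (\<lambda>_. A))" by (rule imageI)
    then show "x \<in> vec_lambda ` (PiE UNIV (\<lambda>_. A))" by (simp only: vec_nth_inverse)
  qed
  moreover have "finite (vec_lambda ` (PiE (UNIV :: 'n set) (\<lambda>_. A)))"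
    using A by (intro finite_imageI finite_PiE) auto
  ultimately show ?thesis by (rule finite_subset)
qed

lemma prod_sum_vec:
  fixes f :: "'n::finite \<Rightarrow> 'a \<Rightarrow> 'b::comm_semiring_1"
  assumes "finite A"
  shows "(\<Prod>i\<in>UNIV. \<Sum>y\<in>A. f i y) = (\<Sum>x\<in>{x :: 'a ^ 'n. \<forall>i. x $ i \<in> A}. \<Prod>i\<in>UNIV. f i (x $ i))"
proof -
  have "(\<Prod>i\<in>UNIV. \<Sum>y\<in>A. f i y) = (\<Sum>g\<in>PiE UNIV (\<lambda>_. A). \<Prod>i\<in>UNIV. f i (g i))"
    using assms by (intro prod_sum_PiE) auto
  also have "\<dots> = (\<Sum>x\<in>{x :: 'a ^ 'n. \<forall>i. x $ i \<in> A}. \<Prod>i\<in>UNIV. f i (x $ i))"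
    by (rule sum.reindex_bij_witness[of _ vec_nth vec_lambda]) auto
  finally show ?thesis .
qed

text \<open>Turns indicators of boxes into products over the coordinates, the form in which Fubini
  and \<open>prod_sum_vec\<close> apply.\<close>

lemma of_bool_all_eq_prod: "of_bool (\<forall>i. P i) = (\<Prod>i\<in>UNIV. of_bool (P (i::'n::finite)) :: 'a::comm_semiring_1)"
proof (cases "\<forall>i. P i")
  case False
  then obtain i where "\<not> P i" by auto
  then have "(\<Prod>i\<in>UNIV. of_bool (P i) :: 'a) = 0" by (intro prod_zero bexI[of _ i]) auto
  with False show ?thesis by simp
qed simp

lemma measurable_vec_nth [measurable]: "(\<lambda>x::real^'n. x $ i) \<in> borel_measurable borel"
  by (intro borel_measurable_continuous_onI continuous_intros)

lemma borel_measurable_cis [measurable]: "cis \<in> borel_measurable borel"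
  by (intro borel_measurable_continuous_onI continuous_intros)

text \<open>Lebesgue measure on \<open>real ^ 'n\<close> is the image of a product measure indexed
  by \<open>Basis\<close>; the map from \<open>i\<close> to \<open>axis i 1\<close> carries the
  index set over, and Fubini for finite products applies.\<close>

lemma
  fixes F :: "'n::finite \<Rightarrow> real \<Rightarrow> 'a::{real_normed_field,banach,second_countable_topology}"
  assumes F: "\<And>i. integrable lborel (F i)"
  shows integrable_lborel_prod_vec: "integrable lborel (\<lambda>x::real^'n. \<Prod>i\<in>UNIV. F i (x $ i))"
    and integral_lborel_prod_vec: "(\<integral>x. (\<Prod>i\<in>UNIV. F i (x $ i)) \<partial>(lborel :: (real^'n) measure)) = (\<Prod>i\<in>UNIV. \<integral>t. F i t \<partial>lborel)"
proof -
  interpret product_sigma_finite "\<lambda>_::real^'n. lborel :: real measure" by standard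
  define F' where "F' b = F (axis_index b)" for b :: "real^'n"
  have bij: "bij_betw (\<lambda>i. axis i (1::real)) UNIV (Basis :: (real^'n) set)"
    by (auto simp: bij_betw_def inj_on_def axis_eq_axis Basis_vec_def)
  have F'_int: "integrable lborel (F' b)" for b by (simp add: F'_def F)
  let ?e = "\<lambda>f. \<Sum>b\<in>Basis. f b *\<^sub>R (b :: real^'n)"
  have nth: "?e f $ i = f (axis i 1)" for f i
  proof -
    have "?e f $ i = inner (?e f) (axis i 1)" by (rule cart_eq_inner_axis)
    also have "\<dots> = f (axis i 1)" by (simp add: inner_sum_left_Basis)
    finally show ?thesis .
  qed
  have eq: "(\<Prod>i\<in>UNIV. F i (?e f $ i)) = (\<Prod>b\<in>Basis. F' b (f b))" for f
    unfolding nth F'_def by (subst prod.reindex_bij_betw[OF bij, symmetric]) simp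
  have e: "?e \<in> measurable (\<Pi>\<^sub>M b\<in>Basis. lborel) borel" by measurable
  have m: "(\<lambda>x::real^'n. \<Prod>i\<in>UNIV. F i (x $ i)) \<in> borel_measurable borel"
    using F by (intro borel_measurable_prod measurable_compose[OF measurable_vec_nth]) auto
  show "integrable lborel (\<lambda>x::real^'n. \<Prod>i\<in>UNIV. F i (x $ i))"
    unfolding lborel_eq[where 'a="real^'n"] integrable_distr_eq[OF e m] eq
    by (rule product_integrable_prod) (auto simp: F'_int)
  have "(\<integral>x. (\<Prod>i\<in>UNIV. F i (x $ i)) \<partial>(lborel :: (real^'n) measure)) = (\<Prod>b\<in>Basis. \<integral>t. F' b t \<partial>lborel)"
    unfolding lborel_eq[where 'a="real^'n"] integral_distr[OF e m] eq
    by (rule product_integral_prod) (auto simp: F'_int)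
  also have "\<dots> = (\<Prod>i\<in>UNIV. \<integral>t. F i t \<partial>lborel)"
    unfolding F'_def by (subst prod.reindex_bij_betw[OF bij, symmetric]) simp
  finally show "(\<integral>x. (\<Prod>i\<in>UNIV. F i (x $ i)) \<partial>(lborel :: (real^'n) measure)) = (\<Prod>i\<in>UNIV. \<integral>t. F i t \<partial>lborel)" .
qed

lemma integrable_cis_Icc: "integrable lborel (\<lambda>t. indicat_real {a..b} t *\<^sub>R cis (k * t))"
proof -
  have "continuous_on {a..b} (\<lambda>t. cis (k * t))" by (intro continuous_intros)
  then show ?thesis by (intro borel_integrable_compact) auto
qed

text \<open>Origin of the multiplier of the box means: after division by \<open>2 * h\<close>,
  averaging over the interval acts on a character as the factor \<open>sinc (k * h)\<close>.\<close>

lemma integral_cis_Icc: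
  assumes h: "h > 0"
  shows "(\<integral>t. indicat_real {\<theta> - h..\<theta> + h} t *\<^sub>R cis (k * t) \<partial>lborel) = complex_of_real (2 * h * sinc (k * h)) * cis (k * \<theta>)"
proof (cases "k = 0")
  case True
  with h show ?thesis by (simp add: sinc_def scaleR_conv_of_real)
next
  case False
  define F where "F t = cis (k * t) / (\<i> * k)" for t
  have "(\<integral>t. indicat_real {\<theta> - h..\<theta> + h} t *\<^sub>R cis (k * t) \<partial>lborel) = F (\<theta> + h) - F (\<theta> - h)"
  proof (rule integral_FTC_atLeastAtMost)
    fix t
    have "((\<lambda>z. exp (\<i> * k * z) / (\<i> * k)) has_field_derivative exp (\<i> * k * of_real t)) (at (of_real t))"
      using False by (auto intro!: derivative_eq_intros)
    from has_vector_derivative_real_field[OF this]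
    have "((\<lambda>x. exp (\<i> * k * of_real x) / (\<i> * k)) has_vector_derivative exp (\<i> * k * of_real t)) (at t within {\<theta> - h..\<theta> + h})" .
    then show "(F has_vector_derivative cis (k * t)) (at t within {\<theta> - h..\<theta> + h})"
      by (simp add: F_def[abs_def] cis_conv_exp mult.assoc)
  qed (use h in \<open>auto intro!: continuous_intros\<close>)
  also have "\<dots> = cis (k * \<theta>) * (cis (k * h) - cis (- (k * h))) / (\<i> * k)"
    unfolding F_def by (simp add: cis_mult diff_divide_distrib ring_distribs algebra_simps)
  also have "cis (k * h) - cis (- (k * h)) = 2 * \<i> * sin (k * h)"
    by (simp add: complex_eq_iff)
  finally show ?thesis using False h by (simp add: sinc_def field_simps)
qed

definition char_torus :: "int ^ 'n \<Rightarrow> real ^ 'n \<Rightarrow> complex" where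
  "char_torus \<kappa> \<psi> = cis (\<Sum>i\<in>UNIV. of_int (\<kappa> $ i) * \<psi> $ i)"

lemma cis_sum: "cis (\<Sum>i\<in>A. f i) = (\<Prod>i\<in>A. cis (f i))"
  by (induction A rule: infinite_finite_induct) (auto simp: cis_mult[symmetric])

lemma char_torus_eq_prod: "char_torus \<kappa> \<psi> = (\<Prod>i\<in>UNIV. cis (of_int (\<kappa> $ i) * \<psi> $ i))"
  by (simp add: char_torus_def cis_sum)

lemma char_torus_add: "char_torus (\<kappa> + \<mu>) \<psi> = char_torus \<kappa> \<psi> * char_torus \<mu> \<psi>"
  by (simp add: char_torus_def cis_mult ring_distribs sum.distrib)

lemma char_torus_minus: "char_torus (- \<kappa>) \<psi> = cnj (char_torus \<kappa> \<psi>)"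
  by (simp add: char_torus_def cis_cnj sum_negf)

lemma norm_char_torus [simp]: "cmod (char_torus \<kappa> \<psi>) = 1"
  by (simp add: char_torus_def)

lemma char_torus_diff_arg: "char_torus \<kappa> (\<theta> - \<psi>) = char_torus \<kappa> \<theta> * char_torus (- \<kappa>) \<psi>"
  by (simp add: char_torus_def cis_mult ring_distribs sum_subtractf sum_negf)

lemma char_torus_periodic: "char_torus \<kappa> (\<psi> + axis i (2 * pi)) = char_torus \<kappa> \<psi>"
proof -
  have "(\<Sum>j\<in>UNIV. of_int (\<kappa> $ j) * axis i (2 * pi) $ j) = 2 * pi * of_int (\<kappa> $ i)"
    by (simp add: axis_def if_distrib[of "\<lambda>x. _ * x"] cong: if_cong)
  then have "char_torus \<kappa> (\<psi> + axis i (2 * pi)) = char_torus \<kappa> \<psi> * cis (2 * pi * of_int (\<kappa> $ i))"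
    by (simp only: char_torus_def cis_mult ring_distribs sum.distrib vector_add_component)
  also have "cis (2 * pi * of_int (\<kappa> $ i)) = 1"
    by (metis cis_multiple_2pi Ints_of_int)
  finally show ?thesis by simp
qed

lemma continuous_on_char_torus [continuous_intros]: "continuous_on S (char_torus \<kappa>)"
  unfolding char_torus_def[abs_def] by (intro continuous_intros)

lemma borel_measurable_char_torus [measurable]: "char_torus \<kappa> \<in> borel_measurable borel"
  by (intro borel_measurable_continuous_onI continuous_on_char_torus)

lemma indicator_torus: "indicator torus x = (\<Prod>i\<in>UNIV. indicator {0..<2*pi} (x $ i) :: 'a::comm_semiring_1)"
proof -
  have "indicator torus x = (of_bool (\<forall>i. x $ i \<in> {0..<2*pi}) :: 'a)"
    by (auto simp: torus_def indicator_def)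
  also have "\<dots> = (\<Prod>i\<in>UNIV. indicator {0..<2*pi} (x $ i))"
    by (simp only: of_bool_all_eq_prod indicator_def)
  finally show ?thesis .
qed

lemma torus_borel [measurable]: "(torus :: (real^'n) set) \<in> sets borel"
proof -
  have "torus = (\<Inter>i. (\<lambda>x::real^'n. x $ i) -` {0..<2*pi} \<inter> space borel)"
    by (auto simp: torus_def)
  moreover have "(\<lambda>x::real^'n. x $ i) -` {0..<2*pi} \<inter> space borel \<in> sets borel" for i
    by (rule measurable_sets[OF measurable_vec_nth]) auto
  then have "(\<Inter>i. (\<lambda>x::real^'n. x $ i) -` {0..<2*pi} \<inter> space borel) \<in> sets borel"
    by (intro sets.finite_INT) auto
  ultimately show ?thesis by metis
qed

lemma torus_lebesgue [measurable]: "torus \<in> sets lebesgue"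
  using torus_borel by simp

lemma emeasure_torus: "emeasure lebesgue (torus :: (real^'n) set) = ennreal ((2 * pi) ^ CARD('n))"
proof -
  have int: "integrable lborel (indicator {0..<2*pi} :: real \<Rightarrow> real)" by simp
  have "integrable lborel (indicator (torus :: (real^'n) set) :: _ \<Rightarrow> real)"
    using integrable_lborel_prod_vec[OF int, where 'n='n] by (simp add: indicator_torus[abs_def])
  then have fin: "emeasure lborel (torus :: (real^'n) set) < \<infinity>"
    by (simp add: integrable_indicator_iff)
  have "measure lborel (torus :: (real^'n) set) = (\<integral>x. indicator torus x \<partial>(lborel :: (real^'n) measure))" by simp
  also have "\<dots> = (2 * pi) ^ CARD('n)"
    unfolding indicator_torus using integral_lborel_prod_vec[OF int, where 'n='n] by simp
  finally show ?thesis using fin by (simp add: emeasure_eq_ennreal_measure)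
qed

text \<open>\<open>uniform_measure\<close> divides indicators in \<open>ennreal\<close>; a real
  density gives access to the transfer rules for Bochner integrals.\<close>

lemma torus_measure_eq_density:
  "(torus_measure :: (real^'n) measure) = density lebesgue (\<lambda>x. ennreal (indicator torus x / (2 * pi) ^ CARD('n)))"
  unfolding torus_measure_def uniform_measure_def emeasure_torus
  by (intro density_cong) (auto simp: indicator_def divide_ennreal[symmetric] simp del: ennreal_power)

lemma sets_torus_measure [simp, measurable_cong]: "sets torus_measure = sets lebesgue"
  and space_torus_measure [simp]: "space torus_measure = UNIV"
  by (simp_all add: torus_measure_def)

lemma emeasure_torus_measure_UNIV: "emeasure torus_measure UNIV = 1"
  unfolding torus_measure_def by (subst emeasure_uniform_measure) (auto simp: emeasure_torus divide_ennreal)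

lemma finite_torus_measure: "finite_measure torus_measure"
  by (rule finite_measureI) (simp add: emeasure_torus_measure_UNIV)

lemma
  fixes f :: "real ^ 'n \<Rightarrow> 'a::{banach,second_countable_topology}"
  assumes [measurable]: "f \<in> borel_measurable lebesgue"
  shows integrable_torus_measure_iff: "integrable torus_measure f \<longleftrightarrow> integrable lebesgue (\<lambda>x. indicat_real torus x *\<^sub>R f x)"
    and integral_torus_measure: "(\<integral>x. f x \<partial>torus_measure) = (1 / (2 * pi) ^ CARD('n)) *\<^sub>R (\<integral>x. indicat_real torus x *\<^sub>R f x \<partial>lebesgue)"
proof -
  have "integrable torus_measure f \<longleftrightarrow> integrable lebesgue (\<lambda>x. (indicat_real torus x / (2 * pi) ^ CARD('n)) *\<^sub>R f x)"
    unfolding torus_measure_eq_density by (intro integrable_density) auto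
  also have "\<dots> \<longleftrightarrow> integrable lebesgue (\<lambda>x. (1 / (2 * pi) ^ CARD('n)) *\<^sub>R (indicat_real torus x *\<^sub>R f x))"
    by simp
  also have "\<dots> \<longleftrightarrow> integrable lebesgue (\<lambda>x. indicat_real torus x *\<^sub>R f x)"
  proof
    assume "integrable lebesgue (\<lambda>x. (1 / (2 * pi) ^ CARD('n)) *\<^sub>R (indicat_real torus x *\<^sub>R f x))"
    then have "integrable lebesgue (\<lambda>x. (2 * pi) ^ CARD('n) *\<^sub>R (1 / (2 * pi) ^ CARD('n)) *\<^sub>R (indicat_real torus x *\<^sub>R f x))"
      by (rule integrable_scaleR_right)
    then show "integrable lebesgue (\<lambda>x. indicat_real torus x *\<^sub>R f x)" by simp
  qed (rule integrable_scaleR_right)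
  finally show "integrable torus_measure f \<longleftrightarrow> integrable lebesgue (\<lambda>x. indicat_real torus x *\<^sub>R f x)" .
  have "(\<integral>x. f x \<partial>torus_measure) = (\<integral>x. (indicat_real torus x / (2 * pi) ^ CARD('n)) *\<^sub>R f x \<partial>lebesgue)"
    unfolding torus_measure_eq_density by (intro integral_density) auto
  also have "\<dots> = (\<integral>x. (1 / (2 * pi) ^ CARD('n)) *\<^sub>R (indicat_real torus x *\<^sub>R f x) \<partial>lebesgue)"
    by simp
  also have "\<dots> = (1 / (2 * pi) ^ CARD('n)) *\<^sub>R (\<integral>x. indicat_real torus x *\<^sub>R f x \<partial>lebesgue)"
    by (rule integral_scaleR_right)
  finally show "(\<integral>x. f x \<partial>torus_measure) = (1 / (2 * pi) ^ CARD('n)) *\<^sub>R (\<integral>x. indicat_real torus x *\<^sub>R f x \<partial>lebesgue)" .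
qed

lemma measurable_torus_measureI: "f \<in> borel_measurable borel \<Longrightarrow> f \<in> borel_measurable lebesgue"
  by (simp add: measurable_completion)

lemma integral_char_torus: "(\<integral>\<psi>. char_torus \<kappa> \<psi> \<partial>torus_measure) = of_bool (\<kappa> = (0 :: int ^ 'n))"
proof -
  let ?F = "\<lambda>i t. indicat_real {0..<2*pi} t *\<^sub>R cis (of_int (\<kappa> $ i) * t)"
  \<comment> \<open>The interval is written as \<open>{pi - pi..pi + pi}\<close> to match
    \<open>integral_cis_Icc\<close> with center and half length \<open>pi\<close>; it differs from
    \<open>{0..<2*pi}\<close> in one point. Orthogonality then comes from
    \<open>sinc (k * pi) = 0\<close> for integers \<open>k \<noteq> 0\<close>.\<close>
  have ae: "AE t in lborel. indicat_real {pi - pi..pi + pi} t *\<^sub>R cis (of_int (\<kappa> $ i) * t) = ?F i t" for i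
    by (rule eventually_mono[OF AE_lborel_singleton[of "2 * pi"]]) (auto simp: indicator_def)
  have F: "integrable lborel (?F i)" for i
    by (rule integrable_cong_AE_imp[OF integrable_cis_Icc _ ae]) measurable
  have F1: "(\<integral>t. ?F i t \<partial>lborel) = 2 * pi * of_bool (\<kappa> $ i = 0)" for i
  proof -
    have "(\<integral>t. ?F i t \<partial>lborel) = complex_of_real (2 * pi * sinc (of_int (\<kappa> $ i) * pi)) * cis (of_int (\<kappa> $ i) * pi)"
      unfolding integral_cis_Icc[OF pi_gt_zero, symmetric]
      by (rule integral_cong_AE[OF _ _ AE_symmetric]) (use ae in auto)
    also have "\<dots> = 2 * pi * of_bool (\<kappa> $ i = 0)"
      by (auto simp: sinc_def mult.commute)
    finally show ?thesis .
  qed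
  have "(\<integral>x. indicat_real torus x *\<^sub>R char_torus \<kappa> x \<partial>lebesgue) = (\<integral>x. indicat_real torus x *\<^sub>R char_torus \<kappa> x \<partial>lborel)"
    by (rule integral_completion) measurable
  also have "\<dots> = (\<integral>x. (\<Prod>i\<in>UNIV. ?F i (x $ i)) \<partial>lborel)"
    by (simp add: indicator_torus char_torus_eq_prod prod.distrib scaleR_conv_of_real)
  also have "\<dots> = (\<Prod>i\<in>UNIV. 2 * pi * of_bool (\<kappa> $ i = 0))"
    by (subst integral_lborel_prod_vec[OF F]) (simp add: F1)
  also have "\<dots> = (2 * pi) ^ CARD('n) * of_bool (\<kappa> = 0)"
    by (simp add: prod.distrib of_bool_all_eq_prod[symmetric] vec_eq_iff)
  finally show ?thesis
    by (subst integral_torus_measure) (auto intro: measurable_torus_measureI simp: scaleR_conv_of_real)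
qed

subsection \<open>Boxes of periodic functions\<close>

text \<open>The range of \<open>t\<close> is that of a coordinate in a box with center in
  \<open>torus\<close> and half sides below \<open>pi\<close>; three periods cover it.\<close>

lemma sum_indicator_translates:
  assumes "- pi < t" "t < 3 * pi"
  shows "(\<Sum>j\<in>{-1,0,1::int}. indicator {0..<2*pi} (t - 2 * pi * of_int j) :: real) = 1"
proof -
  consider "t < 0" | "0 \<le> t" "t < 2 * pi" | "2 * pi \<le> t" by linarith
  then show ?thesis using assms by cases (auto simp: indicator_def simp del: sum_of_bool_eq)
qed

lemma cos_less_cos_iff:
  assumes "\<bar>u\<bar> \<le> pi" "0 < h" "h < pi"
  shows "cos h < cos u \<longleftrightarrow> \<bar>u\<bar> < h"
proof -
  have "cos u = cos \<bar>u\<bar>" by (simp add: abs_if)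
  then show ?thesis using assms cos_mono_less_eq[of h "\<bar>u\<bar>"] by simp
qed

text \<open>One of the translates brings \<open>y - t\<close> into the interval from
  \<open>- pi\<close> to \<open>pi\<close>, where \<open>cos\<close> compares absolute values; since
  \<open>h < pi\<close>, no other translate can come within \<open>h\<close>.\<close>

lemma sum_of_bool_translates:
  assumes y: "0 \<le> y" "y < 2 * pi" and t: "0 \<le> t" "t < 2 * pi" and h: "0 < h" "h < pi"
  shows "(\<Sum>j\<in>{-1,0,1::int}. of_bool (\<bar>y + 2 * pi * of_int j - t\<bar> < h) :: real) = of_bool (cos h < cos (y - t))"
proof -
  consider "\<bar>y - t\<bar> \<le> pi" | "y - t > pi" | "y - t < - pi" by linarith
  then show ?thesis
  proof cases
    case 1
    then show ?thesis using cos_less_cos_iff[OF 1 h] h by (auto simp: algebra_simps)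
  next
    case 2
    have "cos (y - t) = cos (y - t - 2 * pi)" by (metis cos_periodic diff_add_cancel)
    moreover have "\<bar>y - t - 2 * pi\<bar> \<le> pi" using 2 y t by auto
    ultimately show ?thesis using cos_less_cos_iff[of "y - t - 2 * pi" h] h 2 y t
      by (auto simp: algebra_simps)
  next
    case 3
    have "cos (y - t) = cos (y - t + 2 * pi)" by simp
    moreover have "\<bar>y - t + 2 * pi\<bar> \<le> pi" using 3 y t by auto
    ultimately show ?thesis using cos_less_cos_iff[of "y - t + 2 * pi" h] h 3 y t
      by (auto simp: algebra_simps)
  qed
qed

lemma periodic_translate:
  fixes \<phi> :: "real ^ 'n \<Rightarrow> 'a"
  assumes per: "\<And>x i. \<phi> (x + axis i (2 * pi)) = \<phi> x" and k: "\<And>i. k $ i \<in> {-1, 0, 1::int}"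
  shows "\<phi> (x + (\<chi> i. 2 * pi * of_int (k $ i))) = \<phi> x"
proof -
  have per': "\<phi> (x - axis i (2 * pi)) = \<phi> x" for x i
    using per[of "x - axis i (2 * pi)" i] by simp
  have step: "\<phi> (x + axis i (2 * pi * of_int (k $ i))) = \<phi> x" for x i
  proof -
    consider "k $ i = -1" | "k $ i = 0" | "k $ i = 1" using k[of i] by auto
    then show ?thesis
    proof cases
      case 1
      have "axis i (2 * pi * of_int (k $ i)) = - axis i (2 * pi)"
        using 1 by (simp add: vec_eq_iff axis_def)
      then show ?thesis using per'[of x i] by simp
    next
      case 2
      have "axis i (2 * pi * of_int (k $ i)) = 0"
        using 2 by (simp add: vec_eq_iff axis_def)
      then show ?thesis by (simp only: add_0_right)
    next
      case 3
      then show ?thesis using per by simp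
    qed
  qed
  have "\<phi> (x + (\<Sum>i\<in>S. axis i (2 * pi * of_int (k $ i)))) = \<phi> x" if "finite S" for S
    using that
  proof (induction S)
    case (insert i S)
    have "\<phi> (x + (\<Sum>j\<in>insert i S. axis j (2 * pi * of_int (k $ j))))
       = \<phi> ((x + (\<Sum>j\<in>S. axis j (2 * pi * of_int (k $ j)))) + axis i (2 * pi * of_int (k $ i)))"
      using insert by (simp add: add_ac)
    then show ?case using insert step by metis
  qed simp
  from this[OF finite, of UNIV] have "\<phi> (x + (\<Sum>i\<in>UNIV. axis i (2 * pi * of_int (k $ i)))) = \<phi> x" .
  moreover have "(\<Sum>i\<in>UNIV. axis i (2 * pi * of_int (k $ i))) = (\<chi> i. 2 * pi * of_int (k $ i))"
    by (simp add: vec_eq_iff axis_def)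
  ultimately show ?thesis by simp
qed

lemma lebesgue_distr_translation: "distr lebesgue lebesgue (\<lambda>x. t + x) = (lebesgue :: 'a::euclidean_space measure)"
  and measurable_translation_lebesgue: "(\<lambda>x. t + x) \<in> lebesgue \<rightarrow>\<^sub>M (lebesgue :: 'a::euclidean_space measure)"
proof -
  have eq: "(\<lambda>x::'a. t + (\<Sum>j\<in>Basis. (1 * (x \<bullet> j)) *\<^sub>R j)) = (\<lambda>x. t + x)"
    by (simp add: euclidean_representation)
  show "distr lebesgue lebesgue (\<lambda>x. t + x) = (lebesgue :: 'a::euclidean_space measure)"
    using lebesgue_affine_euclidean[of "\<lambda>_. 1" t, unfolded eq] by (simp add: density_1)
  show "(\<lambda>x. t + x) \<in> lebesgue \<rightarrow>\<^sub>M (lebesgue :: 'a::euclidean_space measure)"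
    using lebesgue_affine_measurable[of "\<lambda>_. 1" t, unfolded eq] by simp
qed

lemma
  fixes f :: "'a::euclidean_space \<Rightarrow> 'b::{banach,second_countable_topology}"
  assumes f: "f \<in> borel_measurable lebesgue"
  shows integrable_lebesgue_translation: "integrable lebesgue (\<lambda>x. f (t + x)) \<longleftrightarrow> integrable lebesgue f"
    and integral_lebesgue_translation: "(\<integral>x. f (t + x) \<partial>lebesgue) = (\<integral>x. f x \<partial>lebesgue)"
  using integrable_distr_eq[OF measurable_translation_lebesgue f, of t]
    integral_distr[OF measurable_translation_lebesgue f, of t]
  by (simp_all add: lebesgue_distr_translation)

text \<open>For \<open>0 < h $ i < pi\<close>, the indicator function of the periodization of the box with center \<open>\<theta>\<close>
  and half side lengths \<open>h $ i\<close>. Being a function of cosines, it is a limit of trigonometric polynomials.\<close>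

definition periodic_box :: "real ^ 'n \<Rightarrow> real ^ 'n \<Rightarrow> real ^ 'n \<Rightarrow> real" where
  "periodic_box \<theta> h \<psi> = of_bool (\<forall>i. cos (h $ i) < cos (\<psi> $ i - \<theta> $ i))"

text \<open>The box is cut along the translates of the torus with shifts in
  \<open>{-1, 0, 1}\<close>, and each piece is moved back by periodicity. \<open>tile\<close> says
  that the pieces exhaust the box, \<open>tile2\<close> that the moved pieces add up to the periodic
  box.\<close>

lemma
  fixes \<phi> :: "real ^ 'n \<Rightarrow> 'a::{banach,second_countable_topology}"
  assumes per: "\<And>x i. \<phi> (x + axis i (2 * pi)) = \<phi> x"
    and meas: "\<phi> \<in> borel_measurable lebesgue"
    and int: "integrable torus_measure \<phi>"
    and \<theta>: "\<theta> \<in> torus" and h: "\<And>i. 0 < h $ i \<and> h $ i < pi"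
  shows integrable_box_periodic: "integrable lebesgue (\<lambda>x. indicat_real (box (\<theta> - h) (\<theta> + h)) x *\<^sub>R \<phi> x)"
    and integral_box_periodic: "(1 / (2 * pi) ^ CARD('n)) *\<^sub>R (\<integral>x. indicat_real (box (\<theta> - h) (\<theta> + h)) x *\<^sub>R \<phi> x \<partial>lebesgue)
       = (\<integral>x. periodic_box \<theta> h x *\<^sub>R \<phi> x \<partial>torus_measure)"
proof -
  define K where "K = {k :: int ^ 'n. \<forall>i. k $ i \<in> {-1, 0, 1}}"
  define v :: "int ^ 'n \<Rightarrow> real ^ 'n" where "v k = (\<chi> i. 2 * pi * of_int (k $ i))" for k
  let ?B = "box (\<theta> - h) (\<theta> + h)"
  have finK: "finite K" unfolding K_def by (intro finite_vec_all) auto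
  have mem: "x \<in> ?B \<longleftrightarrow> (\<forall>i. \<bar>x $ i - \<theta> $ i\<bar> < h $ i)" for x
    by (auto simp: mem_box_cart abs_less_iff) (smt (verit))+
  have th: "0 \<le> \<theta> $ i" "\<theta> $ i < 2 * pi" for i using \<theta> by (auto simp: torus_def)
  have tile: "(\<Sum>k\<in>K. indicat_real torus (x - v k)) = 1" if "x \<in> ?B" for x
  proof -
    have x: "- pi < x $ i" "x $ i < 3 * pi" for i
      using that th[of i] h[of i] unfolding mem by (smt (verit))+
    have "(\<Sum>k\<in>K. indicat_real torus (x - v k)) = (\<Sum>k\<in>K. \<Prod>i\<in>UNIV. indicator {0..<2*pi} (x $ i - 2 * pi * of_int (k $ i)))"
      by (simp add: indicator_torus v_def)
    also have "\<dots> = (\<Prod>i\<in>UNIV. \<Sum>j\<in>{-1,0,1::int}. indicator {0..<2*pi} (x $ i - 2 * pi * of_int j))"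
      unfolding K_def by (subst prod_sum_vec) auto
    also have "\<dots> = 1" by (intro prod.neutral ballI sum_indicator_translates x)
    finally show ?thesis .
  qed
  have tile2: "(\<Sum>k\<in>K. indicat_real ?B (v k + y)) = periodic_box \<theta> h y" if "y \<in> torus" for y
  proof -
    have y: "0 \<le> y $ i" "y $ i < 2 * pi" for i using that by (auto simp: torus_def)
    have "indicat_real ?B (v k + y) = (\<Prod>i\<in>UNIV. of_bool (\<bar>y $ i + 2 * pi * of_int (k $ i) - \<theta> $ i\<bar> < h $ i))" for k
      unfolding indicator_def mem of_bool_all_eq_prod by (simp add: v_def add_ac)
    then have "(\<Sum>k\<in>K. indicat_real ?B (v k + y)) = (\<Sum>k\<in>K. \<Prod>i\<in>UNIV. of_bool (\<bar>y $ i + 2 * pi * of_int (k $ i) - \<theta> $ i\<bar> < h $ i))"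
      by simp
    also have "\<dots> = (\<Prod>i\<in>UNIV. \<Sum>j\<in>{-1,0,1::int}. of_bool (\<bar>y $ i + 2 * pi * of_int j - \<theta> $ i\<bar> < h $ i))"
      unfolding K_def by (subst prod_sum_vec) auto
    also have "\<dots> = (\<Prod>i\<in>UNIV. of_bool (cos (h $ i) < cos (y $ i - \<theta> $ i)))"
      using y th h by (intro prod.cong refl sum_of_bool_translates) auto
    also have "\<dots> = periodic_box \<theta> h y"
      unfolding periodic_box_def of_bool_all_eq_prod ..
    finally show ?thesis .
  qed
  \<comment> \<open>\<open>g k\<close> is the piece of the box in the \<open>k\<close>-th translate
    of the torus, moved back to the torus.\<close>
  define g where "g k y = (indicat_real ?B (v k + y) * indicat_real torus y) *\<^sub>R \<phi> y" for k y
  have tor: "integrable lebesgue (\<lambda>x. indicat_real torus x *\<^sub>R \<phi> x)"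
    using int by (simp add: integrable_torus_measure_iff[OF meas])
  have Bm: "?B \<in> sets lebesgue" by simp
  have Bvm: "(\<lambda>y. indicat_real ?B (v k + y)) \<in> borel_measurable lebesgue" for k
    by (rule measurable_compose[OF measurable_translation_lebesgue]) (rule borel_measurable_indicator[OF Bm])
  have gm: "g k \<in> borel_measurable lebesgue" for k
    unfolding g_def using Bvm meas by simp
  have gint: "integrable lebesgue (g k)" for k
    by (rule Bochner_Integration.integrable_bound[OF tor gm]) (auto simp: g_def indicator_def)
  have shift: "g k (x - v k) = (indicat_real ?B x * indicat_real torus (x - v k)) *\<^sub>R \<phi> x" if "k \<in> K" for k x
  proof -
    have "\<phi> ((x - v k) + v k) = \<phi> (x - v k)"
      unfolding v_def using that by (intro periodic_translate[OF per]) (auto simp: K_def)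
    then show ?thesis by (simp add: g_def)
  qed
  have gsm: "integrable lebesgue (\<lambda>x. g k (x - v k))" "(\<integral>x. g k (x - v k) \<partial>lebesgue) = (\<integral>x. g k x \<partial>lebesgue)" for k
    using integrable_lebesgue_translation[OF gm, of k "- v k"] integral_lebesgue_translation[OF gm, of k "- v k"] gint[of k]
    by simp_all
  have dec: "indicat_real ?B x *\<^sub>R \<phi> x = (\<Sum>k\<in>K. g k (x - v k))" for x
  proof (cases "x \<in> ?B")
    case True
    then show ?thesis by (simp add: shift scaleR_sum_left[symmetric] tile cong: sum.cong)
  next
    case False
    then show ?thesis by (simp add: shift cong: sum.cong)
  qed
  show "integrable lebesgue (\<lambda>x. indicat_real ?B x *\<^sub>R \<phi> x)"
    unfolding dec by (intro Bochner_Integration.integrable_sum gsm)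
  have "(\<integral>x. indicat_real ?B x *\<^sub>R \<phi> x \<partial>lebesgue) = (\<Sum>k\<in>K. \<integral>x. g k x \<partial>lebesgue)"
    unfolding dec by (subst Bochner_Integration.integral_sum) (simp_all add: gsm)
  also have "\<dots> = (\<integral>x. (\<Sum>k\<in>K. g k x) \<partial>lebesgue)"
    by (rule Bochner_Integration.integral_sum[symmetric]) (rule gint)
  also have "\<dots> = (\<integral>x. indicat_real torus x *\<^sub>R (periodic_box \<theta> h x *\<^sub>R \<phi> x) \<partial>lebesgue)"
  proof (rule Bochner_Integration.integral_cong[OF refl])
    fix x
    show "(\<Sum>k\<in>K. g k x) = indicat_real torus x *\<^sub>R (periodic_box \<theta> h x *\<^sub>R \<phi> x)"
    proof (cases "x \<in> torus")
      case True
      then show ?thesis by (simp add: g_def scaleR_sum_left[symmetric] tile2)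
    qed (simp add: g_def)
  qed
  finally have "(\<integral>x. indicat_real ?B x *\<^sub>R \<phi> x \<partial>lebesgue) = (\<integral>x. indicat_real torus x *\<^sub>R (periodic_box \<theta> h x *\<^sub>R \<phi> x) \<partial>lebesgue)" .
  moreover have "periodic_box \<theta> h \<in> borel_measurable lebesgue"
    by (rule measurable_torus_measureI) (simp add: periodic_box_def[abs_def])
  ultimately show "(1 / (2 * pi) ^ CARD('n)) *\<^sub>R (\<integral>x. indicat_real ?B x *\<^sub>R \<phi> x \<partial>lebesgue)
       = (\<integral>x. periodic_box \<theta> h x *\<^sub>R \<phi> x \<partial>torus_measure)"
    using meas by (subst integral_torus_measure) auto
qed

subsection \<open>Potentials and capacity\<close>

definition int_vec :: "nat ^ 'n \<Rightarrow> int ^ 'n" where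
  "int_vec \<alpha> = (\<chi> i. int (\<alpha> $ i))"

lemma int_vec_eq_iff: "int_vec \<alpha> = int_vec \<beta> \<longleftrightarrow> \<alpha> = \<beta>"
  by (auto simp: int_vec_def vec_eq_iff)

lemma char_torus_int_vec: "char_torus (int_vec \<alpha>) \<theta> = cis (\<Sum>i\<in>UNIV. real (\<alpha> $ i) * \<theta> $ i)"
  by (simp add: char_torus_def int_vec_def)

definition trig_poly :: "(nat ^ 'n) set \<Rightarrow> (nat ^ 'n \<Rightarrow> 'h::chilbert_space) \<Rightarrow> real ^ 'n \<Rightarrow> 'h" where
  "trig_poly A a \<psi> = (\<Sum>\<alpha>\<in>A. char_torus (int_vec \<alpha>) \<psi> *\<^sub>C a \<alpha>)"

lemma continuous_on_trig_poly [continuous_intros]: "continuous_on S (trig_poly A a)"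
  unfolding trig_poly_def[abs_def]
  by (intro continuous_on_sum bounded_linear.continuous_on[OF bounded_linear_scaleC_left] continuous_on_char_torus)

lemma borel_measurable_norm_trig_poly [measurable]: "(\<lambda>\<psi>. norm (trig_poly A a \<psi>)) \<in> borel_measurable borel"
  by (intro borel_measurable_continuous_onI continuous_intros)

lemma borel_measurable_cinner_trig_poly [measurable]: "(\<lambda>\<psi>. cinner (trig_poly A a \<psi>) w) \<in> borel_measurable borel"
  by (intro borel_measurable_continuous_onI bounded_linear.continuous_on[OF bounded_linear_cinner_left] continuous_intros)

lemma cinner_trig_poly: "cinner (trig_poly A a \<psi>) w = (\<Sum>\<alpha>\<in>A. char_torus (int_vec \<alpha>) \<psi> * cinner (a \<alpha>) w)"
  by (simp add: trig_poly_def cinner_sum_left cinner_scaleC_left)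

lemma norm_trig_poly_le: "norm (trig_poly A a \<psi>) \<le> (\<Sum>\<alpha>\<in>A. norm (a \<alpha>))"
  unfolding trig_poly_def by (rule order_trans[OF norm_sum]) (simp add: norm_scaleC)

lemma integrable_torus_measure_bounded:
  fixes f :: "real ^ 'n \<Rightarrow> 'b::{banach,second_countable_topology}"
  assumes "f \<in> borel_measurable lebesgue" "\<And>x. norm (f x) \<le> B"
  shows "integrable torus_measure f"
  using assms by (intro finite_measure.integrable_const_bound[OF finite_torus_measure, of _ B]) auto

lemma integrable_char_torus: "integrable torus_measure (char_torus \<kappa>)"
  by (rule integrable_torus_measure_bounded[of _ 1]) (auto intro: measurable_torus_measureI)

lemma integral_char_torus_mult:
  "(\<integral>\<psi>. char_torus \<kappa> \<psi> * char_torus \<mu> \<psi> \<partial>torus_measure) = of_bool (\<kappa> = - \<mu>)"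
  unfolding char_torus_add[symmetric] integral_char_torus by (simp add: eq_neg_iff_add_eq_0)

lemma integrable_char_torus_mult:
  "integrable torus_measure (\<lambda>\<psi>. char_torus \<kappa> \<psi> * char_torus \<mu> \<psi>)"
  unfolding char_torus_add[symmetric] by (rule integrable_char_torus)

text \<open>The character is not conjugated, so the frequency \<open>\<kappa>\<close> picks out the
  coefficient at \<open>- \<kappa>\<close>; this accounts for the minus sign.\<close>

lemma integral_cinner_trig_poly_char:
  assumes "finite A"
  shows "(\<integral>\<psi>. char_torus \<kappa> \<psi> * cinner (trig_poly A a \<psi>) w \<partial>torus_measure)
     = (\<Sum>\<alpha>\<in>A. of_bool (\<kappa> = - int_vec \<alpha>) * cinner (a \<alpha>) w)"
proof -
  have "(\<integral>\<psi>. char_torus \<kappa> \<psi> * cinner (trig_poly A a \<psi>) w \<partial>torus_measure)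
     = (\<integral>\<psi>. (\<Sum>\<alpha>\<in>A. char_torus \<kappa> \<psi> * char_torus (int_vec \<alpha>) \<psi> * cinner (a \<alpha>) w) \<partial>torus_measure)"
    by (simp add: cinner_trig_poly sum_distrib_left mult.assoc)
  also have "\<dots> = (\<Sum>\<alpha>\<in>A. of_bool (\<kappa> = - int_vec \<alpha>) * cinner (a \<alpha>) w)"
    by (subst Bochner_Integration.integral_sum)
      (auto intro!: integrable_mult_left integrable_char_torus_mult simp: integral_char_torus_mult)
  finally show ?thesis .
qed

text \<open>Parseval for finite sums. Only one of the two factors of the inner product is expanded
  at first, so that the scalar orthogonality relation applies to the other.\<close>

lemma nn_integral_norm_trig_poly:
  assumes "finite A"
  shows "(\<integral>\<^sup>+\<psi>. ennreal ((norm (trig_poly A a \<psi>))\<^sup>2) \<partial>torus_measure) = ennreal (\<Sum>\<alpha>\<in>A. (norm (a \<alpha>))\<^sup>2)"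
proof -
  have int: "integrable torus_measure (\<lambda>\<psi>. (norm (trig_poly A a \<psi>))\<^sup>2)"
  proof (rule integrable_torus_measure_bounded)
    show "(\<lambda>\<psi>. (norm (trig_poly A a \<psi>))\<^sup>2) \<in> borel_measurable lebesgue"
      by (rule measurable_torus_measureI) measurable
    show "norm ((norm (trig_poly A a \<psi>))\<^sup>2) \<le> (\<Sum>\<alpha>\<in>A. norm (a \<alpha>))\<^sup>2" for \<psi>
      using norm_trig_poly_le[of A a \<psi>] by (simp add: power_mono)
  qed
  have eq: "complex_of_real ((norm (trig_poly A a \<psi>))\<^sup>2) = (\<Sum>\<beta>\<in>A. char_torus (- int_vec \<beta>) \<psi> * cinner (trig_poly A a \<psi>) (a \<beta>))" for \<psi>
  proof -
    have "complex_of_real ((norm (trig_poly A a \<psi>))\<^sup>2) = cinner (trig_poly A a \<psi>) (trig_poly A a \<psi>)"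
      by (simp add: cinner_self)
    also have "\<dots> = cnj (\<Sum>\<beta>\<in>A. char_torus (int_vec \<beta>) \<psi> * cinner (a \<beta>) (trig_poly A a \<psi>))"
      by (subst cinner_commute) (subst cinner_trig_poly, simp)
    also have "\<dots> = (\<Sum>\<beta>\<in>A. char_torus (- int_vec \<beta>) \<psi> * cinner (trig_poly A a \<psi>) (a \<beta>))"
      by (simp add: char_torus_minus) (metis cinner_commute)
    finally show ?thesis .
  qed
  have int2: "integrable torus_measure (\<lambda>\<psi>. char_torus \<kappa> \<psi> * cinner (trig_poly A a \<psi>) w)" for \<kappa> w
    unfolding cinner_trig_poly sum_distrib_left mult.assoc[symmetric]
    by (intro Bochner_Integration.integrable_sum integrable_mult_left integrable_char_torus_mult)
  have "complex_of_real (\<integral>\<psi>. (norm (trig_poly A a \<psi>))\<^sup>2 \<partial>torus_measure)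
     = (\<integral>\<psi>. complex_of_real ((norm (trig_poly A a \<psi>))\<^sup>2) \<partial>torus_measure)"
    by (rule integral_complex_of_real[symmetric])
  also have "\<dots> = (\<Sum>\<beta>\<in>A. \<Sum>\<alpha>\<in>A. of_bool (- int_vec \<beta> = - int_vec \<alpha>) * cinner (a \<alpha>) (a \<beta>))"
    unfolding eq by (subst Bochner_Integration.integral_sum) (simp_all add: int2 integral_cinner_trig_poly_char[OF assms])
  also have "\<dots> = (\<Sum>\<beta>\<in>A. cinner (a \<beta>) (a \<beta>))"
    using assms by (simp add: int_vec_eq_iff of_bool_def if_distrib[of "\<lambda>x. x * _"] cong: if_cong)
  also have "\<dots> = complex_of_real (\<Sum>\<alpha>\<in>A. (norm (a \<alpha>))\<^sup>2)"
    by (simp add: cinner_self)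
  finally have "(\<integral>\<psi>. (norm (trig_poly A a \<psi>))\<^sup>2 \<partial>torus_measure) = (\<Sum>\<alpha>\<in>A. (norm (a \<alpha>))\<^sup>2)"
    by (simp only: of_real_eq_iff)
  then show ?thesis using nn_integral_eq_integral[OF int] by simp
qed

text \<open>With \<open>z = cis (s - t)\<close> the chord \<open>cmod (1 - z)\<close> is the
  distance of \<open>cis s\<close> and \<open>cis t\<close>. Where they coincide, the right-hand
  side is infinite because \<open>C > 0\<close>.\<close>

lemma ennreal_kernel_le:
  assumes "multiplier_bound \<mu> C" "C > 0"
  shows "ennreal (cmod (\<Sum>m<N. of_real (\<mu> m / sqrt (real m + 1)) * cis (real m * (s - t))))
    \<le> ennreal C * (1 / ennreal (cmod (cis s - cis t) powr (1/2)))"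
proof -
  define d where "d = cmod (cis s - cis t)"
  define K where "K = cmod (\<Sum>m<N. of_real (\<mu> m / sqrt (real m + 1)) * cis (real m * (s - t)))"
  have "cis t - cis s = cis t * (1 - cis (s - t))"
    by (simp add: right_diff_distrib cis_mult)
  then have d: "d = cmod (1 - cis (s - t))"
    unfolding d_def by (metis norm_minus_commute norm_mult norm_cis mult_1)
  have "cmod (\<Sum>m<N. of_real (\<mu> m / sqrt (real m + 1)) * cis (s - t) ^ m) * sqrt (cmod (1 - cis (s - t))) \<le> C"
    using assms(1) norm_cis[of "s - t"] unfolding multiplier_bound_def by blast
  then have "K * sqrt d \<le> C" by (simp only: K_def d Complex.DeMoivre)
  show ?thesis
  proof (cases "d = 0")
    case True
    then show ?thesis using assms(2) by (simp add: d_def[symmetric] ennreal_mult_top)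
  next
    case False
    then have "d > 0" by (simp add: d_def)
    have "K \<le> C / sqrt d" using \<open>K * sqrt d \<le> C\<close> \<open>d > 0\<close> by (simp add: field_simps)
    also have "C / sqrt d = C * (1 / d powr (1/2))" using \<open>d > 0\<close> by (simp add: powr_half_sqrt)
    finally have "ennreal K \<le> ennreal (C * (1 / d powr (1/2)))" by (rule ennreal_leI)
    also have "\<dots> = ennreal C * (1 / ennreal (d powr (1/2)))"
      using assms(2) \<open>d > 0\<close> by (simp add: ennreal_mult divide_ennreal[symmetric] ennreal_times_divide)
    finally show ?thesis by (simp add: K_def d_def)
  qed
qed

text \<open>Pairing with a vector reduces the Hilbert space valued convolution identity to a
  complex valued one.\<close>

lemma norm_multiplier_le_B_potential:
  fixes a :: "nat ^ 'n \<Rightarrow> 'h::chilbert_space"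
  assumes A: "finite A" and \<mu>: "\<And>i. multiplier_bound (\<mu> i) C" and C: "C > 0"
  shows "ennreal (norm (\<Sum>\<alpha>\<in>A. (\<Prod>i\<in>UNIV. \<mu> i (\<alpha> $ i)) *\<^sub>R (char_torus (int_vec \<alpha>) \<theta> *\<^sub>C a \<alpha>)))
    \<le> ennreal C ^ CARD('n) *
      B_potential (\<lambda>\<psi>. ennreal (norm (trig_poly A (\<lambda>\<alpha>. (\<Prod>i\<in>UNIV. sqrt (real (\<alpha> $ i) + 1)) *\<^sub>R a \<alpha>) \<psi>))) \<theta>"
proof -
  define g where "g \<alpha> = (\<Prod>i\<in>UNIV. sqrt (real (\<alpha> $ i) + 1)) *\<^sub>R a \<alpha>" for \<alpha>
  define b where "b i m = \<mu> i m / sqrt (real m + 1)" for i m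
  define V where "V = (\<Sum>\<alpha>\<in>A. (\<Prod>i\<in>UNIV. \<mu> i (\<alpha> $ i)) *\<^sub>R (char_torus (int_vec \<alpha>) \<theta> *\<^sub>C a \<alpha>))"
  define k where "k \<psi> = (\<Prod>i\<in>UNIV. 1 / ennreal (cmod (cis (\<theta> $ i) - cis (\<psi> $ i)) powr (1/2)))" for \<psi> :: "real ^ 'n"
  define T where "T = trig_poly A g"
  define X where "X = ennreal C ^ CARD('n) * B_potential (\<lambda>\<psi>. ennreal (norm (T \<psi>))) \<theta>"
  have "finite ((\<lambda>(\<alpha>,i). \<alpha> $ i) ` (A \<times> UNIV))" using A by simp
  then obtain N where N: "\<forall>x\<in>(\<lambda>(\<alpha>,i). \<alpha> $ i) ` (A \<times> UNIV). x < N"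
    using finite_nat_set_iff_bounded by metis
  \<comment> \<open>A cube containing \<open>A\<close> lets the kernel be a product of
    one-dimensional kernels; its frequencies outside \<open>A\<close> are annihilated by
    orthogonality to \<open>T\<close>.\<close>
  define D where "D = {\<beta> :: nat ^ 'n. \<forall>i. \<beta> $ i \<in> {..<N}}"
  have D: "finite D" "A \<subseteq> D"
    unfolding D_def using N by (auto simp del: lessThan_iff intro: finite_vec_all)
  define Q where "Q \<psi> = (\<Prod>i\<in>UNIV. \<Sum>m<N. of_real (b i m) * cis (real m * (\<theta> $ i - \<psi> $ i)))" for \<psi>
  have Q: "Q \<psi> = (\<Sum>\<beta>\<in>D. of_real (\<Prod>i\<in>UNIV. b i (\<beta> $ i)) * char_torus (int_vec \<beta>) \<theta> * char_torus (- int_vec \<beta>) \<psi>)" for \<psi>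
  proof -
    have "char_torus (int_vec \<beta>) \<theta> * char_torus (- int_vec \<beta>) \<psi> = (\<Prod>i\<in>UNIV. cis (real (\<beta> $ i) * (\<theta> $ i - \<psi> $ i)))" for \<beta>
      by (subst char_torus_diff_arg[symmetric]) (simp add: char_torus_eq_prod int_vec_def)
    then show ?thesis
      unfolding Q_def D_def prod_sum_vec[OF finite_lessThan] mult.assoc by (simp add: prod.distrib)
  qed
  have Qk: "ennreal (cmod (Q \<psi>)) \<le> ennreal C ^ CARD('n) * k \<psi>" for \<psi>
  proof -
    have "ennreal (cmod (Q \<psi>)) = (\<Prod>i\<in>UNIV. ennreal (cmod (\<Sum>m<N. of_real (b i m) * cis (real m * (\<theta> $ i - \<psi> $ i)))))"
      unfolding Q_def by (simp add: prod_norm[symmetric] prod_ennreal)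
    also have "\<dots> \<le> (\<Prod>i\<in>UNIV. ennreal C * (1 / ennreal (cmod (cis (\<theta> $ i) - cis (\<psi> $ i)) powr (1/2))))"
      unfolding b_def by (intro prod_mono_ennreal ennreal_kernel_le \<mu> C)
    also have "\<dots> = ennreal C ^ CARD('n) * k \<psi>" by (simp add: k_def prod.distrib)
    finally show ?thesis .
  qed
  have int2: "integrable torus_measure (\<lambda>\<psi>. char_torus \<kappa> \<psi> * cinner (T \<psi>) w)" for \<kappa> w
    unfolding T_def cinner_trig_poly sum_distrib_left mult.assoc[symmetric]
    by (intro Bochner_Integration.integrable_sum integrable_mult_left integrable_char_torus_mult)
  \<comment> \<open>The roots in \<open>b\<close> and \<open>g\<close> cancel, so convolution with
    \<open>Q\<close> turns the coefficients of \<open>T\<close> into those of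
    \<open>V\<close>.\<close>
  have bg: "(\<Prod>i\<in>UNIV. b i (\<alpha> $ i)) *\<^sub>R g \<alpha> = (\<Prod>i\<in>UNIV. \<mu> i (\<alpha> $ i)) *\<^sub>R a \<alpha>" for \<alpha>
    unfolding g_def b_def scaleR_scaleR prod.distrib[symmetric] by (simp add: add_nonneg_eq_0_iff)
  have conv: "(\<integral>\<psi>. Q \<psi> * cinner (T \<psi>) w \<partial>torus_measure) = cinner V w" for w
  proof -
    have "(\<integral>\<psi>. Q \<psi> * cinner (T \<psi>) w \<partial>torus_measure)
        = (\<integral>\<psi>. (\<Sum>\<beta>\<in>D. (of_real (\<Prod>i\<in>UNIV. b i (\<beta> $ i)) * char_torus (int_vec \<beta>) \<theta>) * (char_torus (- int_vec \<beta>) \<psi> * cinner (T \<psi>) w)) \<partial>torus_measure)"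
      unfolding Q by (simp add: sum_distrib_right mult.assoc)
    also have "\<dots> = (\<Sum>\<beta>\<in>D. (of_real (\<Prod>i\<in>UNIV. b i (\<beta> $ i)) * char_torus (int_vec \<beta>) \<theta>) * (\<Sum>\<alpha>\<in>A. of_bool (- int_vec \<beta> = - int_vec \<alpha>) * cinner (g \<alpha>) w))"
      by (subst Bochner_Integration.integral_sum)
        (use int2 in \<open>auto simp: T_def integral_cinner_trig_poly_char[OF A]\<close>)
    also have "\<dots> = (\<Sum>\<beta>\<in>D. if \<beta> \<in> A then of_real (\<Prod>i\<in>UNIV. b i (\<beta> $ i)) * char_torus (int_vec \<beta>) \<theta> * cinner (g \<beta>) w else 0)"
      using A by (intro sum.cong) (auto simp: int_vec_eq_iff of_bool_def if_distrib[of "\<lambda>x. x * _"] cong: if_cong)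
    also have "\<dots> = (\<Sum>\<beta>\<in>A. of_real (\<Prod>i\<in>UNIV. b i (\<beta> $ i)) * char_torus (int_vec \<beta>) \<theta> * cinner (g \<beta>) w)"
      using D by (intro sum.mono_neutral_cong_right) auto
    also have "\<dots> = (\<Sum>\<beta>\<in>A. char_torus (int_vec \<beta>) \<theta> * cinner ((\<Prod>i\<in>UNIV. b i (\<beta> $ i)) *\<^sub>R g \<beta>) w)"
      by (simp only: cinner_scaleR_left scaleR_conv_of_real mult_ac)
    also have "\<dots> = cinner V w"
      unfolding bg V_def cinner_sum_left cinner_scaleR_left cinner_scaleC_left by simp
    finally show ?thesis .
  qed
  have [measurable]: "k \<in> borel_measurable borel"
    unfolding k_def[abs_def] by measurable
  have [measurable]: "(\<lambda>\<psi>. norm (T \<psi>)) \<in> borel_measurable borel" unfolding T_def by measurable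
  have "ennreal (cmod (cinner V w)) \<le> ennreal (norm w) * X" for w
  proof -
    have "ennreal (cmod (cinner V w)) \<le> (\<integral>\<^sup>+\<psi>. ennreal (cmod (Q \<psi> * cinner (T \<psi>) w)) \<partial>torus_measure)"
      unfolding conv[symmetric]
    proof (rule integral_norm_bound_ennreal)
      show "integrable torus_measure (\<lambda>\<psi>. Q \<psi> * cinner (T \<psi>) w)"
        unfolding Q sum_distrib_right mult.assoc
        by (intro Bochner_Integration.integrable_sum integrable_mult_right int2)
    qed
    also have "\<dots> \<le> (\<integral>\<^sup>+\<psi>. (ennreal (norm w) * ennreal C ^ CARD('n)) * (k \<psi> * ennreal (norm (T \<psi>))) \<partial>torus_measure)"
    proof (rule nn_integral_mono)
      fix \<psi>
      have "ennreal (cmod (Q \<psi> * cinner (T \<psi>) w)) \<le> ennreal (cmod (Q \<psi>)) * ennreal (norm (T \<psi>) * norm w)"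
        unfolding norm_mult ennreal_mult'[OF norm_ge_zero]
        by (intro mult_left_mono ennreal_leI[OF cinner_Cauchy_Schwarz, unfolded ennreal_mult'[OF norm_ge_zero]]) simp
      also have "\<dots> \<le> (ennreal C ^ CARD('n) * k \<psi>) * ennreal (norm (T \<psi>) * norm w)"
        by (rule mult_right_mono[OF Qk]) simp
      also have "\<dots> = (ennreal (norm w) * ennreal C ^ CARD('n)) * (k \<psi> * ennreal (norm (T \<psi>)))"
        by (simp add: ennreal_mult mult_ac)
      finally show "ennreal (cmod (Q \<psi> * cinner (T \<psi>) w)) \<le> \<dots>" .
    qed
    also have "\<dots> = (ennreal (norm w) * ennreal C ^ CARD('n)) * (\<integral>\<^sup>+\<psi>. k \<psi> * ennreal (norm (T \<psi>)) \<partial>torus_measure)"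
      by (rule nn_integral_cmult) (simp add: measurable_completion cong: measurable_cong_sets)
    also have "\<dots> = ennreal (norm w) * X"
      by (simp add: X_def B_potential_def k_def mult.assoc)
    finally show ?thesis .
  qed
  \<comment> \<open>Duality: for \<open>w = V\<close> the pairing is the square of the norm, and one
    factor \<open>norm V\<close> cancels unless it is zero.\<close>
  from this[of V] have "ennreal (norm V) * ennreal (norm V) \<le> ennreal (norm V) * X"
    by (simp add: cinner_self norm_power power2_eq_square ennreal_mult norm_mult)
  then have "ennreal (norm V) \<le> X"
    by (cases "norm V = 0") (simp_all add: ennreal_mult_le_mult_iff)
  then show ?thesis by (simp add: V_def X_def T_def g_def[abs_def])
qed

section \<open>Sets on which a potential is infinite\<close>

lemma B_potential_cmult:
  fixes G :: "real ^ 'n \<Rightarrow> ennreal"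
  assumes "G \<in> borel_measurable lebesgue"
  shows "B_potential (\<lambda>\<psi>. c * G \<psi>) \<theta> = c * B_potential G \<theta>"
proof -
  have "(\<lambda>\<psi>::real^'n. \<Prod>i\<in>UNIV. 1 / ennreal (cmod (cis (\<theta> $ i) - cis (\<psi> $ i)) powr (1/2))) \<in> borel_measurable borel"
    by measurable
  then have "(\<lambda>\<psi>::real^'n. \<Prod>i\<in>UNIV. 1 / ennreal (cmod (cis (\<theta> $ i) - cis (\<psi> $ i)) powr (1/2))) \<in> borel_measurable torus_measure"
    by (simp add: measurable_completion cong: measurable_cong_sets)
  then show ?thesis
    unfolding B_potential_def using assms
    by (subst nn_integral_cmult[symmetric]) (auto simp: mult_ac)
qed

text \<open>Every multiple \<open>e * G\<close> with \<open>e > 0\<close> is admissible, as its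
  potential stays infinite on the set, while its energy carries the factor
  \<open>e\<^sup>2\<close>.\<close>

lemma capacity_B_potential_top:
  fixes G :: "real ^ 'n \<Rightarrow> ennreal"
  assumes G: "G \<in> borel_measurable lebesgue" and L2: "(\<integral>\<^sup>+\<psi>. (G \<psi>)\<^sup>2 \<partial>torus_measure) < \<infinity>"
  shows "capacity {\<theta> \<in> torus. B_potential G \<theta> = \<infinity>} = 0"
proof -
  define I where "I = (\<integral>\<^sup>+\<psi>. (G \<psi>)\<^sup>2 \<partial>torus_measure)"
  have GM: "G \<in> borel_measurable torus_measure" using G by simp
  have le: "capacity {\<theta> \<in> torus. B_potential G \<theta> = \<infinity>} \<le> (ennreal e)\<^sup>2 * I" if "e > 0" for e
  proof -
    note B = B_potential_cmult[OF G]
    have "capacity {\<theta> \<in> torus. B_potential G \<theta> = \<infinity>} \<le> (\<integral>\<^sup>+\<psi>. (ennreal e * G \<psi>)\<^sup>2 \<partial>torus_measure)"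
      unfolding capacity_def
      by (rule INF_lower) (use G that in \<open>auto simp: B ennreal_mult_top\<close>)
    also have "\<dots> = (ennreal e)\<^sup>2 * I"
      unfolding I_def by (subst nn_integral_cmult[symmetric]) (use GM in \<open>auto simp: power_mult_distrib\<close>)
    finally show ?thesis .
  qed
  obtain J where J: "I = ennreal J" "J \<ge> 0" using L2 unfolding I_def[symmetric] by (cases I) auto
  have small: "capacity {\<theta> \<in> torus. B_potential G \<theta> = \<infinity>} \<le> ennreal \<epsilon>" if "\<epsilon> > 0" for \<epsilon>
  proof -
    \<comment> \<open>\<open>J + 1\<close> in place of \<open>J\<close> keeps \<open>e\<close>
      positive when the energy vanishes.\<close>
    define e where "e = sqrt (\<epsilon> / (J + 1))"
    have e: "e > 0" using that J by (simp add: e_def)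
    have "e\<^sup>2 * J \<le> \<epsilon>" using that J by (simp add: e_def field_simps)
    then have "(ennreal e)\<^sup>2 * I \<le> ennreal \<epsilon>"
      using e J by (simp add: ennreal_power ennreal_mult[symmetric] ennreal_leI)
    with le[OF e] show ?thesis by (rule order_trans)
  qed
  have "capacity {\<theta> \<in> torus. B_potential G \<theta> = \<infinity>} \<le> 0"
    by (rule ennreal_le_epsilon) (simp only: add_0 small)
  then show ?thesis by simp
qed

subsection \<open>Integrability of strongly measurable functions\<close>

text \<open>The measurability clause of \<open>L2_torus\<close> by itself, as it is also needed for
  products of \<open>f\<close> with characters and for differences from simple functions.\<close>

definition strongly_measurable :: "('a::euclidean_space \<Rightarrow> 'h::real_normed_vector) \<Rightarrow> bool" where
  "strongly_measurable f \<longleftrightarrow> (\<exists>s. (\<forall>k::nat. simple_function lebesgue (s k)) \<and>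
     (AE x in lebesgue. (\<lambda>k. s k x) \<longlonglongrightarrow> f x))"

text \<open>A continuous map into a Euclidean space leads back to Borel measurability, which
  survives limits. It is applied to the norm and to pairings with a vector.\<close>

lemma strongly_measurable_compose:
  fixes \<phi> :: "'h::real_normed_vector \<Rightarrow> 'b::euclidean_space"
  assumes f: "strongly_measurable f" and \<phi>: "continuous_on UNIV \<phi>"
  shows "(\<lambda>x. \<phi> (f x)) \<in> borel_measurable lebesgue"
proof -
  obtain s where s: "\<And>k::nat. simple_function lebesgue (s k)" "AE x in lebesgue. (\<lambda>k. s k x) \<longlonglongrightarrow> f x"
    using f unfolding strongly_measurable_def by blast
  have [measurable]: "(\<lambda>x. \<phi> (s k x)) \<in> borel_measurable lebesgue" for k
    using simple_function_compose1[OF s(1), of \<phi> k] by (rule borel_measurable_simple_function)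
  have "(\<lambda>x. lim (\<lambda>k. \<phi> (s k x))) \<in> borel_measurable lebesgue"
    by measurable
  moreover have "AE x in lebesgue. lim (\<lambda>k. \<phi> (s k x)) = \<phi> (f x)"
    using s(2)
  proof (rule eventually_mono)
    fix x assume "(\<lambda>k. s k x) \<longlonglongrightarrow> f x"
    then have "(\<lambda>k. \<phi> (s k x)) \<longlonglongrightarrow> \<phi> (f x)"
      using \<phi> by (intro isCont_tendsto_compose[of _ \<phi>]) (auto simp: continuous_on_eq_continuous_at)
    then show "lim (\<lambda>k. \<phi> (s k x)) = \<phi> (f x)" by (rule limI)
  qed
  ultimately show ?thesis by (rule borel_measurable_AE)
qed

lemma strongly_measurable_scaleC:
  fixes f :: "'a::euclidean_space \<Rightarrow> 'h::chilbert_space"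
  assumes f: "strongly_measurable f" and c: "c \<in> borel_measurable lebesgue"
  shows "strongly_measurable (\<lambda>x. c x *\<^sub>C f x)"
proof -
  obtain s where s: "\<And>k::nat. simple_function lebesgue (s k)" "AE x in lebesgue. (\<lambda>k. s k x) \<longlonglongrightarrow> f x"
    using f unfolding strongly_measurable_def by blast
  obtain t where t: "\<And>k::nat. simple_function lebesgue (t k)" "\<And>x. (\<lambda>k. t k x) \<longlonglongrightarrow> c x"
    using borel_measurable_implies_sequence_metric[OF c, of 0] by auto
  have "(\<lambda>k. t k x *\<^sub>C s k x) \<longlonglongrightarrow> c x *\<^sub>C f x" if "(\<lambda>k. s k x) \<longlonglongrightarrow> f x" for x
  proof -
    \<comment> \<open>The product is split as \<open>t * (s - f) + t * f\<close>: the first part is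
      estimated in norm, the second is linear in \<open>t\<close>.\<close>
    have "(\<lambda>k. t k x *\<^sub>C (s k x - f x)) \<longlonglongrightarrow> 0"
    proof (rule Lim_null_comparison)
      show "\<forall>\<^sub>F k in sequentially. norm (t k x *\<^sub>C (s k x - f x)) \<le> cmod (t k x) * norm (s k x - f x)"
        by (simp add: norm_scaleC)
      have "(\<lambda>k. cmod (t k x) * norm (s k x - f x)) \<longlonglongrightarrow> cmod (c x) * norm (f x - f x)"
        by (intro tendsto_intros t that)
      then show "(\<lambda>k. cmod (t k x) * norm (s k x - f x)) \<longlonglongrightarrow> 0" by simp
    qed
    moreover have "(\<lambda>k. t k x *\<^sub>C f x) \<longlonglongrightarrow> c x *\<^sub>C f x"
      by (rule bounded_linear.tendsto[OF bounded_linear_scaleC_left t(2)])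
    ultimately have "(\<lambda>k. t k x *\<^sub>C (s k x - f x) + t k x *\<^sub>C f x) \<longlonglongrightarrow> 0 + c x *\<^sub>C f x"
      by (rule tendsto_add)
    then show ?thesis by (simp add: scaleC_add_right[symmetric])
  qed
  then have "AE x in lebesgue. (\<lambda>k. t k x *\<^sub>C s k x) \<longlonglongrightarrow> c x *\<^sub>C f x"
    using s(2) by (auto elim: eventually_mono)
  moreover have "simple_function lebesgue (\<lambda>x. t k x *\<^sub>C s k x)" for k
    by (rule simple_function_compose2[OF t(1) s(1)])
  ultimately show ?thesis unfolding strongly_measurable_def by (intro exI[of _ "\<lambda>k x. t k x *\<^sub>C s k x"]) auto
qed

text \<open>Such a function is a finite combination of indicators of its level sets, which have
  finite measure once intersected with the box.\<close>

lemma simple_function_integrable_on_cbox: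
  fixes t :: "'a::euclidean_space \<Rightarrow> 'h::banach"
  assumes "simple_function lebesgue t"
  shows "t integrable_on cbox a b"
proof -
  have fin: "finite (range t)" and meas: "t -` {y} \<in> sets lebesgue" if "y \<in> range t" for y
    using assms that by (auto simp: simple_function_def)
  have finr: "finite (range t)" using fin by blast
  have "t = (\<lambda>x. \<Sum>y\<in>range t. indicat_real (t -` {y}) x *\<^sub>R y)"
  proof
    fix x
    have "(\<Sum>y\<in>range t. indicat_real (t -` {y}) x *\<^sub>R y) = (\<Sum>y\<in>range t. if y = t x then y else 0)"
      by (intro sum.cong) (auto simp: indicator_def)
    then show "t x = (\<Sum>y\<in>range t. indicat_real (t -` {y}) x *\<^sub>R y)"
      using finr by simp
  qed
  moreover have "(\<lambda>x. \<Sum>y\<in>range t. indicat_real (t -` {y}) x *\<^sub>R y) integrable_on cbox a b"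
  proof (intro integrable_sum finr integrable_on_scaleR_left)
    fix y assume "y \<in> range t"
    then have "t -` {y} \<inter> cbox a b \<in> lmeasurable"
      using meas by (intro fmeasurableI2[OF lmeasurable_cbox[of a b]]) auto
    then show "indicat_real (t -` {y}) integrable_on cbox a b" by (simp add: integrable_on_indicator)
  qed
  ultimately show ?thesis by simp
qed

lemma norm_diff_chain:
  fixes x :: "'a::real_normed_vector"
  assumes "norm (y - y') < e / 2" "norm (x - y) < e / 4" "norm (x' - y') < e / 4"
  shows "norm (x - x') < e"
  using norm_diff_triangle_less[OF norm_diff_triangle_less[OF assms(2,1)], of x' "e / 4"] assms(3)
  by (simp add: norm_minus_commute)

text \<open>Cauchy criterion for Riemann sums. The sums of \<open>F\<close> and \<open>t\<close>
  differ by at most the Riemann sum of the real function \<open>norm (F x - t x)\<close>, which a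
  fine gauge brings close to its small integral.\<close>

lemma integrable_on_cbox_if_L1_approximable:
  fixes F :: "'a::euclidean_space \<Rightarrow> 'h::banach"
  assumes "\<And>e. e > 0 \<Longrightarrow> \<exists>t. t integrable_on cbox a b \<and> (\<lambda>x. norm (F x - t x)) integrable_on cbox a b \<and>
     integral (cbox a b) (\<lambda>x. norm (F x - t x)) < e"
  shows "F integrable_on cbox a b"
  unfolding integrable_Cauchy
proof (intro allI impI)
  fix e :: real assume e: "e > 0"
  then have "e / 8 > 0" "e / 2 > 0" by auto
  obtain t where t: "t integrable_on cbox a b" and q: "(\<lambda>x. norm (F x - t x)) integrable_on cbox a b"
     "integral (cbox a b) (\<lambda>x. norm (F x - t x)) < e / 8"
    using assms[OF \<open>e / 8 > 0\<close>] by blast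
  define q where "q x = norm (F x - t x)" for x
  have "\<exists>\<gamma>. gauge \<gamma> \<and> (\<forall>\<D>1 \<D>2. \<D>1 tagged_division_of (cbox a b) \<and> \<gamma> fine \<D>1 \<and>
            \<D>2 tagged_division_of (cbox a b) \<and> \<gamma> fine \<D>2 \<longrightarrow>
            norm ((\<Sum>(x,K)\<in>\<D>1. measure lborel K *\<^sub>R t x) - (\<Sum>(x,K)\<in>\<D>2. measure lborel K *\<^sub>R t x)) < e / 2)"
    by (rule t[unfolded integrable_Cauchy, THEN spec, THEN mp, OF \<open>e / 2 > 0\<close>])
  then obtain \<gamma>1 where \<gamma>1: "gauge \<gamma>1" "\<forall>\<D>1 \<D>2. \<D>1 tagged_division_of (cbox a b) \<and> \<gamma>1 fine \<D>1 \<and>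
            \<D>2 tagged_division_of (cbox a b) \<and> \<gamma>1 fine \<D>2 \<longrightarrow>
            norm ((\<Sum>(x,K)\<in>\<D>1. measure lborel K *\<^sub>R t x) - (\<Sum>(x,K)\<in>\<D>2. measure lborel K *\<^sub>R t x)) < e / 2"
    by (elim exE conjE)
  have "(q has_integral integral (cbox a b) q) (cbox a b)"
    using q(1) unfolding q_def[symmetric] by (rule integrable_integral)
  then have "\<exists>\<gamma>. gauge \<gamma> \<and> (\<forall>\<D>. \<D> tagged_division_of (cbox a b) \<and> \<gamma> fine \<D> \<longrightarrow>
        norm ((\<Sum>(x, k)\<in>\<D>. measure lborel k *\<^sub>R q x) - integral (cbox a b) q) < e / 8)"
    by (rule has_integral[THEN iffD1, THEN spec, THEN mp, OF _ \<open>e / 8 > 0\<close>])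
  then obtain \<gamma>2 where \<gamma>2: "gauge \<gamma>2" "\<forall>\<D>. \<D> tagged_division_of (cbox a b) \<and> \<gamma>2 fine \<D> \<longrightarrow>
        norm ((\<Sum>(x, k)\<in>\<D>. measure lborel k *\<^sub>R q x) - integral (cbox a b) q) < e / 8"
    by (elim exE conjE)
  have close: "norm ((\<Sum>(x,K)\<in>\<D>. measure lborel K *\<^sub>R F x) - (\<Sum>(x,K)\<in>\<D>. measure lborel K *\<^sub>R t x)) < e / 4"
    if "\<D> tagged_division_of (cbox a b)" "\<gamma>2 fine \<D>" for \<D>
  proof -
    have "norm ((\<Sum>(x,K)\<in>\<D>. measure lborel K *\<^sub>R F x) - (\<Sum>(x,K)\<in>\<D>. measure lborel K *\<^sub>R t x))
       = norm (\<Sum>(x,K)\<in>\<D>. measure lborel K *\<^sub>R (F x - t x))"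
      by (simp add: sum_subtractf[symmetric] case_prod_unfold scaleR_diff_right)
    also have "\<dots> \<le> (\<Sum>(x,K)\<in>\<D>. measure lborel K *\<^sub>R q x)"
      by (rule order_trans[OF norm_sum]) (simp add: case_prod_unfold q_def)
    \<comment> \<open>One \<open>e / 8\<close> bounds the integral itself, the other the error of
      its Riemann sum.\<close>
    also have "\<dots> < e / 8 + e / 8"
      using \<gamma>2(2)[THEN spec, THEN mp, OF conjI[OF that]] q(2) unfolding q_def[symmetric] real_norm_def by linarith
    finally show ?thesis by simp
  qed
  show "\<exists>\<gamma>. gauge \<gamma> \<and> (\<forall>\<D>1 \<D>2. \<D>1 tagged_division_of (cbox a b) \<and> \<gamma> fine \<D>1 \<and>
            \<D>2 tagged_division_of (cbox a b) \<and> \<gamma> fine \<D>2 \<longrightarrow>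
            norm ((\<Sum>(x,K)\<in>\<D>1. measure lborel K *\<^sub>R F x) - (\<Sum>(x,K)\<in>\<D>2. measure lborel K *\<^sub>R F x)) < e)"
  proof (intro exI[of _ "\<lambda>x. \<gamma>1 x \<inter> \<gamma>2 x"] conjI allI impI)
    show "gauge (\<lambda>x. \<gamma>1 x \<inter> \<gamma>2 x)" using \<gamma>1(1) \<gamma>2(1) by (rule gauge_Int)
    fix \<D>1 \<D>2 assume D: "\<D>1 tagged_division_of (cbox a b) \<and> (\<lambda>x. \<gamma>1 x \<inter> \<gamma>2 x) fine \<D>1 \<and>
            \<D>2 tagged_division_of (cbox a b) \<and> (\<lambda>x. \<gamma>1 x \<inter> \<gamma>2 x) fine \<D>2"
    let ?S = "\<lambda>\<D> f. (\<Sum>(x,K)\<in>\<D>. measure lborel K *\<^sub>R f x)"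
    have "norm (?S \<D>1 t - ?S \<D>2 t) < e / 2" using D by (intro \<gamma>1(2)[rule_format]) (auto simp: fine_Int)
    moreover have "norm (?S \<D>1 F - ?S \<D>1 t) < e / 4"
      by (rule close) (use D in \<open>auto simp: fine_Int\<close>)
    moreover have "norm (?S \<D>2 F - ?S \<D>2 t) < e / 4"
      by (rule close) (use D in \<open>auto simp: fine_Int\<close>)
    ultimately show "norm (?S \<D>1 F - ?S \<D>2 F) < e"
      by (rule norm_diff_chain)
  qed
qed

text \<open>Simple functions converging almost everywhere to the restriction \<open>F\<close> of
  \<open>f\<close> to \<open>S\<close> are truncated so as to converge in mean, by dominated
  convergence for the real functions \<open>norm (F x - t k x)\<close>.\<close>

lemma strongly_measurable_integrable_on:
  fixes f :: "'a::euclidean_space \<Rightarrow> 'h::chilbert_space"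
  assumes f: "strongly_measurable f" and S: "S \<in> sets lebesgue" "bounded S"
    and int: "integrable lebesgue (\<lambda>x. indicat_real S x * norm (f x))"
  shows "f integrable_on S"
proof -
  define F where "F x = complex_of_real (indicat_real S x) *\<^sub>C f x" for x
  have F: "strongly_measurable F"
    unfolding F_def using S by (intro strongly_measurable_scaleC f) auto
  have nF: "norm (F x) = indicat_real S x * norm (f x)" for x
    by (simp add: F_def norm_scaleC)
  have nFm: "(\<lambda>x. norm (F x)) \<in> borel_measurable lebesgue"
    by (rule strongly_measurable_compose[OF F]) (intro continuous_intros)
  obtain s where s: "\<And>k::nat. simple_function lebesgue (s k)" "AE x in lebesgue. (\<lambda>k. s k x) \<longlonglongrightarrow> F x"
    using F unfolding strongly_measurable_def by blast
  \<comment> \<open>Truncation at twice the norm gives domination by a multiple of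
    \<open>norm (F x)\<close>. The factor 2 leaves the sequence eventually unchanged where it
    converges and \<open>F x \<noteq> 0\<close>; where \<open>F x = 0\<close> the truncated value is
    0.\<close>
  define t where "t k x = (if norm (s k x) \<le> 2 * norm (F x) then s k x else 0)" for k x
  have nsm: "(\<lambda>x. norm (s k x)) \<in> borel_measurable lebesgue" for k
    using simple_function_compose1[OF s(1), of norm k] by (rule borel_measurable_simple_function)
  have t: "simple_function lebesgue (t k)" for k
    unfolding t_def[abs_def]
    by (rule simple_function_If[OF s(1) simple_function_const]) (use nsm[of k] nFm in measurable)
  have t_lim: "AE x in lebesgue. (\<lambda>k. t k x) \<longlonglongrightarrow> F x"
    using s(2)
  proof (rule eventually_mono)
    fix x assume sx: "(\<lambda>k. s k x) \<longlonglongrightarrow> F x"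
    show "(\<lambda>k. t k x) \<longlonglongrightarrow> F x"
    proof (cases "F x = 0")
      case True
      then have "t k x = 0" for k by (simp add: t_def)
      with True show ?thesis by simp
    next
      case False
      then have "norm (F x) < 2 * norm (F x)" by simp
      with tendsto_norm[OF sx] have "\<forall>\<^sub>F k in sequentially. norm (s k x) < 2 * norm (F x)"
        by (rule order_tendstoD)
      then have "\<forall>\<^sub>F k in sequentially. s k x = t k x"
        by (rule eventually_mono) (simp add: t_def)
      with sx show ?thesis by (rule Lim_transform_eventually)
    qed
  qed
  have tF: "norm (t k x) \<le> 2 * norm (F x)" for k x by (simp add: t_def)
  have diff_meas: "(\<lambda>x. norm (F x - t k x)) \<in> borel_measurable lebesgue" for k
  proof -
    have "strongly_measurable (\<lambda>x. F x - t k x)"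
      unfolding strongly_measurable_def
    proof (intro exI[of _ "\<lambda>j x. t j x - t k x"] conjI allI)
      show "simple_function lebesgue (\<lambda>x. t j x - t k x)" for j
        by (rule simple_function_compose2[OF t t])
      show "AE x in lebesgue. (\<lambda>j. t j x - t k x) \<longlonglongrightarrow> F x - t k x"
        using t_lim by (rule eventually_mono) (intro tendsto_intros)
    qed
    then show ?thesis by (rule strongly_measurable_compose) (intro continuous_intros)
  qed
  have bound: "norm (norm (F x - t k x)) \<le> 3 * norm (F x)" for k x
    using norm_triangle_ineq4[of "F x" "t k x"] tF[of k x] by simp
  have intF: "integrable lebesgue (\<lambda>x. 3 * norm (F x))" using int by (simp add: nF)
  have intD: "integrable lebesgue (\<lambda>x. norm (F x - t k x))" for k
    by (rule Bochner_Integration.integrable_bound[OF intF diff_meas]) (use bound in \<open>auto intro: order_trans[OF _ abs_ge_self]\<close>)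
  have "(\<lambda>k. \<integral>x. norm (F x - t k x) \<partial>lebesgue) \<longlonglongrightarrow> (\<integral>x. 0 \<partial>(lebesgue :: 'a measure))"
  proof (rule integral_dominated_convergence[where w = "\<lambda>x. 3 * norm (F x)"])
    show "AE x in lebesgue. (\<lambda>k. norm (F x - t k x)) \<longlonglongrightarrow> 0"
      using t_lim
    proof (rule eventually_mono)
      fix x assume "(\<lambda>k. t k x) \<longlonglongrightarrow> F x"
      from tendsto_norm[OF tendsto_diff[OF tendsto_const[of "F x"] this]]
      show "(\<lambda>k. norm (F x - t k x)) \<longlonglongrightarrow> 0" by simp
    qed
  qed (use diff_meas intF bound in auto)
  then have lim0: "(\<lambda>k. \<integral>x. norm (F x - t k x) \<partial>lebesgue) \<longlonglongrightarrow> 0" by simp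
  obtain a b where ab: "S \<subseteq> cbox a b" using bounded_subset_cbox_symmetric[OF S(2)] by metis
  have "F integrable_on cbox a b"
  proof (rule integrable_on_cbox_if_L1_approximable)
    fix e :: real assume "e > 0"
    then have "\<forall>\<^sub>F k in sequentially. (\<integral>x. norm (F x - t k x) \<partial>lebesgue) < e"
      using lim0 by (rule order_tendstoD(2)[rotated])
    then obtain k where k: "(\<integral>x. norm (F x - t k x) \<partial>lebesgue) < e"
      by (auto simp: eventually_sequentially)
    have q: "((\<lambda>x. norm (F x - t k x)) has_integral (\<integral>x. norm (F x - t k x) \<partial>lebesgue)) UNIV"
      by (rule has_integral_integral_lebesgue[OF intD])
    then have qc: "(\<lambda>x. norm (F x - t k x)) integrable_on cbox a b"
      by (intro integrable_on_subcbox[of _ UNIV]) auto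
    have "integral (cbox a b) (\<lambda>x. norm (F x - t k x)) \<le> integral UNIV (\<lambda>x. norm (F x - t k x))"
      using q qc by (intro integral_subset_le) auto
    also have "\<dots> < e" using k q by (simp add: integral_unique)
    finally show "\<exists>t. t integrable_on cbox a b \<and> (\<lambda>x. norm (F x - t x)) integrable_on cbox a b \<and>
        integral (cbox a b) (\<lambda>x. norm (F x - t x)) < e"
      using qc simple_function_integrable_on_cbox[OF t] by (intro exI[of _ "t k"]) auto
  qed
  then obtain i where i: "(F has_integral i) (cbox a b)" by blast
  have "F = (\<lambda>x. if x \<in> S then f x else 0)"
    by (auto simp: F_def scaleC_of_real[of 1, simplified] scaleC_of_real[of 0, simplified])
  with i have "(f has_integral i) S" using ab by simp
  then show ?thesis by blast
qed

text \<open>The passage from vector-valued Henstock-Kurzweil integrals to complex Lebesgue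
  integrals, in which the Fourier coefficients and box means of \<open>f\<close> are then
  computed.\<close>

lemma cinner_integral:
  fixes f :: "'a::euclidean_space \<Rightarrow> 'h::chilbert_space"
  assumes "strongly_measurable f" "S \<in> sets lebesgue" "bounded S"
    and int: "integrable lebesgue (\<lambda>x. indicat_real S x * norm (f x))"
  shows "cinner (integral S f) w = (\<integral>x. indicat_real S x *\<^sub>R cinner (f x) w \<partial>lebesgue)"
proof -
  have fS: "f integrable_on S" by (rule strongly_measurable_integrable_on[OF assms])
  have "cinner (integral S f) w = integral S (\<lambda>x. cinner (f x) w)"
    using integral_linear[OF fS bounded_linear_cinner_left[of w]] by (simp add: o_def)
  also have "\<dots> = (LINT x:S|lebesgue. cinner (f x) w)"
  proof (rule set_lebesgue_integral_eq_integral(2)[symmetric])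
    have m: "(\<lambda>x. cinner (f x) w) \<in> borel_measurable lebesgue"
      by (rule strongly_measurable_compose[OF assms(1)]) (rule bounded_linear.continuous_on[OF bounded_linear_cinner_left continuous_on_id])
    have "integrable lebesgue (\<lambda>x. norm w * (indicat_real S x * norm (f x)))" using int by simp
    then show "set_integrable lebesgue S (\<lambda>x. cinner (f x) w)"
      unfolding set_integrable_def
    proof (rule Bochner_Integration.integrable_bound)
      show "(\<lambda>x. indicat_real S x *\<^sub>R cinner (f x) w) \<in> borel_measurable lebesgue"
        using m assms(2) by simp
      have "indicat_real S x * cmod (cinner (f x) w) \<le> norm w * (indicat_real S x * norm (f x))" for x
        using cinner_Cauchy_Schwarz[of "f x" w] by (auto simp: indicator_def mult.commute)
      then show "AE x in lebesgue. norm (indicat_real S x *\<^sub>R cinner (f x) w) \<le> norm (norm w * (indicat_real S x * norm (f x)))"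
        by (auto simp: abs_mult)
    qed
  qed
  finally show ?thesis by (simp add: set_lebesgue_integral_def)
qed

subsection \<open>Trigonometric polynomials as test functions\<close>

text \<open>Generation from characters by addition gives an induction principle for identities that
  are additive in the test function, without a choice of coefficients.\<close>

inductive trigonometric :: "(real ^ 'n \<Rightarrow> complex) \<Rightarrow> bool" where
  char: "trigonometric (\<lambda>\<psi>. c * char_torus \<kappa> \<psi>)"
| add: "trigonometric S \<Longrightarrow> trigonometric T \<Longrightarrow> trigonometric (\<lambda>\<psi>. S \<psi> + T \<psi>)"

lemma trigonometric_char_mult: "trigonometric T \<Longrightarrow> trigonometric (\<lambda>\<psi>. (c * char_torus \<kappa> \<psi>) * T \<psi>)"
proof (induction rule: trigonometric.induct)
  case (char d \<mu>)
  have "(\<lambda>\<psi>. (c * char_torus \<kappa> \<psi>) * (d * char_torus \<mu> \<psi>)) = (\<lambda>\<psi>. (c * d) * char_torus (\<kappa> + \<mu>) \<psi>)"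
    by (simp add: char_torus_add mult_ac)
  then show ?case by (simp only: trigonometric.char)
next
  case (add S T)
  show ?case unfolding ring_distribs by (rule trigonometric.add[OF add.IH])
qed

lemma trigonometric_mult: "trigonometric S \<Longrightarrow> trigonometric T \<Longrightarrow> trigonometric (\<lambda>\<psi>. S \<psi> * T \<psi>)"
proof (induction rule: trigonometric.induct)
  case (char c \<kappa>)
  then show ?case by (rule trigonometric_char_mult)
next
  case (add S S')
  then show ?case unfolding ring_distribs by (intro trigonometric.add) auto
qed

lemma trigonometric_const: "trigonometric (\<lambda>\<psi>. c)"
  using trigonometric.char[of c 0] by (simp add: char_torus_def)

lemma trigonometric_sum: "finite A \<Longrightarrow> (\<And>i. i \<in> A \<Longrightarrow> trigonometric (f i)) \<Longrightarrow> trigonometric (\<lambda>\<psi>. \<Sum>i\<in>A. f i \<psi>)"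
  by (induction rule: finite_induct) (auto intro: trigonometric_const trigonometric.add)

lemma trigonometric_prod: "finite A \<Longrightarrow> (\<And>i. i \<in> A \<Longrightarrow> trigonometric (f i)) \<Longrightarrow> trigonometric (\<lambda>\<psi>. \<Prod>i\<in>A. f i \<psi>)"
  by (induction rule: finite_induct) (auto intro: trigonometric_const trigonometric_mult)

lemma trigonometric_power: "trigonometric T \<Longrightarrow> trigonometric (\<lambda>\<psi>. T \<psi> ^ m)"
  by (induction m) (auto intro: trigonometric_const trigonometric_mult)

lemma char_torus_axis: "char_torus (axis i m) \<psi> = cis (of_int m * \<psi> $ i)"
  by (simp add: char_torus_def axis_def if_distrib[of "\<lambda>x. x * _"] if_distrib[of of_int] cong: if_cong)

lemma cos_eq_cis: "complex_of_real (cos u) = (cis u + cis (- u)) / 2"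
  by (simp add: complex_eq_iff)

lemma trigonometric_cos: "trigonometric (\<lambda>\<psi>. complex_of_real (cos (\<psi> $ i - t)))"
proof -
  have "complex_of_real (cos (\<psi> $ i - t)) = (cis (- t) / 2) * char_torus (axis i 1) \<psi> + (cis t / 2) * char_torus (axis i (-1)) \<psi>" for \<psi>
  proof -
    have "complex_of_real (cos (\<psi> $ i - t)) = (cis (\<psi> $ i - t) + cis (- (\<psi> $ i - t))) / 2"
      using cos_eq_cis[of "\<psi> $ i - t"] .
    then show ?thesis
      by (simp add: char_torus_axis cis_mult add_divide_distrib add.commute)
  qed
  then show ?thesis by (simp only:) (intro trigonometric.add trigonometric.char)
qed

lemma trigonometric_real_polynomial:
  assumes "real_polynomial_function P"
  shows "trigonometric (\<lambda>\<psi>. complex_of_real (P (cos (\<psi> $ i - t))))"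
proof -
  obtain a n where P: "P = (\<lambda>x. \<Sum>j\<le>n. a j * x ^ j)"
    using assms real_polynomial_function_iff_sum by blast
  show ?thesis
    unfolding P of_real_sum of_real_mult of_real_power
    by (intro trigonometric_sum trigonometric_mult trigonometric_const trigonometric_power trigonometric_cos) auto
qed

lemma trigonometric_measurable: "trigonometric T \<Longrightarrow> T \<in> borel_measurable borel"
  by (induction rule: trigonometric.induct) auto

lemma trigonometric_bounded: "trigonometric T \<Longrightarrow> \<exists>B. \<forall>x. cmod (T x) \<le> B"
proof (induction rule: trigonometric.induct)
  case (char c \<kappa>)
  then show ?case by (intro exI[of _ "cmod c"]) (simp add: norm_mult)
next
  case (add S T)
  then obtain B C where "\<forall>x. cmod (S x) \<le> B" "\<forall>x. cmod (T x) \<le> C" by auto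
  then show ?case by (intro exI[of _ "B + C"]) (auto intro: norm_triangle_le add_mono)
qed

lemma polynomials_tendsto_step:
  fixes c :: real
  obtains P :: "nat \<Rightarrow> real \<Rightarrow> real" where "\<And>m. real_polynomial_function (P m)"
    "\<And>m x. x \<in> {-1..1} \<Longrightarrow> \<bar>P m x\<bar> \<le> 2"
    "\<And>x. x \<in> {-1..1} \<Longrightarrow> (\<lambda>m. P m x) \<longlonglongrightarrow> of_bool (c < x)"
proof -
  \<comment> \<open>A ramp of slope \<open>m\<close> that starts at \<open>c\<close> with the value
    0: its limit is the indicator of the open half-line, as the strict inequality in
    \<open>periodic_box\<close> demands. An approximation error of at most 1 added to it gives the
    bound 2.\<close>
  define \<rho> where "\<rho> m x = min 1 (max 0 (real m * (x - c)))" for m and x :: real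
  have "\<exists>g. real_polynomial_function g \<and> (\<forall>x\<in>{-1..1}. \<bar>\<rho> m x - g x\<bar> < inverse (real (Suc m)))" for m
  proof -
    have "continuous_on {-1..1} (\<rho> m)" unfolding \<rho>_def[abs_def] by (intro continuous_intros)
    then obtain g where "real_polynomial_function g" "\<And>x. x \<in> {-1..1} \<Longrightarrow> \<bar>\<rho> m x - g x\<bar> < inverse (real (Suc m))"
      using Stone_Weierstrass_real_polynomial_function[of "{-1..1::real}" "\<rho> m" "inverse (real (Suc m))"] by auto
    then show ?thesis by blast
  qed
  then obtain P where P: "\<And>m. real_polynomial_function (P m)"
    "\<And>m x. x \<in> {-1..1} \<Longrightarrow> \<bar>\<rho> m x - P m x\<bar> < inverse (real (Suc m))" by metis
  show thesis
  proof (rule that[OF P(1)])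
    fix x :: real assume x: "x \<in> {-1..1}"
    show "\<bar>P m x\<bar> \<le> 2" for m
    proof -
      have "0 \<le> \<rho> m x" "\<rho> m x \<le> 1" by (auto simp: \<rho>_def)
      moreover have "inverse (real (Suc m)) \<le> 1" by (simp add: field_simps)
      ultimately show ?thesis using P(2)[OF x, of m] by linarith
    qed
    have "(\<lambda>m. \<rho> m x - P m x) \<longlonglongrightarrow> 0"
      by (rule Lim_null_comparison[OF _ LIMSEQ_inverse_real_of_nat]) (use P(2)[OF x] in \<open>simp add: less_imp_le\<close>)
    moreover have "(\<lambda>m. \<rho> m x) \<longlonglongrightarrow> of_bool (c < x)"
    proof (cases "c < x")
      case True
      then obtain k where k: "1 \<le> real k * (x - c)"
        by (metis diff_gt_0_iff_gt less_imp_le ex_less_of_nat_mult)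
      have "\<forall>\<^sub>F m in sequentially. \<rho> m x = of_bool (c < x)"
        using eventually_ge_at_top[of k]
      proof (rule eventually_mono)
        fix m assume "k \<le> m"
        then have "real k * (x - c) \<le> real m * (x - c)" using True by (intro mult_right_mono) auto
        with k have "1 \<le> real m * (x - c)" by linarith
        with True show "\<rho> m x = of_bool (c < x)" by (simp add: \<rho>_def)
      qed
      then show ?thesis by (rule tendsto_eventually)
    next
      case False
      then have "real m * (x - c) \<le> 0" for m by (simp add: mult_le_0_iff)
      then have "\<rho> m x = 0" for m by (simp add: \<rho>_def)
      with False show ?thesis by simp
    qed
    ultimately have "(\<lambda>m. \<rho> m x - (\<rho> m x - P m x)) \<longlonglongrightarrow> of_bool (c < x) - 0"
      by (intro tendsto_diff)
    then show "(\<lambda>m. P m x) \<longlonglongrightarrow> of_bool (c < x)" by simp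
  qed
qed

text \<open>The periodic box is a product of one condition per coordinate, so the one-dimensional
  polynomials in cosines are multiplied; each factor contributes 2 to the bound.\<close>

lemma periodic_box_limit:
  obtains T :: "nat \<Rightarrow> real ^ 'n \<Rightarrow> complex" where "\<And>m. trigonometric (T m)"
    "\<And>m \<psi>. cmod (T m \<psi>) \<le> 2 ^ CARD('n)"
    "\<And>\<psi>. (\<lambda>m. T m \<psi>) \<longlonglongrightarrow> of_real (periodic_box \<theta> h \<psi>)"
proof -
  have "\<exists>P :: nat \<Rightarrow> real \<Rightarrow> real. (\<forall>m. real_polynomial_function (P m)) \<and> (\<forall>m. \<forall>x\<in>{-1..1}. \<bar>P m x\<bar> \<le> 2) \<and>
    (\<forall>x\<in>{-1..1}. (\<lambda>m. P m x) \<longlonglongrightarrow> of_bool (cos (h $ i) < x))" for i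
    by (rule polynomials_tendsto_step[of "cos (h $ i)"]) blast
  then obtain P where P: "\<And>i m. real_polynomial_function (P i m :: real \<Rightarrow> real)"
     "\<And>i m x. x \<in> {-1..1} \<Longrightarrow> \<bar>P i m x\<bar> \<le> 2"
     "\<And>i x. x \<in> {-1..1} \<Longrightarrow> (\<lambda>m. P i m x) \<longlonglongrightarrow> of_bool (cos (h $ i) < x)" by metis
  have c: "cos t \<in> {-1..1}" for t :: real by simp
  define T where "T m \<psi> = (\<Prod>i\<in>UNIV. complex_of_real (P i m (cos (\<psi> $ i - \<theta> $ i))))" for m and \<psi> :: "real ^ 'n"
  show thesis
  proof (rule that[of T])
    show "trigonometric (T m)" for m
      unfolding T_def[abs_def] by (intro trigonometric_prod trigonometric_real_polynomial P(1)) auto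
    show "cmod (T m \<psi>) \<le> 2 ^ CARD('n)" for m \<psi>
    proof -
      have "cmod (T m \<psi>) = (\<Prod>i\<in>UNIV. \<bar>P i m (cos (\<psi> $ i - \<theta> $ i))\<bar>)"
        by (simp add: T_def prod_norm[symmetric])
      also have "\<dots> \<le> (\<Prod>i\<in>(UNIV::'n set). 2)"
        by (intro prod_mono conjI abs_ge_zero P(2) c)
      finally show ?thesis by simp
    qed
    show "(\<lambda>m. T m \<psi>) \<longlonglongrightarrow> of_real (periodic_box \<theta> h \<psi>)" for \<psi>
      unfolding T_def periodic_box_def of_bool_all_eq_prod of_real_prod
      by (intro tendsto_prod tendsto_of_real P(3) c)
  qed
qed

text \<open>Integrates the pointwise inequality \<open>r \<le> e + r\<^sup>2 / e\<close>, which
  takes the place of the Cauchy-Schwarz inequality; \<open>e\<close> will be chosen according to the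
  block.\<close>

lemma norm_trig_poly_L1:
  assumes A: "finite A" and e: "e > 0"
  shows "(\<integral>\<psi>. norm (trig_poly A a \<psi>) \<partial>torus_measure) \<le> e + (\<Sum>\<alpha>\<in>A. (norm (a \<alpha>))\<^sup>2) / e"
proof -
  have int: "integrable torus_measure (\<lambda>\<psi>. norm (trig_poly A a \<psi>))"
    by (rule integrable_torus_measure_bounded[of _ "\<Sum>\<alpha>\<in>A. norm (a \<alpha>)"])
      (auto intro: measurable_torus_measureI simp: norm_trig_poly_le)
  have int2: "integrable torus_measure (\<lambda>\<psi>. (norm (trig_poly A a \<psi>))\<^sup>2)"
  proof (rule integrable_torus_measure_bounded)
    show "(\<lambda>\<psi>. (norm (trig_poly A a \<psi>))\<^sup>2) \<in> borel_measurable lebesgue"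
      by (rule measurable_torus_measureI) measurable
    show "norm ((norm (trig_poly A a \<psi>))\<^sup>2) \<le> (\<Sum>\<alpha>\<in>A. norm (a \<alpha>))\<^sup>2" for \<psi>
      using norm_trig_poly_le[of A a \<psi>] by (simp add: power_mono)
  qed
  have I2: "(\<integral>\<psi>. (norm (trig_poly A a \<psi>))\<^sup>2 \<partial>torus_measure) = (\<Sum>\<alpha>\<in>A. (norm (a \<alpha>))\<^sup>2)"
    using nn_integral_norm_trig_poly[OF A, of a] nn_integral_eq_integral[OF int2]
    by (simp add: sum_nonneg)
  have c: "integrable torus_measure (\<lambda>_. e)" by (rule integrable_torus_measure_bounded[of _ "norm e"]) auto
  have "(\<integral>\<psi>. norm (trig_poly A a \<psi>) \<partial>torus_measure) \<le> (\<integral>\<psi>. e + (norm (trig_poly A a \<psi>))\<^sup>2 / e \<partial>torus_measure)"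
  proof (rule integral_mono[OF int])
    show "integrable torus_measure (\<lambda>\<psi>. e + (norm (trig_poly A a \<psi>))\<^sup>2 / e)"
      by (intro Bochner_Integration.integrable_add c integrable_divide_zero int2)
    show "norm (trig_poly A a \<psi>) \<le> e + (norm (trig_poly A a \<psi>))\<^sup>2 / e" for \<psi>
    proof -
      define r where "r = norm (trig_poly A a \<psi>)"
      have "0 \<le> (r - e)\<^sup>2" "0 \<le> r * e" using e by (auto simp: r_def)
      then have "r * e \<le> e * e + r\<^sup>2" by (simp add: power2_eq_square algebra_simps)
      then show ?thesis using e unfolding r_def[symmetric] by (simp add: field_simps)
    qed
  qed
  also have "\<dots> = e + (\<Sum>\<alpha>\<in>A. (norm (a \<alpha>))\<^sup>2) / e"
    using Bochner_Integration.integral_add[OF c integrable_divide_zero[OF int2], of e]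
    by (simp add: I2 measure_def emeasure_torus_measure_UNIV)
  finally show ?thesis .
qed

text \<open>Both sides are continuous in the test function under bounded pointwise convergence and
  agree on characters.\<close>

lemma sums_integral_periodic_box:
  fixes a :: "nat ^ 'n \<Rightarrow> 'h::chilbert_space" and \<phi> :: "real ^ 'n \<Rightarrow> complex"
  assumes A: "\<And>k. finite (A k)" "\<And>\<alpha>. \<exists>!k::nat. \<alpha> \<in> A k"
    and dec: "\<And>k. (\<Sum>\<alpha>\<in>A k. (norm (a \<alpha>))\<^sup>2) \<le> M * (1/16) ^ k"
    and \<phi>: "integrable torus_measure \<phi>"
    and coeff: "\<And>\<kappa>. (\<integral>\<psi>. char_torus (- \<kappa>) \<psi> * \<phi> \<psi> \<partial>torus_measure) =
       (if \<forall>i. 0 \<le> \<kappa> $ i then cinner (a (\<chi> i. nat (\<kappa> $ i))) w else 0)"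
  shows "(\<lambda>k. \<integral>\<psi>. of_real (periodic_box \<theta> h \<psi>) * cinner (trig_poly (A k) a \<psi>) w \<partial>torus_measure)
     sums (\<integral>\<psi>. of_real (periodic_box \<theta> h \<psi>) * \<phi> \<psi> \<partial>torus_measure)"
proof -
  let ?p = "\<lambda>k \<psi>. cinner (trig_poly (A k) a \<psi>) w"
  have "0 \<le> (\<Sum>\<alpha>\<in>A 0. (norm (a \<alpha>))\<^sup>2)" by (simp add: sum_nonneg)
  with dec[of 0] have M: "M \<ge> 0" by simp
  have p_int: "integrable torus_measure (?p k)" for k
  proof (rule integrable_torus_measure_bounded)
    show "?p k \<in> borel_measurable lebesgue" by (rule measurable_torus_measureI) measurable
    show "norm (?p k \<psi>) \<le> (\<Sum>\<alpha>\<in>A k. norm (a \<alpha>)) * norm w" for \<psi>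
      by (rule order_trans[OF cinner_Cauchy_Schwarz]) (simp add: mult_right_mono norm_trig_poly_le)
  qed
  have mult_int: "integrable torus_measure (\<lambda>\<psi>. T \<psi> * g \<psi>)"
    if "T \<in> borel_measurable borel" "\<And>x. cmod (T x) \<le> B" "integrable torus_measure g" for T g B
  proof (rule Bochner_Integration.integrable_bound)
    show "integrable torus_measure (\<lambda>\<psi>. B * cmod (g \<psi>))" using that by simp
    have "T \<in> borel_measurable torus_measure" using measurable_torus_measureI[OF that(1)] by simp
    then show "(\<lambda>\<psi>. T \<psi> * g \<psi>) \<in> borel_measurable torus_measure" using that by simp
    have "B \<ge> 0" using that(2)[of 0] norm_ge_zero order_trans by blast
    then show "AE x in torus_measure. norm (T x * g x) \<le> norm (B * cmod (g x))"
      using that(2) by (intro AE_I2) (simp add: norm_mult mult_right_mono)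
  qed
  have trig_int: "integrable torus_measure (\<lambda>\<psi>. T \<psi> * g \<psi>)" if "trigonometric T" "integrable torus_measure g" for T g
    using trigonometric_bounded[OF that(1)] mult_int[OF trigonometric_measurable[OF that(1)] _ that(2)] by blast
  have sums_trig: "(\<lambda>k. \<integral>\<psi>. T \<psi> * ?p k \<psi> \<partial>torus_measure) sums (\<integral>\<psi>. T \<psi> * \<phi> \<psi> \<partial>torus_measure)"
    if "trigonometric T" for T
    using that
  proof (induction rule: trigonometric.induct)
    case (char c \<kappa>)
    have eq: "(\<integral>\<psi>. c * char_torus \<kappa> \<psi> * ?p k \<psi> \<partial>torus_measure) = c * (\<Sum>\<alpha>\<in>A k. of_bool (\<kappa> = - int_vec \<alpha>) * cinner (a \<alpha>) w)" for k
      by (simp add: mult.assoc integral_cinner_trig_poly_char[OF A(1)])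
    have eq2: "(\<integral>\<psi>. c * char_torus \<kappa> \<psi> * \<phi> \<psi> \<partial>torus_measure) = c * (if \<forall>i. 0 \<le> (- \<kappa>) $ i then cinner (a (\<chi> i. nat ((- \<kappa>) $ i))) w else 0)"
      using coeff[of "- \<kappa>"] by (simp only: mult.assoc integral_mult_right_zero minus_minus)
    \<comment> \<open>If \<open>- \<kappa>\<close> is a natural multi-index, it lies in exactly one
      block and only that block contributes to the series; otherwise both sides vanish.\<close>
    show ?case
    proof (cases "\<forall>i. 0 \<le> (- \<kappa>) $ i")
      case True
      define \<alpha> where "\<alpha> = (\<chi> i. nat ((- \<kappa>) $ i))"
      have \<kappa>: "\<kappa> = - int_vec \<alpha>" using True by (simp add: \<alpha>_def int_vec_def vec_eq_iff)
      obtain k0 where k0: "\<alpha> \<in> A k0" "\<And>k. \<alpha> \<in> A k \<Longrightarrow> k = k0" using A(2)[of \<alpha>] by blast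
      have "(\<Sum>\<beta>\<in>A k. of_bool (\<kappa> = - int_vec \<beta>) * cinner (a \<beta>) w) = (if k = k0 then cinner (a \<alpha>) w else 0)" for k
      proof -
        have "(\<Sum>\<beta>\<in>A k. of_bool (\<kappa> = - int_vec \<beta>) * cinner (a \<beta>) w) = (\<Sum>\<beta>\<in>A k. if \<beta> = \<alpha> then cinner (a \<alpha>) w else 0)"
          by (intro sum.cong) (auto simp: \<kappa> int_vec_eq_iff)
        also have "\<dots> = (if \<alpha> \<in> A k then cinner (a \<alpha>) w else 0)" by (simp add: A(1))
        also have "\<alpha> \<in> A k \<longleftrightarrow> k = k0" using k0 by blast
        finally show ?thesis .
      qed
      then have "(\<lambda>k. \<integral>\<psi>. c * char_torus \<kappa> \<psi> * ?p k \<psi> \<partial>torus_measure) = (\<lambda>k. if k = k0 then c * cinner (a \<alpha>) w else 0)"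
        by (auto simp: eq)
      then show ?thesis
        using sums_single[of k0 "\<lambda>_. c * cinner (a \<alpha>) w"] True unfolding eq2 \<alpha>_def[symmetric] by simp
    next
      case False
      have "\<kappa> \<noteq> - int_vec \<beta>" for \<beta>
      proof
        assume "\<kappa> = - int_vec \<beta>"
        then have "\<forall>i. 0 \<le> (- \<kappa>) $ i" by (simp add: int_vec_def)
        with False show False by blast
      qed
      then have "(\<lambda>k. \<integral>\<psi>. c * char_torus \<kappa> \<psi> * ?p k \<psi> \<partial>torus_measure) = (\<lambda>k. 0)" by (auto simp: eq)
      with False show ?thesis unfolding eq2 by auto
    qed
  next
    case (add S T)
    have "(\<lambda>k. (\<integral>\<psi>. S \<psi> * ?p k \<psi> \<partial>torus_measure) + (\<integral>\<psi>. T \<psi> * ?p k \<psi> \<partial>torus_measure))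
       sums ((\<integral>\<psi>. S \<psi> * \<phi> \<psi> \<partial>torus_measure) + (\<integral>\<psi>. T \<psi> * \<phi> \<psi> \<partial>torus_measure))"
      by (intro sums_add add.IH)
    then show ?case
      unfolding ring_distribs
      using trig_int[OF add.hyps(1) p_int] trig_int[OF add.hyps(2) p_int] trig_int[OF add.hyps(1) \<phi>] trig_int[OF add.hyps(2) \<phi>]
      by (simp add: Bochner_Integration.integral_add)
  qed
  obtain T :: "nat \<Rightarrow> real ^ 'n \<Rightarrow> complex" where T: "\<And>m. trigonometric (T m)"
    "\<And>m \<psi>. cmod (T m \<psi>) \<le> 2 ^ CARD('n)"
    "\<And>\<psi>. (\<lambda>m. T m \<psi>) \<longlonglongrightarrow> of_real (periodic_box \<theta> h \<psi>)"
    using periodic_box_limit[of \<theta> h] by blast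
  let ?W = "\<lambda>\<psi>. complex_of_real (periodic_box \<theta> h \<psi>)"
  have Wm: "?W \<in> borel_measurable borel"
    unfolding periodic_box_def[abs_def] by measurable
  have conv: "(\<lambda>m. \<integral>\<psi>. T m \<psi> * g \<psi> \<partial>torus_measure) \<longlonglongrightarrow> (\<integral>\<psi>. ?W \<psi> * g \<psi> \<partial>torus_measure)"
    if g: "integrable torus_measure g" for g
  proof (rule integral_dominated_convergence[where w = "\<lambda>\<psi>. 2 ^ CARD('n) * cmod (g \<psi>)"])
    show "(\<lambda>\<psi>. ?W \<psi> * g \<psi>) \<in> borel_measurable torus_measure"
      by (rule borel_measurable_integrable, rule mult_int[OF Wm _ g, of 1]) (simp add: periodic_box_def)
    show "(\<lambda>\<psi>. T m \<psi> * g \<psi>) \<in> borel_measurable torus_measure" for m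
      by (rule borel_measurable_integrable[OF trig_int[OF T(1) g]])
    show "AE x in torus_measure. (\<lambda>m. T m x * g x) \<longlonglongrightarrow> ?W x * g x"
      by (intro AE_I2 tendsto_mult T(3) tendsto_const)
    show "AE x in torus_measure. norm (T m x * g x) \<le> 2 ^ CARD('n) * cmod (g x)" for m
      using T(2)[of m] by (intro AE_I2) (simp add: norm_mult mult_right_mono)
    show "integrable torus_measure (\<lambda>\<psi>. 2 ^ CARD('n) * cmod (g \<psi>))" using g by simp
  qed
  \<comment> \<open>Comes from \<open>norm_trig_poly_L1\<close> with \<open>e = (1/4) ^ k\<close>,
    which balances its two terms against the decay \<open>(1/16) ^ k\<close>.\<close>
  define R where "R k = 2 ^ CARD('n) * (norm w * ((1 + M) * (1/4) ^ k))" for k :: nat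
  have sR: "summable R"
    unfolding R_def by (intro summable_mult summable_geometric) simp
  have bound: "cmod (\<integral>\<psi>. T m \<psi> * ?p k \<psi> \<partial>torus_measure) \<le> R k" for m k
  proof -
    have nint: "integrable torus_measure (\<lambda>\<psi>. norm (trig_poly (A k) a \<psi>))"
      by (rule integrable_torus_measure_bounded[of _ "\<Sum>\<alpha>\<in>A k. norm (a \<alpha>)"])
        (auto intro: measurable_torus_measureI simp: norm_trig_poly_le)
    have "cmod (\<integral>\<psi>. T m \<psi> * ?p k \<psi> \<partial>torus_measure) \<le> (\<integral>\<psi>. 2 ^ CARD('n) * (norm w * norm (trig_poly (A k) a \<psi>)) \<partial>torus_measure)"
    proof (rule Bochner_Integration.integral_norm_bound_integral[OF trig_int[OF T(1) p_int]])
      show "integrable torus_measure (\<lambda>\<psi>. 2 ^ CARD('n) * (norm w * norm (trig_poly (A k) a \<psi>)))" using nint by simp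
      show "cmod (T m \<psi> * ?p k \<psi>) \<le> 2 ^ CARD('n) * (norm w * norm (trig_poly (A k) a \<psi>))" for \<psi>
        unfolding norm_mult using cinner_Cauchy_Schwarz[of "trig_poly (A k) a \<psi>" w]
        by (intro mult_mono T(2)) (auto simp: mult.commute)
    qed
    also have "\<dots> = 2 ^ CARD('n) * (norm w * (\<integral>\<psi>. norm (trig_poly (A k) a \<psi>) \<partial>torus_measure))" by simp
    also have "\<dots> \<le> R k"
      unfolding R_def
    proof (intro mult_left_mono)
      have "(\<integral>\<psi>. norm (trig_poly (A k) a \<psi>) \<partial>torus_measure) \<le> (1/4) ^ k + (\<Sum>\<alpha>\<in>A k. (norm (a \<alpha>))\<^sup>2) / (1/4) ^ k"
        by (rule norm_trig_poly_L1[OF A(1)]) simp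
      also have "\<dots> \<le> (1/4) ^ k + (M * (1/16) ^ k) / (1/4) ^ k"
        by (intro add_left_mono divide_right_mono dec) simp
      also have "\<dots> = (1 + M) * (1/4) ^ k"
      proof -
        have "(1/16 :: real) ^ k = (1/4) ^ k * (1/4) ^ k" by (simp add: power_mult_distrib[symmetric])
        then show ?thesis by (simp add: ring_distribs)
      qed
      finally show "(\<integral>\<psi>. norm (trig_poly (A k) a \<psi>) \<partial>torus_measure) \<le> (1 + M) * (1/4) ^ k" .
    qed auto
    finally show ?thesis .
  qed
  \<comment> \<open>Passage to the limit in \<open>m\<close> under the sum over the blocks;
    \<open>R\<close> dominates uniformly in \<open>m\<close>.\<close>
  have "(\<forall>\<^sub>F m in sequentially. summable (\<lambda>k. norm (\<integral>\<psi>. T m \<psi> * ?p k \<psi> \<partial>torus_measure))) \<and>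
      summable (\<lambda>k. norm (\<integral>\<psi>. ?W \<psi> * ?p k \<psi> \<partial>torus_measure)) \<and>
      ((\<lambda>m. \<Sum>k. \<integral>\<psi>. T m \<psi> * ?p k \<psi> \<partial>torus_measure) \<longlonglongrightarrow> (\<Sum>k. \<integral>\<psi>. ?W \<psi> * ?p k \<psi> \<partial>torus_measure))"
    by (rule tannerys_theorem[OF conv[OF p_int] _ sR]) (simp_all add: bound case_prod_unfold)
  then have sm: "summable (\<lambda>k. \<integral>\<psi>. ?W \<psi> * ?p k \<psi> \<partial>torus_measure)"
    and lim: "(\<lambda>m. \<integral>\<psi>. T m \<psi> * \<phi> \<psi> \<partial>torus_measure) \<longlonglongrightarrow> (\<Sum>k. \<integral>\<psi>. ?W \<psi> * ?p k \<psi> \<partial>torus_measure)"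
    using sums_trig[OF T(1)] by (auto simp: sums_iff intro: summable_norm_cancel)
  from LIMSEQ_unique[OF lim conv[OF \<phi>]] sm show ?thesis by (simp add: sums_iff)
qed

subsection \<open>Box means\<close>

lemma
  assumes "f \<in> L2_torus"
  shows L2_torus_strongly_measurable: "strongly_measurable f"
    and L2_torus_periodic: "f (x + axis i (2 * pi)) = f x"
  using assms by (auto simp: L2_torus_def strongly_measurable_def)

lemma L2_torus_norm_measurable:
  assumes "f \<in> L2_torus"
  shows "(\<lambda>x. norm (f x)) \<in> borel_measurable lebesgue"
  by (rule strongly_measurable_compose[OF L2_torus_strongly_measurable[OF assms]]) (intro continuous_intros)

lemma L2_torus_cinner_measurable:
  assumes "f \<in> L2_torus"
  shows "(\<lambda>x. cinner (f x) w) \<in> borel_measurable lebesgue"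
  by (rule strongly_measurable_compose[OF L2_torus_strongly_measurable[OF assms]])
    (rule bounded_linear.continuous_on[OF bounded_linear_cinner_left continuous_on_id])

lemma L2_torus_norm_integrable:
  assumes "f \<in> L2_torus"
  shows "integrable torus_measure (\<lambda>x. norm (f x))"
proof (rule integrableI_bounded)
  have m: "(\<lambda>x. norm (f x)) \<in> borel_measurable torus_measure"
    using L2_torus_norm_measurable[OF assms] by simp
  then show "(\<lambda>x. norm (f x)) \<in> borel_measurable torus_measure" .
  have "(\<integral>\<^sup>+x. ennreal (norm (norm (f x))) \<partial>torus_measure) \<le> (\<integral>\<^sup>+x. 1 + ennreal ((norm (f x))\<^sup>2) \<partial>torus_measure)"
  proof (rule nn_integral_mono)
    fix x
    have "norm (f x) \<le> 1 + (norm (f x))\<^sup>2"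
      using zero_le_power2[of "norm (f x) - 1"] by (simp add: power2_diff) (smt (verit) norm_ge_zero)
    then have "ennreal (norm (f x)) \<le> ennreal (1 + (norm (f x))\<^sup>2)" by (rule ennreal_leI)
    then show "ennreal (norm (norm (f x))) \<le> 1 + ennreal ((norm (f x))\<^sup>2)" by simp
  qed
  also have "\<dots> = 1 + (\<integral>\<^sup>+x. ennreal ((norm (f x))\<^sup>2) \<partial>torus_measure)"
    using m by (subst nn_integral_add) (auto simp: emeasure_torus_measure_UNIV)
  also have "\<dots> < \<infinity>"
    using assms by (simp add: L2_torus_def)
  finally show "(\<integral>\<^sup>+x. ennreal (norm (norm (f x))) \<partial>torus_measure) < \<infinity>" .
qed

lemma L2_torus_cinner_integrable:
  assumes "f \<in> L2_torus"
  shows "integrable torus_measure (\<lambda>x. cinner (f x) w)"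
proof (rule Bochner_Integration.integrable_bound)
  show "integrable torus_measure (\<lambda>x. norm (f x) * norm w)" using L2_torus_norm_integrable[OF assms] by simp
  show "(\<lambda>x. cinner (f x) w) \<in> borel_measurable torus_measure"
    using L2_torus_cinner_measurable[OF assms] by simp
  show "AE x in torus_measure. norm (cinner (f x) w) \<le> norm (norm (f x) * norm w)"
    by (intro AE_I2) (simp add: cinner_Cauchy_Schwarz)
qed

lemma bounded_torus: "bounded (torus :: (real^'n) set)"
  by (rule bounded_subset[OF bounded_cbox[of 0 "\<chi> i. 2 * pi"]]) (simp add: torus_def mem_box_cart less_imp_le subset_iff)

text \<open>Carries the hypothesis on the Fourier series over to each scalar pairing, the form
  required by \<open>sums_integral_periodic_box\<close>.\<close>

lemma cinner_fourier_coeff: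
  fixes f :: "real ^ 'n \<Rightarrow> 'h::chilbert_space"
  assumes "f \<in> L2_torus"
  shows "cinner (fourier_coeff f \<kappa>) w = (\<integral>\<psi>. char_torus (- \<kappa>) \<psi> * cinner (f \<psi>) w \<partial>torus_measure)"
proof -
  let ?g = "\<lambda>\<psi>. char_torus (- \<kappa>) \<psi> *\<^sub>C f \<psi>"
  have eq: "cis (- (\<Sum>i\<in>UNIV. of_int (\<kappa> $ i) * \<psi> $ i)) = char_torus (- \<kappa>) \<psi>" for \<psi>
    by (simp add: char_torus_def sum_negf)
  have int: "integrable lebesgue (\<lambda>x. indicat_real torus x * norm (?g x))"
    using L2_torus_norm_integrable[OF assms] L2_torus_norm_measurable[OF assms]
    by (simp add: norm_scaleC integrable_torus_measure_iff)
  have "cinner (integral torus ?g) w = (\<integral>x. indicat_real torus x *\<^sub>R cinner (?g x) w \<partial>lebesgue)"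
    by (rule cinner_integral[OF strongly_measurable_scaleC[OF L2_torus_strongly_measurable[OF assms]] torus_lebesgue bounded_torus int])
      (rule measurable_torus_measureI, measurable)
  then have "cinner (fourier_coeff f \<kappa>) w = (1 / (2 * pi) ^ CARD('n)) *\<^sub>R (\<integral>x. indicat_real torus x *\<^sub>R cinner (?g x) w \<partial>lebesgue)"
    unfolding fourier_coeff_def eq cinner_scaleR_left by simp
  also have "\<dots> = (\<integral>x. cinner (?g x) w \<partial>torus_measure)"
  proof (rule integral_torus_measure[symmetric])
    have "char_torus (- \<kappa>) \<in> borel_measurable lebesgue" by (rule measurable_torus_measureI) measurable
    then show "(\<lambda>x. cinner (?g x) w) \<in> borel_measurable lebesgue"
      using L2_torus_cinner_measurable[OF assms] by (simp add: cinner_scaleC_left)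
  qed
  finally show ?thesis by (simp add: cinner_scaleC_left)
qed

text \<open>The box may stick out of the torus, over which the Fourier coefficients are taken;
  periodicity moves it back.\<close>

lemma cinner_box_mean:
  fixes f :: "real ^ 'n \<Rightarrow> 'h::chilbert_space"
  assumes f: "f \<in> L2_torus" and \<theta>: "\<theta> \<in> torus" and h: "\<And>i. 0 < h $ i \<and> h $ i < pi"
  shows "cinner (box_mean f h \<theta>) w = (pi ^ CARD('n) / (\<Prod>i\<in>UNIV. h $ i)) *\<^sub>R
     (\<integral>\<psi>. of_real (periodic_box \<theta> h \<psi>) * cinner (f \<psi>) w \<partial>torus_measure)"
proof -
  let ?B = "box (\<theta> - h) (\<theta> + h)"
  have int: "integrable lebesgue (\<lambda>x. indicat_real ?B x * norm (f x))"
    using integrable_box_periodic[OF _ L2_torus_norm_measurable[OF f] L2_torus_norm_integrable[OF f] \<theta> h] L2_torus_periodic[OF f]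
    by simp
  have "cinner (integral ?B f) w = (\<integral>x. indicat_real ?B x *\<^sub>R cinner (f x) w \<partial>lebesgue)"
    by (rule cinner_integral[OF L2_torus_strongly_measurable[OF f] _ bounded_box int]) simp
  then have "cinner (box_mean f h \<theta>) w = (pi ^ CARD('n) / (\<Prod>i\<in>UNIV. h $ i)) *\<^sub>R
     ((1 / (2 * pi) ^ CARD('n)) *\<^sub>R (\<integral>x. indicat_real ?B x *\<^sub>R cinner (f x) w \<partial>lebesgue))"
    unfolding box_mean_def cinner_scaleR_left by simp
  also have "(1 / (2 * pi) ^ CARD('n)) *\<^sub>R (\<integral>x. indicat_real ?B x *\<^sub>R cinner (f x) w \<partial>lebesgue)
    = (\<integral>x. periodic_box \<theta> h x *\<^sub>R cinner (f x) w \<partial>torus_measure)"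
    by (rule integral_box_periodic[OF _ L2_torus_cinner_measurable[OF f] L2_torus_cinner_integrable[OF f] \<theta> h])
      (simp add: L2_torus_periodic[OF f])
  finally show ?thesis by (simp only: scaleR_conv_of_real)
qed

lemma integral_box_char_torus:
  assumes h: "\<And>i. 0 < h $ i"
  shows "(\<integral>x. indicat_real (box (\<theta> - h) (\<theta> + h)) x *\<^sub>R char_torus \<kappa> x \<partial>lebesgue)
    = (\<Prod>i\<in>UNIV. complex_of_real (2 * h $ i * sinc (of_int (\<kappa> $ i) * h $ i))) * char_torus \<kappa> (\<theta> :: real ^ 'n)"
proof -
  let ?B = "box (\<theta> - h) (\<theta> + h)"
  let ?F = "\<lambda>i t. indicat_real {\<theta> $ i - h $ i<..<\<theta> $ i + h $ i} t *\<^sub>R cis (of_int (\<kappa> $ i) * t)"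
  let ?G = "\<lambda>i t. indicat_real {\<theta> $ i - h $ i..\<theta> $ i + h $ i} t *\<^sub>R cis (of_int (\<kappa> $ i) * t)"
  \<comment> \<open>The open sides of the box differ from the closed intervals of
    \<open>integral_cis_Icc\<close> in two points.\<close>
  have ae: "AE t in lborel. ?G i t = ?F i t" for i
    using AE_lborel_singleton[of "\<theta> $ i - h $ i"] AE_lborel_singleton[of "\<theta> $ i + h $ i"]
    by eventually_elim (auto simp: indicator_def)
  have F: "integrable lborel (?F i)" for i
    by (rule integrable_cong_AE_imp[OF integrable_cis_Icc _ ae]) measurable
  have F1: "(\<integral>t. ?F i t \<partial>lborel) = complex_of_real (2 * h $ i * sinc (of_int (\<kappa> $ i) * h $ i)) * cis (of_int (\<kappa> $ i) * \<theta> $ i)" for i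
    unfolding integral_cis_Icc[OF h, symmetric]
    by (rule integral_cong_AE[OF _ _ AE_symmetric]) (use ae in auto)
  have ind: "indicat_real ?B x = (\<Prod>i\<in>UNIV. indicat_real {\<theta> $ i - h $ i<..<\<theta> $ i + h $ i} (x $ i))" for x
  proof -
    have "indicat_real ?B x = of_bool (\<forall>i. x $ i \<in> {\<theta> $ i - h $ i<..<\<theta> $ i + h $ i})"
      by (auto simp: indicator_def mem_box_cart)
    then show ?thesis by (simp only: of_bool_all_eq_prod indicator_def)
  qed
  have "(\<integral>x. indicat_real ?B x *\<^sub>R char_torus \<kappa> x \<partial>lebesgue) = (\<integral>x. indicat_real ?B x *\<^sub>R char_torus \<kappa> x \<partial>lborel)"
    by (rule integral_completion) measurable
  also have "\<dots> = (\<integral>x. (\<Prod>i\<in>UNIV. ?F i (x $ i)) \<partial>lborel)"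
    by (simp add: ind char_torus_eq_prod prod.distrib scaleR_conv_of_real)
  also have "\<dots> = (\<Prod>i\<in>UNIV. complex_of_real (2 * h $ i * sinc (of_int (\<kappa> $ i) * h $ i)) * cis (of_int (\<kappa> $ i) * \<theta> $ i))"
    by (subst integral_lborel_prod_vec[OF F]) (simp only: F1)
  finally show ?thesis by (simp only: prod.distrib char_torus_eq_prod)
qed

lemma nonzero_cancel: "p \<noteq> 0 \<Longrightarrow> c \<noteq> 0 \<Longrightarrow> c / p * (p / c * r) = (r::'a::field)"
  by simp

text \<open>The periodic box has normalized measure
  \<open>(\<Prod>i\<in>UNIV. h $ i) / pi ^ CARD('n)\<close>, which the prefactor cancels; only the
  product of the \<open>sinc\<close> factors remains.\<close>

lemma integral_periodic_box_trig_poly: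
  fixes a :: "nat ^ 'n \<Rightarrow> 'h::chilbert_space"
  assumes A: "finite A" and \<theta>: "\<theta> \<in> torus" and h: "\<And>i. 0 < h $ i \<and> h $ i < pi"
  shows "(pi ^ CARD('n) / (\<Prod>i\<in>UNIV. h $ i)) *\<^sub>R
     (\<integral>\<psi>. of_real (periodic_box \<theta> h \<psi>) * cinner (trig_poly A a \<psi>) w \<partial>torus_measure)
    = cinner (\<Sum>\<alpha>\<in>A. (\<Prod>i\<in>UNIV. sinc (real (\<alpha> $ i) * h $ i)) *\<^sub>R (char_torus (int_vec \<alpha>) \<theta> *\<^sub>C a \<alpha>)) w"
proof -
  let ?B = "box (\<theta> - h) (\<theta> + h)"
  have hp: "(\<Prod>i\<in>UNIV. h $ i) > 0" using h by (intro prod_pos) auto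
  have pm: "periodic_box \<theta> h \<in> borel_measurable torus_measure"
  proof -
    have "periodic_box \<theta> h \<in> borel_measurable lebesgue"
      by (rule measurable_torus_measureI) (simp add: periodic_box_def[abs_def])
    then show ?thesis by simp
  qed
  have char_int: "integrable torus_measure (\<lambda>\<psi>. complex_of_real (periodic_box \<theta> h \<psi>) * char_torus \<kappa> \<psi>)" for \<kappa>
  proof (rule Bochner_Integration.integrable_bound[OF integrable_char_torus[of \<kappa>]])
    show "(\<lambda>\<psi>. complex_of_real (periodic_box \<theta> h \<psi>) * char_torus \<kappa> \<psi>) \<in> borel_measurable torus_measure"
      using pm borel_measurable_integrable[OF integrable_char_torus[of \<kappa>]] by simp
    show "AE x in torus_measure. norm (complex_of_real (periodic_box \<theta> h x) * char_torus \<kappa> x) \<le> norm (char_torus \<kappa> x)"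
      by (intro AE_I2) (simp add: norm_mult periodic_box_def)
  qed
  have char: "(\<integral>\<psi>. complex_of_real (periodic_box \<theta> h \<psi>) * char_torus \<kappa> \<psi> \<partial>torus_measure)
      = complex_of_real ((\<Prod>i\<in>UNIV. h $ i) / pi ^ CARD('n) * (\<Prod>i\<in>UNIV. sinc (of_int (\<kappa> $ i) * h $ i))) * char_torus \<kappa> \<theta>" for \<kappa>
  proof -
    have "(\<integral>\<psi>. periodic_box \<theta> h \<psi> *\<^sub>R char_torus \<kappa> \<psi> \<partial>torus_measure)
       = (1 / (2 * pi) ^ CARD('n)) *\<^sub>R (\<integral>x. indicat_real ?B x *\<^sub>R char_torus \<kappa> x \<partial>lebesgue)"
      by (rule integral_box_periodic[symmetric, OF char_torus_periodic measurable_torus_measureI integrable_char_torus \<theta> h]) measurable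
    also have "\<dots> = complex_of_real (1 / (2 * pi) ^ CARD('n) * (\<Prod>i\<in>UNIV. 2 * h $ i * sinc (of_int (\<kappa> $ i) * h $ i))) * char_torus \<kappa> \<theta>"
      using h by (subst integral_box_char_torus) (simp_all add: scaleR_conv_of_real)
    also have "1 / (2 * pi) ^ CARD('n) * (\<Prod>i\<in>UNIV. 2 * h $ i * sinc (of_int (\<kappa> $ i) * h $ i))
       = (\<Prod>i\<in>UNIV. h $ i) / pi ^ CARD('n) * (\<Prod>i\<in>UNIV. sinc (of_int (\<kappa> $ i) * h $ i))"
      by (simp add: prod.distrib power_mult_distrib)
    finally show ?thesis by (simp add: scaleR_conv_of_real)
  qed
  have "(\<integral>\<psi>. of_real (periodic_box \<theta> h \<psi>) * cinner (trig_poly A a \<psi>) w \<partial>torus_measure)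
     = (\<integral>\<psi>. (\<Sum>\<alpha>\<in>A. complex_of_real (periodic_box \<theta> h \<psi>) * char_torus (int_vec \<alpha>) \<psi> * cinner (a \<alpha>) w) \<partial>torus_measure)"
    by (simp add: cinner_trig_poly sum_distrib_left mult.assoc)
  also have "\<dots> = (\<Sum>\<alpha>\<in>A. complex_of_real ((\<Prod>i\<in>UNIV. h $ i) / pi ^ CARD('n) * (\<Prod>i\<in>UNIV. sinc (real (\<alpha> $ i) * h $ i))) * char_torus (int_vec \<alpha>) \<theta> * cinner (a \<alpha>) w)"
    by (subst Bochner_Integration.integral_sum)
      (auto intro!: integrable_mult_left char_int simp: char int_vec_def[THEN arg_cong[of _ _ "\<lambda>x. x $ _"]] simp del: of_real_mult of_real_divide of_real_prod)
  also have "(pi ^ CARD('n) / (\<Prod>i\<in>UNIV. h $ i)) *\<^sub>R \<dots> = (\<Sum>\<alpha>\<in>A. complex_of_real (\<Prod>i\<in>UNIV. sinc (real (\<alpha> $ i) * h $ i)) * char_torus (int_vec \<alpha>) \<theta> * cinner (a \<alpha>) w)"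
    unfolding scaleR_sum_right
  proof (rule sum.cong[OF refl])
    fix \<alpha>
    have "(pi ^ CARD('n) / (\<Prod>i\<in>UNIV. h $ i)) * ((\<Prod>i\<in>UNIV. h $ i) / pi ^ CARD('n) * (\<Prod>i\<in>UNIV. sinc (real (\<alpha> $ i) * h $ i))) = (\<Prod>i\<in>UNIV. sinc (real (\<alpha> $ i) * h $ i))"
      by (rule nonzero_cancel[OF less_imp_neq[OF hp, symmetric]]) simp
    then show "(pi ^ CARD('n) / (\<Prod>i\<in>UNIV. h $ i)) *\<^sub>R (complex_of_real ((\<Prod>i\<in>UNIV. h $ i) / pi ^ CARD('n) * (\<Prod>i\<in>UNIV. sinc (real (\<alpha> $ i) * h $ i))) * char_torus (int_vec \<alpha>) \<theta> * cinner (a \<alpha>) w)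
       = complex_of_real (\<Prod>i\<in>UNIV. sinc (real (\<alpha> $ i) * h $ i)) * char_torus (int_vec \<alpha>) \<theta> * cinner (a \<alpha>) w"
      unfolding scaleR_conv_of_real mult.assoc[symmetric] of_real_mult[symmetric] by metis
  qed
  also have "\<dots> = cinner (\<Sum>\<alpha>\<in>A. (\<Prod>i\<in>UNIV. sinc (real (\<alpha> $ i) * h $ i)) *\<^sub>R (char_torus (int_vec \<alpha>) \<theta> *\<^sub>C a \<alpha>)) w"
    by (simp only: cinner_sum_left cinner_scaleR_left cinner_scaleC_left scaleR_conv_of_real mult.assoc)
  finally show ?thesis .
qed

text \<open>By summability there are cubes \<open>Q (m k)\<close> off which every finite sum is at
  most \<open>(1/16) ^ Suc k\<close>; the block of \<open>\<alpha>\<close> is given by the first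
  cube that contains it.\<close>

lemma block_decomposition:
  fixes s :: "nat ^ 'n \<Rightarrow> real"
  assumes nn: "\<And>\<alpha>. 0 \<le> s \<alpha>" and summ: "s summable_on UNIV"
  obtains \<l> :: "nat ^ 'n \<Rightarrow> nat" and M :: real
  where "\<And>k. finite {\<alpha>. \<l> \<alpha> = k}" "\<And>k. sum s {\<alpha>. \<l> \<alpha> = k} \<le> M * (1/16) ^ k"
proof -
  define S where "S = infsum s UNIV"
  define Q where "Q m = {\<alpha> :: nat ^ 'n. \<forall>i. \<alpha> $ i \<in> {..<m}}" for m
  have finQ: "finite (Q m)" for m unfolding Q_def by (rule finite_vec_all) simp
  have leS: "sum s F \<le> S" if "finite F" for F
    unfolding S_def using that nn summ by (intro finite_sum_le_infsum) auto
  \<comment> \<open>\<open>m \<ge> Suc k\<close> makes the cubes exhaust the index set, so that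
    every \<open>\<alpha>\<close> has a block.\<close>
  have "\<exists>m \<ge> Suc k. \<forall>F. finite F \<longrightarrow> F \<inter> Q m = {} \<longrightarrow> sum s F \<le> (1/16) ^ Suc k" for k
  proof -
    have "(s has_sum S) UNIV" unfolding S_def using summ by (rule has_sum_infsum)
    then have "(sum s \<longlongrightarrow> S) (finite_subsets_at_top UNIV)" unfolding has_sum_def .
    then have "\<forall>\<^sub>F F in finite_subsets_at_top UNIV. S - (1/16) ^ Suc k < sum s F"
      by (rule order_tendstoD) simp
    then obtain F0 where F0: "finite F0" "\<And>F. finite F \<Longrightarrow> F0 \<subseteq> F \<Longrightarrow> S - (1/16) ^ Suc k < sum s F"
      by (auto simp: eventually_finite_subsets_at_top)
    have "finite ((\<lambda>(\<alpha>,i). \<alpha> $ i) ` (F0 \<times> (UNIV :: 'n set)))" using F0(1) by simp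
    then obtain m0 where m0: "\<forall>x\<in>(\<lambda>(\<alpha>,i). \<alpha> $ i) ` (F0 \<times> UNIV). x < m0"
      using finite_nat_set_iff_bounded by blast
    define m where "m = max m0 (Suc k)"
    have sub: "F0 \<subseteq> Q m"
    proof
      fix \<alpha> assume "\<alpha> \<in> F0"
      then have "\<alpha> $ i < m0" for i using m0 by auto
      then show "\<alpha> \<in> Q m" by (simp add: Q_def m_def less_max_iff_disj)
    qed
    have "sum s F \<le> (1/16) ^ Suc k" if "finite F" "F \<inter> Q m = {}" for F
    proof -
      have "sum s (F \<union> F0) = sum s F + sum s F0"
        using that sub F0(1) by (intro sum.union_disjoint) auto
      moreover have "sum s (F \<union> F0) \<le> S" using that F0(1) by (intro leS) auto
      moreover have "S - (1/16) ^ Suc k < sum s F0" using F0 by blast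
      ultimately show ?thesis by linarith
    qed
    then show ?thesis by (intro exI[of _ m]) (auto simp: m_def)
  qed
  then obtain m where m: "\<And>k. Suc k \<le> m k" "\<And>k F. finite F \<Longrightarrow> F \<inter> Q (m k) = {} \<Longrightarrow> sum s F \<le> (1/16) ^ Suc k"
    by metis
  define \<l> where "\<l> \<alpha> = (LEAST k. \<alpha> \<in> Q (m k))" for \<alpha>
  have ex: "\<exists>k. \<alpha> \<in> Q (m k)" for \<alpha>
  proof
    define k where "k = Max (range (vec_nth \<alpha>))"
    have "\<alpha> $ i \<le> k" for i unfolding k_def by (intro Max_ge) auto
    then show "\<alpha> \<in> Q (m k)" using m(1)[of k] by (auto simp: Q_def) (meson le_trans not_less_eq_eq not_le)
  qed
  have in_Q: "\<alpha> \<in> Q (m (\<l> \<alpha>))" for \<alpha> unfolding \<l>_def using ex[of \<alpha>] by (rule LeastI_ex)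
  have fin: "finite {\<alpha>. \<l> \<alpha> = k}" for k
    by (rule finite_subset[OF _ finQ[of "m k"]]) (use in_Q in auto)
  \<comment> \<open>Block \<open>Suc j\<close> avoids the cube \<open>Q (m j)\<close>, whose tail
    bound is already \<open>(1/16) ^ Suc j\<close>. Block 0 has no preceding cube and is bounded by
    the total sum, hence \<open>1 + S\<close>.\<close>
  have "sum s {\<alpha>. \<l> \<alpha> = k} \<le> (1 + S) * (1/16) ^ k" for k
  proof (cases k)
    case 0
    then show ?thesis using leS[OF fin[of k]] by simp
  next
    case (Suc j)
    have "{\<alpha>. \<l> \<alpha> = k} \<inter> Q (m j) = {}"
    proof -
      have "\<l> \<alpha> \<le> j" if "\<alpha> \<in> Q (m j)" for \<alpha> unfolding \<l>_def using that by (rule Least_le)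
      then show ?thesis using Suc by force
    qed
    then have "sum s {\<alpha>. \<l> \<alpha> = k} \<le> 1 * (1/16) ^ k" using m(2)[OF fin] Suc by simp
    also have "\<dots> \<le> (1 + S) * (1/16) ^ k"
      using leS[of "{}"] by (intro mult_right_mono) auto
    finally show ?thesis .
  qed
  with fin show thesis by (rule that)
qed

text \<open>The filter is arbitrary because both the limit along the smallest index and that as
  \<open>h\<close> tends to 0 are needed. The M-test gives uniform convergence of the series on the
  set where the bounds hold, and this allows the interchange of limits.\<close>

lemma tendsto_suminf_dominated:
  fixes a :: "nat \<Rightarrow> 'x \<Rightarrow> 'a::banach"
  assumes lim: "\<And>k. (a k \<longlongrightarrow> b k) F"
    and bound: "\<forall>\<^sub>F x in F. \<forall>k. norm (a k x) \<le> R k" "\<And>k. norm (b k) \<le> R k" and R: "summable R"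
  shows "((\<lambda>x. \<Sum>k. a k x) \<longlongrightarrow> suminf b) F"
proof (rule swap_uniform_limit'[where F = sequentially])
  show "\<forall>\<^sub>F n in sequentially. ((\<lambda>x. \<Sum>k<n. a k x) \<longlongrightarrow> (\<Sum>k<n. b k)) F"
    by (intro always_eventually allI tendsto_sum lim)
  have "summable b" using R bound(2) by (rule summable_comparison_test'[where N = 0])
  then show "(\<lambda>n. \<Sum>k<n. b k) \<longlonglongrightarrow> suminf b" by (rule summable_LIMSEQ)
  show "uniform_limit {x. \<forall>k. norm (a k x) \<le> R k} (\<lambda>n x. \<Sum>k<n. a k x) (\<lambda>x. \<Sum>k. a k x) sequentially"
    by (rule Weierstrass_m_test[OF _ R]) auto
  show "\<forall>\<^sub>F x in F. x \<in> {x. \<forall>k. norm (a k x) \<le> R k}" using bound(1) by simp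
qed simp

text \<open>A product of two terms is at most the square of the larger one. Through this inequality
  the square integral of \<open>G\<close> is bounded by a sum over the blocks.\<close>

lemma ennreal_SUP_square_le:
  fixes x :: "nat \<Rightarrow> ennreal"
  shows "(SUP k. x k)\<^sup>2 \<le> (\<Sum>k. (x k)\<^sup>2)"
proof -
  have sq: "x k * x k \<le> (\<Sum>k. (x k)\<^sup>2)" for k
    using sum_le_suminf[of "\<lambda>k. (x k)\<^sup>2" "{k}"] by (simp add: power2_eq_square)
  have "x k * x j \<le> (\<Sum>k. (x k)\<^sup>2)" for k j
  proof (cases "x k \<le> x j")
    case True
    then have "x k * x j \<le> x j * x j" by (rule mult_right_mono) simp
    then show ?thesis using sq order_trans by blast
  next
    case False
    then have "x k * x j \<le> x k * x k" by (intro mult_left_mono) auto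
    then show ?thesis using sq order_trans by blast
  qed
  then show ?thesis
    unfolding power2_eq_square SUP_mult_left_ennreal SUP_mult_right_ennreal[symmetric]
    by (simp add: SUP_mult_left_ennreal SUP_mult_right_ennreal SUP_le_iff power2_eq_square)
qed

theorem theorem6:
  fixes a :: "nat ^ 'n \<Rightarrow> 'h::chilbert_space"
    and f :: "real ^ 'n \<Rightarrow> 'h"
  assumes "a \<in> dirichlet_space"
    and "f \<in> L2_torus"
    and "has_fourier_series f a"
  shows "quasi_everywhere (\<lambda>\<theta>. \<exists>s. pringsheim_sums a \<theta> s \<and>
    ((\<lambda>h. box_mean f h \<theta>) \<longlongrightarrow> s) (at 0 within {h. \<forall>i. 0 < h $ i \<and> h $ i < pi}))"
proof -
  define g where "g \<alpha> = (\<Prod>i\<in>UNIV. sqrt (real (\<alpha> $ i) + 1)) *\<^sub>R a \<alpha>" for \<alpha>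
  have norm_g: "(norm (g \<alpha>))\<^sup>2 = (\<Prod>i\<in>UNIV. real (\<alpha> $ i) + 1) * (norm (a \<alpha>))\<^sup>2" for \<alpha>
    by (simp add: g_def power_mult_distrib prod_power_distrib)
  have a_le_g: "(norm (a \<alpha>))\<^sup>2 \<le> (norm (g \<alpha>))\<^sup>2" for \<alpha>
  proof -
    have "1 \<le> (\<Prod>i\<in>UNIV. real (\<alpha> $ i) + 1)" by (rule prod_ge_1) simp
    from mult_right_mono[OF this, of "(norm (a \<alpha>))\<^sup>2"] show ?thesis by (simp add: norm_g)
  qed
  have "(\<lambda>\<alpha>. (norm (g \<alpha>))\<^sup>2) summable_on UNIV"
    using assms(1) by (simp add: dirichlet_space_def norm_g)
  then obtain \<l> :: "nat ^ 'n \<Rightarrow> nat" and M where fin: "\<And>k. finite {\<alpha>. \<l> \<alpha> = k}"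
    and block: "\<And>k. (\<Sum>\<alpha> | \<l> \<alpha> = k. (norm (g \<alpha>))\<^sup>2) \<le> M * (1/16) ^ k"
    using block_decomposition[of "\<lambda>\<alpha>. (norm (g \<alpha>))\<^sup>2"] by auto
  define A where "A k = {\<alpha>. \<l> \<alpha> = k}" for k
  have finA: "finite (A k)" for k unfolding A_def by (rule fin)
  define u where "u k \<psi> = norm (trig_poly (A k) g \<psi>)" for k \<psi>
  \<comment> \<open>The weights \<open>2 ^ k\<close> turn finiteness of the potential of \<open>G\<close> into geometric decay of the blocks.\<close>
  define G where "G \<psi> = (SUP k. ennreal (2 ^ k * u k \<psi>))" for \<psi>
  have u_meas: "u k \<in> borel_measurable borel" for k unfolding u_def[abs_def] by measurable
  have G_meas: "G \<in> borel_measurable lebesgue"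
    unfolding G_def[abs_def] using u_meas by (intro measurable_torus_measureI borel_measurable_SUP) auto
  have M: "M \<ge> 0" using block[of 0] sum_nonneg[of "{\<alpha>. \<l> \<alpha> = 0}" "\<lambda>\<alpha>. (norm (g \<alpha>))\<^sup>2"] by simp
  \<comment> \<open>The \<open>k\<close>-th block contributes at most
    \<open>4 ^ k * (M * (1/16) ^ k)\<close>, the term of a convergent geometric series.\<close>
  have "(\<integral>\<^sup>+\<psi>. (G \<psi>)\<^sup>2 \<partial>torus_measure) \<le> (\<integral>\<^sup>+\<psi>. (\<Sum>k. (ennreal (2 ^ k * u k \<psi>))\<^sup>2) \<partial>torus_measure)"
    unfolding G_def by (intro nn_integral_mono ennreal_SUP_square_le)
  also have "\<dots> = (\<Sum>k. \<integral>\<^sup>+\<psi>. (ennreal (2 ^ k * u k \<psi>))\<^sup>2 \<partial>torus_measure)"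
  proof (rule nn_integral_suminf)
    fix k
    have "(\<lambda>\<psi>. (ennreal (2 ^ k * u k \<psi>))\<^sup>2) \<in> borel_measurable lebesgue"
      by (rule measurable_torus_measureI) (use u_meas[of k] in measurable)
    then show "(\<lambda>\<psi>. (ennreal (2 ^ k * u k \<psi>))\<^sup>2) \<in> borel_measurable torus_measure" by simp
  qed
  also have "\<dots> \<le> (\<Sum>k. ennreal (M * (1/4) ^ k))"
  proof (rule suminf_le)
    fix k
    have "(\<lambda>\<psi>. ennreal ((u k \<psi>)\<^sup>2)) \<in> borel_measurable lebesgue"
      by (rule measurable_torus_measureI) (use u_meas[of k] in measurable)
    then have m: "(\<lambda>\<psi>. ennreal ((u k \<psi>)\<^sup>2)) \<in> borel_measurable torus_measure" by simp
    have "(\<integral>\<^sup>+\<psi>. (ennreal (2 ^ k * u k \<psi>))\<^sup>2 \<partial>torus_measure) = (\<integral>\<^sup>+\<psi>. ennreal (4 ^ k) * ennreal ((u k \<psi>)\<^sup>2) \<partial>torus_measure)"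
    proof (rule nn_integral_cong)
      fix \<psi>
      have "(ennreal (2 ^ k * u k \<psi>))\<^sup>2 = ennreal ((2 ^ k * u k \<psi>)\<^sup>2)"
        by (rule ennreal_power) (simp add: u_def)
      also have "(2 ^ k * u k \<psi>)\<^sup>2 = 4 ^ k * (u k \<psi>)\<^sup>2"
        by (simp add: power_mult_distrib power2_eq_square flip: power_mult_distrib)
      finally show "(ennreal (2 ^ k * u k \<psi>))\<^sup>2 = ennreal (4 ^ k) * ennreal ((u k \<psi>)\<^sup>2)"
        by (simp add: ennreal_mult)
    qed
    also have "\<dots> = ennreal (4 ^ k) * (\<integral>\<^sup>+\<psi>. ennreal ((u k \<psi>)\<^sup>2) \<partial>torus_measure)"
      by (rule nn_integral_cmult[OF m])
    also have "\<dots> = ennreal (4 ^ k * (\<Sum>\<alpha>\<in>A k. (norm (g \<alpha>))\<^sup>2))"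
      unfolding u_def nn_integral_norm_trig_poly[OF finA] by (subst ennreal_mult) (auto intro: sum_nonneg)
    also have "\<dots> \<le> ennreal (4 ^ k * (M * (1/16) ^ k))"
      unfolding A_def by (intro ennreal_leI mult_left_mono block) simp
    also have "4 ^ k * (M * (1/16) ^ k) = M * (1/4) ^ k"
      by (simp add: power_mult_distrib[symmetric] mult.left_commute)
    finally show "(\<integral>\<^sup>+\<psi>. (ennreal (2 ^ k * u k \<psi>))\<^sup>2 \<partial>torus_measure) \<le> ennreal (M * (1/4) ^ k)" .
  qed auto
  also have "\<dots> < \<infinity>"
  proof -
    have "summable (\<lambda>k. M * (1/4::real) ^ k)" by (intro summable_mult summable_geometric) simp
    then show ?thesis using M by (subst suminf_ennreal2) auto
  qed
  finally have G_L2: "(\<integral>\<^sup>+\<psi>. (G \<psi>)\<^sup>2 \<partial>torus_measure) < \<infinity>" .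
  have "\<exists>s. pringsheim_sums a \<theta> s \<and>
    ((\<lambda>h. box_mean f h \<theta>) \<longlongrightarrow> s) (at 0 within {h. \<forall>i. 0 < h $ i \<and> h $ i < pi})"
    if \<theta>: "\<theta> \<in> torus" and BG: "B_potential G \<theta> < \<infinity>" for \<theta>
  proof -
    obtain b where b: "B_potential G \<theta> = ennreal b" "b \<ge> 0" using BG by (cases "B_potential G \<theta>") auto
    \<comment> \<open>\<open>24 ^ CARD('n)\<close> is one kernel constant per coordinate;
      \<open>(1/2) ^ k\<close> comes from
      \<open>u k \<psi> \<le> (1/2) ^ k * G \<psi>\<close>.\<close>
    define R where "R k = 24 ^ CARD('n) * ((1/2) ^ k * b)" for k :: nat
    have R: "summable R" unfolding R_def by (intro summable_mult summable_mult2 summable_geometric) simp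
    \<comment> \<open>One notation for three cases: the multiplier 1 gives the limit, cutoffs give
      the partial sums, and \<open>sinc\<close> gives the box means.\<close>
    define V where "V \<mu> k = (\<Sum>\<alpha>\<in>A k. (\<Prod>i\<in>UNIV. \<mu> i (\<alpha> $ i)) *\<^sub>R (char_torus (int_vec \<alpha>) \<theta> *\<^sub>C a \<alpha>))"
      for \<mu> :: "'n \<Rightarrow> nat \<Rightarrow> real" and k
    have V_le: "norm (V \<mu> k) \<le> R k" if "\<And>i. multiplier_bound (\<mu> i) 24" for \<mu> k
    proof -
      have "ennreal (norm (V \<mu> k)) \<le> ennreal 24 ^ CARD('n) * B_potential (\<lambda>\<psi>. ennreal (u k \<psi>)) \<theta>"
        unfolding V_def u_def g_def[abs_def] by (rule norm_multiplier_le_B_potential[OF finA that]) simp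
      also have "B_potential (\<lambda>\<psi>. ennreal (u k \<psi>)) \<theta> \<le> B_potential (\<lambda>\<psi>. ennreal ((1/2) ^ k) * G \<psi>) \<theta>"
        unfolding B_potential_def
      proof (intro nn_integral_mono mult_left_mono)
        fix \<psi>
        have "ennreal (u k \<psi>) = ennreal ((1/2) ^ k) * ennreal (2 ^ k * u k \<psi>)"
          by (simp add: ennreal_mult[symmetric] u_def power_one_over)
        also have "\<dots> \<le> ennreal ((1/2) ^ k) * G \<psi>"
          unfolding G_def by (intro mult_left_mono SUP_upper) auto
        finally show "ennreal (u k \<psi>) \<le> ennreal ((1/2) ^ k) * G \<psi>" .
      qed simp
      also have "\<dots> = ennreal ((1/2) ^ k) * B_potential G \<theta>"
        by (rule B_potential_cmult[OF G_meas])
      finally have "ennreal (norm (V \<mu> k)) \<le> ennreal 24 ^ CARD('n) * (ennreal ((1/2) ^ k) * ennreal b)"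
        by (simp add: b(1) mult_left_mono)
      also have "\<dots> = ennreal (R k)"
        using b(2) unfolding R_def by (subst ennreal_power) (simp_all add: ennreal_mult)
      finally show ?thesis using b(2) by (simp add: R_def)
    qed
    define s where "s = (\<Sum>k. V (\<lambda>_ _. 1) k)"
    have one: "multiplier_bound (\<lambda>_. 1) 24" by (rule multiplier_boundI) auto
    \<comment> \<open>Both limits of the theorem are instances: \<open>s\<close> depends neither on
      the filter nor on the multipliers, which need only tend to 1 pointwise under a uniform
      bound.\<close>
    have V_lim: "((\<lambda>x. \<Sum>k. V (\<mu> x) k) \<longlongrightarrow> s) F"
      if \<mu>: "\<forall>\<^sub>F x in F. \<forall>i. multiplier_bound (\<mu> x i) 24" and lim: "\<And>i m. ((\<lambda>x. \<mu> x i m) \<longlongrightarrow> 1) F"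
      for F :: "'x filter" and \<mu> :: "'x \<Rightarrow> 'n \<Rightarrow> nat \<Rightarrow> real"
      unfolding s_def
    proof (rule tendsto_suminf_dominated[OF _ _ V_le R])
      fix k
      show "((\<lambda>x. V (\<mu> x) k) \<longlongrightarrow> V (\<lambda>_ _. 1) k) F"
        unfolding V_def by (intro tendsto_intros lim)
      show "\<forall>\<^sub>F x in F. \<forall>k. norm (V (\<mu> x) k) \<le> R k"
        using \<mu> by (rule eventually_mono) (intro allI V_le, blast)
    qed (rule one)
    \<comment> \<open>A rectangle meets only finitely many blocks, so the series over the blocks is
      a finite regrouping of the partial sum.\<close>
    have partial: "rect_partial_sum a \<theta> N = (\<Sum>k. V (\<lambda>i m. of_bool (m \<le> N $ i)) k)" for N
    proof -
      define B where "B = {\<alpha> :: nat ^ 'n. \<forall>i. \<alpha> $ i \<le> N $ i}"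
      have finB: "finite B"
      proof (rule finite_subset)
        show "B \<subseteq> {\<alpha>. \<forall>i. \<alpha> $ i \<in> {..Max (range (vec_nth N))}}"
          by (auto simp: B_def intro: order_trans[OF _ Max_ge])
      qed (simp only: finite_vec_all finite_atMost)
      have V_eq: "V (\<lambda>i m. of_bool (m \<le> N $ i)) k = (\<Sum>\<alpha> | \<alpha> \<in> B \<and> \<l> \<alpha> = k. char_torus (int_vec \<alpha>) \<theta> *\<^sub>C a \<alpha>)" for k
        unfolding V_def of_bool_all_eq_prod[symmetric]
        by (rule sum.mono_neutral_cong_right[OF finA]) (auto simp: A_def B_def)
      have "(\<Sum>k. V (\<lambda>i m. of_bool (m \<le> N $ i)) k) = (\<Sum>k\<in>\<l> ` B. V (\<lambda>i m. of_bool (m \<le> N $ i)) k)"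
      proof (rule suminf_finite)
        fix k assume "k \<notin> \<l> ` B"
        then have "{\<alpha>. \<alpha> \<in> B \<and> \<l> \<alpha> = k} = {}" by auto
        then show "V (\<lambda>i m. of_bool (m \<le> N $ i)) k = 0" unfolding V_eq by (simp only: sum.empty)
      qed (simp add: finB)
      also have "\<dots> = (\<Sum>\<alpha>\<in>B. char_torus (int_vec \<alpha>) \<theta> *\<^sub>C a \<alpha>)"
        unfolding V_eq by (rule sum.group) (use finB in auto)
      also have "\<dots> = rect_partial_sum a \<theta> N"
        by (simp add: rect_partial_sum_def B_def char_torus_int_vec)
      finally show ?thesis by simp
    qed
    have "pringsheim_sums a \<theta> s"
      unfolding pringsheim_sums_def
    proof
      have "norm (rect_partial_sum a \<theta> N) \<le> suminf R" for N
        unfolding partial by (intro norm_suminf_le V_le multiplier_bound_cutoff R)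
      then show "bounded (range (rect_partial_sum a \<theta>))" by (auto simp: bounded_iff)
      show "(rect_partial_sum a \<theta> \<longlongrightarrow> s) (filtercomap (\<lambda>N. Min (range (\<lambda>j. N $ j))) at_top)"
        unfolding partial[abs_def]
      proof (rule V_lim)
        fix i m
        have "\<forall>\<^sub>F N in filtercomap (\<lambda>N. Min (range (\<lambda>j. N $ j))) at_top. m \<le> Min (range (\<lambda>j. (N :: nat ^ 'n) $ j))"
          by (intro eventually_filtercomapI eventually_ge_at_top)
        then have "\<forall>\<^sub>F N in filtercomap (\<lambda>N. Min (range (\<lambda>j. N $ j))) at_top. of_bool (m \<le> (N :: nat ^ 'n) $ i) = (1 :: real)"
          by (rule eventually_mono) simp
        then show "((\<lambda>N. of_bool (m \<le> (N :: nat ^ 'n) $ i)) \<longlongrightarrow> (1 :: real)) (filtercomap (\<lambda>N. Min (range (\<lambda>j. N $ j))) at_top)"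
          by (rule tendsto_eventually)
      qed (simp add: multiplier_bound_cutoff)
    qed
    moreover have "((\<lambda>h. box_mean f h \<theta>) \<longlongrightarrow> s) (at 0 within {h. \<forall>i. 0 < h $ i \<and> h $ i < pi})"
    proof -
      let ?H = "{h :: real ^ 'n. \<forall>i. 0 < h $ i \<and> h $ i < pi}"
      define S where "S h i m = sinc (real m * h $ i)" for h :: "real ^ 'n" and i m
      have inH: "\<forall>\<^sub>F h in at 0 within ?H. h \<in> ?H" by (simp add: eventually_at_filter)
      have S_bound: "multiplier_bound (S h i) 24" if "h \<in> ?H" for h i
        using that unfolding S_def[abs_def] by (intro multiplier_bound_sinc) auto
      \<comment> \<open>Both sides are compared after pairing with \<open>w\<close>, where the box
        integral of \<open>f\<close> splits into those of the blocks.\<close>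
      have mean: "box_mean f h \<theta> = (\<Sum>k. V (S h) k)" if h: "h \<in> ?H" for h
      proof (rule cinner_eqI)
        fix w
        define c where "c = pi ^ CARD('n) / (\<Prod>i\<in>UNIV. h $ i)"
        have h': "0 < h $ i \<and> h $ i < pi" for i using h by simp
        \<comment> \<open>The box identity involves the blocks of \<open>a\<close> itself; the
          weights are at least 1, so the decay passes from \<open>g\<close> to
          \<open>a\<close>.\<close>
        have dec: "(\<Sum>\<alpha>\<in>A k. (norm (a \<alpha>))\<^sup>2) \<le> M * (1/16) ^ k" for k
          using sum_mono[of "A k", OF a_le_g] block[of k] unfolding A_def by (rule order_trans)
        have "(\<lambda>k. \<integral>\<psi>. of_real (periodic_box \<theta> h \<psi>) * cinner (trig_poly (A k) a \<psi>) w \<partial>torus_measure)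
           sums (\<integral>\<psi>. of_real (periodic_box \<theta> h \<psi>) * cinner (f \<psi>) w \<partial>torus_measure)"
        proof (rule sums_integral_periodic_box[OF finA _ dec L2_torus_cinner_integrable[OF assms(2)]])
          show "\<exists>!k. \<alpha> \<in> A k" for \<alpha> by (simp add: A_def)
          show "(\<integral>\<psi>. char_torus (- \<kappa>) \<psi> * cinner (f \<psi>) w \<partial>torus_measure) =
             (if \<forall>i. 0 \<le> \<kappa> $ i then cinner (a (\<chi> i. nat (\<kappa> $ i))) w else 0)" for \<kappa>
            unfolding cinner_fourier_coeff[OF assms(2), symmetric]
            using assms(3) by (simp add: has_fourier_series_def cinner_zero_left)
        qed
        then have "(\<lambda>k. c *\<^sub>R (\<integral>\<psi>. of_real (periodic_box \<theta> h \<psi>) * cinner (trig_poly (A k) a \<psi>) w \<partial>torus_measure))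
           sums (c *\<^sub>R (\<integral>\<psi>. of_real (periodic_box \<theta> h \<psi>) * cinner (f \<psi>) w \<partial>torus_measure))"
          by (rule sums_scaleR_right)
        then have "(\<lambda>k. cinner (V (S h) k) w) sums cinner (box_mean f h \<theta>) w"
          unfolding c_def integral_periodic_box_trig_poly[OF finA \<theta> h'] cinner_box_mean[OF assms(2) \<theta> h', symmetric]
          by (simp add: V_def S_def)
        moreover have "(\<lambda>k. cinner (V (S h) k) w) sums cinner (\<Sum>k. V (S h) k) w"
        proof (rule bounded_linear.sums[OF bounded_linear_cinner_left])
          have "summable (V (S h))"
            by (rule summable_comparison_test'[OF R, where N = 0]) (intro V_le S_bound h)
          then show "V (S h) sums (\<Sum>k. V (S h) k)" by (rule summable_sums)
        qed
        ultimately show "cinner (box_mean f h \<theta>) w = cinner (\<Sum>k. V (S h) k) w" by (rule sums_unique2)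
      qed
      have "((\<lambda>h. \<Sum>k. V (S h) k) \<longlongrightarrow> s) (at 0 within ?H)"
      proof (rule V_lim)
        show "\<forall>\<^sub>F h in at 0 within ?H. \<forall>i. multiplier_bound (S h i) 24"
          using inH by (rule eventually_mono) (intro allI S_bound)
        fix i m
        have "((\<lambda>h. real m * h $ i) \<longlongrightarrow> real m * (0 :: real ^ 'n) $ i) (at 0 within ?H)"
          by (intro tendsto_intros)
        then have "filterlim (\<lambda>h :: real ^ 'n. real m * h $ i) (nhds 0) (at 0 within ?H)" by simp
        then show "((\<lambda>h. S h i m) \<longlongrightarrow> 1) (at 0 within ?H)"
          unfolding S_def by (rule filterlim_compose[OF tendsto_sinc_0])
      qed
      moreover have "\<forall>\<^sub>F h in at 0 within ?H. (\<Sum>k. V (S h) k) = box_mean f h \<theta>"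
        using inH by (rule eventually_mono) (simp add: mean)
      ultimately show ?thesis by (rule Lim_transform_eventually)
    qed
    ultimately show ?thesis by blast
  qed
  \<comment> \<open>The exceptional set consists of the points of infinite potential; it lies in the
    torus and has capacity zero.\<close>
  then show ?thesis
    unfolding quasi_everywhere_def
    using capacity_B_potential_top[OF G_meas G_L2]
    by (intro exI[of _ "{\<theta> \<in> torus. B_potential G \<theta> = \<infinity>}"]) (auto simp: less_top)
qed

end
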